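(* Let $k>2$ be an integer and let $K\subset\mathbb R^n$ be a nondegenerate $n$-simplex. A matrix field $\tau\in P_k^\ast(K;\mathbb S)$ is uniquely determined by the following degrees of freedom (i.e. they are unisolvent for $P_k^\ast(K;\mathbb S)$: they vanish simultaneously only for $\tau=0$, and their total number equals $\dim P_k^\ast(K;\mathbb S)$): (1) for each $\ell$-dimensional subsimplex $\triangle_\ell$ of $K$, $0\le\ell\le n-1$, with $\ell$ linearly independent tangential vectors $\mathbf t_1,\dots,\mathbf t_\ell$ and $n-\ell$ linearly independent normal vectors $\boldsymbol\nu_1,\dots,\boldsymbol\nu_{n-\ell}$, the mean moments of degree at most $k+n-\ell-2$ over $\triangle_\ell$ of $\mathbf t_l^T\tau\boldsymbol\nu_i$ and $\boldsymbol\nu_i^T\tau\boldsymbol\nu_j$, $l=1,\dots,\ell$, $i,j=1,\dots,n-\ell$; these are $\big(\binom{n+1-\ell}{2}+\ell(n-\ell)\big)\binom{k+n-2}\ell=\frac{(n-\ell)(n+\ell+1)}2\binom{k+n-2}\ell$ degrees of freedom for each $\triangle_\ell$; (2) the values $\int_K\tau:\theta\,dx$ for $\theta\in\epsilon(P_{k-1}(K;\mathbb R^n))$; $n\binom{n+k-1}{n}-\frac{n(n+1)}2$ degrees of freedom; (3) the values $\int_K\tau:\theta\,dx$ for $\theta\in M_k(K)$; $\frac{(k+2n-3)!}{n!(k+n-3)!}\frac{n(n+1)}2+\frac{n(n+1)}2-n\frac{(k+2n-2)!}{n!(k+n-2)!}$ degrees of freedom.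
   Context: $\mathbb S$ is the space of symmetric $n\times n$ real matrices; $P_m(K;X)$ is the space of $X$-valued polynomials of degree $\le m$ on $K$; $\operatorname{div}$ acts row-wise; $\epsilon(v)=(\nabla v+(\nabla v)^T)/2$ is the symmetric gradient. $\Sigma_{k+1\to k+n-1,DF}(K;\mathbb S)$ is the space of divergence-free $\mathbb S$-valued polynomials on $K$ that are sums of homogeneous polynomials of degrees $k+1,\dots,k+n-1$ (it is $\{0\}$ if $n=1$), and $$P_k^\ast(K;\mathbb S):=P_k(K;\mathbb S)+\Sigma_{k+1\to k+n-1,DF}(K;\mathbb S),\qquad M_k(K):=\{\tau\in P_k^\ast(K;\mathbb S):\operatorname{div}\tau=0,\ \tau\nu|_{\partial K}=0\},$$ where $\nu$ is the normal vector of $\partial K$. The moments of degree at most $m$ of a function $g$ over $\triangle_\ell$ are the integrals $\int_{\triangle_\ell}g\,q$ for $q$ in a basis of $P_m(\triangle_\ell;\mathbb R)$; for a vertex ($\ell=0$) the moment is the point value of $g$. *)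

theory Defs
  imports "HOL-Analysis.Analysis" "HOL-Library.Function_Algebras"
begin

text \<open>
  Pointwise scalar multiplication turns a function space into a real vector space, so that
  \<^const>\<open>dim\<close>, \<^const>\<open>span\<close> and \<^const>\<open>independent\<close> apply to spaces of polynomial fields.
\<close>

instantiation "fun" :: (type, real_vector) real_vector
begin

definition scaleR_fun :: "real \<Rightarrow> ('a \<Rightarrow> 'b) \<Rightarrow> 'a \<Rightarrow> 'b"
  where "scaleR_fun c f = (\<lambda>x. c *\<^sub>R f x)"

instance
  by standard (auto simp: scaleR_fun_def fun_eq_iff scaleR_add_right scaleR_add_left)

end

definition is_basis :: "'v::real_vector set \<Rightarrow> 'v set \<Rightarrow> bool"
  where "is_basis B V \<longleftrightarrow> B \<subseteq> V \<and> independent B \<and> V \<subseteq> span B"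

text \<open>
  A family \<open>d\<close> of functionals indexed by \<open>I\<close> is counted with its indices: no two degrees of
  freedom are silently identified.
\<close>

definition unisolvent :: "'v::real_vector set \<Rightarrow> 'i set \<Rightarrow> ('i \<Rightarrow> 'v \<Rightarrow> real) \<Rightarrow> bool"
  where "unisolvent V I d \<longleftrightarrow>
    finite I \<and> (\<forall>v\<in>V. (\<forall>i\<in>I. d i v = 0) \<longrightarrow> v = 0) \<and> card I = dim V"


subsection \<open>Polynomials\<close>

text \<open>
  Polynomials whose monomials have total degree in the finite set \<open>J\<close> and whose coefficients lie
  in the subspace \<open>X\<close>, i.e. sums of \<open>X\<close>-valued homogeneous polynomials of degrees \<open>j \<in> J\<close>.
  Since \<open>K\<close> has nonempty interior, a polynomial on \<open>K\<close> is identified with its unique polynomial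
  extension to the whole space; \<open>polys {..m} X\<close> is the space \<open>P\<^sub>m(K; X)\<close>.
\<close>

definition polys :: "nat set \<Rightarrow> 'x::real_vector set \<Rightarrow> (real^'n \<Rightarrow> 'x) set"
  where "polys J X =
    {\<lambda>x. \<Sum>\<alpha> | (\<Sum>i\<in>UNIV. \<alpha> i) \<in> J. (\<Prod>i\<in>UNIV. x $ i ^ \<alpha> i) *\<^sub>R c \<alpha> | c :: ('n \<Rightarrow> nat) \<Rightarrow> 'x. range c \<subseteq> X}"

text \<open>
  On a lower-dimensional simplex \<open>F\<close> the polynomial extension is not unique, so \<open>P\<^sub>m(F; \<real>)\<close>
  consists of the restrictions to \<open>F\<close>, encoded as functions vanishing outside \<open>F\<close>.
\<close>

definition polys_on :: "(real^'n) set \<Rightarrow> nat \<Rightarrow> (real^'n \<Rightarrow> real) set"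
  where "polys_on F m = (\<lambda>p x. if x \<in> F then p x else 0) ` polys {..m} UNIV"

definition sym_mats :: "(real^'n^'n) set"
  where "sym_mats = {A. transpose A = A}"

definition row_div :: "(real^'n \<Rightarrow> real^'n^'n) \<Rightarrow> real^'n \<Rightarrow> real^'n"
  where "row_div \<tau> x = (\<chi> i. trace (jacobian (\<lambda>y. \<tau> y $ i) (at x)))"

definition sym_grad :: "(real^'n \<Rightarrow> real^'n) \<Rightarrow> real^'n \<Rightarrow> real^'n^'n"
  where "sym_grad v x = (1 / 2) *\<^sub>R (jacobian v (at x) + transpose (jacobian v (at x)))"

definition Sigma_DF :: "nat set \<Rightarrow> (real^'n \<Rightarrow> real^'n^'n) set"
  where "Sigma_DF J = {\<tau> \<in> polys J sym_mats. \<forall>x. row_div \<tau> x = 0}"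

definition P_star :: "nat \<Rightarrow> (real^'n \<Rightarrow> real^'n^'n) set"
  where "P_star k =
    {\<sigma> + \<rho> | \<sigma> \<rho>. \<sigma> \<in> polys {..k} sym_mats \<and> \<rho> \<in> Sigma_DF {k + 1..k + CARD('n) - 1}}"


subsection \<open>Simplices\<close>

definition subsimplices :: "nat \<Rightarrow> (real^'n) set \<Rightarrow> (real^'n) set set"
  where "subsimplices l K = {F. F face_of K \<and> int l simplex F}"

definition tangent_space :: "(real^'n) set \<Rightarrow> (real^'n) set"
  where "tangent_space F = span {x - y | x y. x \<in> F \<and> y \<in> F}"

definition normal_vectors :: "(real^'n) set \<Rightarrow> (real^'n) set"
  where "normal_vectors F = (tangent_space F)\<^sup>\<bottom>"

definition lin_indep_vectors :: "(nat \<Rightarrow> real^'n) \<Rightarrow> nat \<Rightarrow> (real^'n) set \<Rightarrow> bool"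
  where "lin_indep_vectors v m W \<longleftrightarrow>
    v ` {1..m} \<subseteq> W \<and> inj_on v {1..m} \<and> independent (v ` {1..m})"

text \<open>
  Lebesgue measure on the affine hull of \<open>F\<close>, transported from Cartesian coordinates with
  respect to an origin in \<open>F\<close> and an orthonormal basis of the tangent space (the choice does not
  matter). If \<open>F\<close> is a single point, this is the unit mass there.
\<close>

definition flat_measure :: "(real^'n) set \<Rightarrow> (real^'n) measure"
  where "flat_measure F =
    (let a = (SOME a. a \<in> F);
         B = (SOME B. pairwise orthogonal B \<and> (\<forall>b\<in>B. norm b = 1) \<and> span B = tangent_space F)
     in distr (\<Pi>\<^sub>M b\<in>B. lborel) borel (\<lambda>c. a + (\<Sum>b\<in>B. c b *\<^sub>R b)))"

text \<open>\<open>\<tau> \<nu> = 0\<close> on the boundary is required facet by facet, for all normals of the facet.\<close>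

definition M_space :: "nat \<Rightarrow> (real^'n) set \<Rightarrow> (real^'n \<Rightarrow> real^'n^'n) set"
  where "M_space k K =
    {\<tau> \<in> P_star k. (\<forall>x. row_div \<tau> x = 0) \<and>
      (\<forall>F. F facet_of K \<longrightarrow> (\<forall>x\<in>F. \<forall>\<nu>\<in>normal_vectors F. \<tau> x *v \<nu> = 0))}"


subsection \<open>Degrees of freedom\<close>

text \<open>
  Indices: \<open>TN F l i q\<close> is the moment of \<open>t\<^sub>l\<^sup>T \<tau> \<nu>\<^sub>i\<close> against \<open>q\<close> over \<open>F\<close>; \<open>NN F i j q\<close> that of
  \<open>\<nu>\<^sub>i\<^sup>T \<tau> \<nu>\<^sub>j\<close>; the last two are the moments over \<open>K\<close> against basis elements of the symmetric
  gradients and of \<open>M\<^sub>k(K)\<close>.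
\<close>

datatype ('n::finite) dof =
    TN "(real^'n) set" nat nat "real^'n \<Rightarrow> real"
  | NN "(real^'n) set" nat nat "real^'n \<Rightarrow> real"
  | Strain "real^'n \<Rightarrow> real^'n^'n"
  | Bubble "real^'n \<Rightarrow> real^'n^'n"

text \<open>The Frobenius product \<open>\<tau> : \<theta>\<close> is the inner product of the type \<^typ>\<open>real^'n^'n\<close>.\<close>

fun dof_val :: "(real^'n) set \<Rightarrow> ((real^'n) set \<Rightarrow> nat \<Rightarrow> real^'n) \<Rightarrow> ((real^'n) set \<Rightarrow> nat \<Rightarrow> real^'n)
    \<Rightarrow> 'n dof \<Rightarrow> (real^'n \<Rightarrow> real^'n^'n) \<Rightarrow> real"
  where
    "dof_val K t \<nu> (TN F l i q) \<tau> = (LINT x:F|flat_measure F. (t F l \<bullet> (\<tau> x *v \<nu> F i)) * q x)"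
  | "dof_val K t \<nu> (NN F i j q) \<tau> = (LINT x:F|flat_measure F. (\<nu> F i \<bullet> (\<tau> x *v \<nu> F j)) * q x)"
  | "dof_val K t \<nu> (Strain \<theta>) \<tau> = (LINT x:K|lborel. \<tau> x \<bullet> \<theta> x)"
  | "dof_val K t \<nu> (Bubble \<theta>) \<tau> = (LINT x:K|lborel. \<tau> x \<bullet> \<theta> x)"

text \<open>
  By symmetry of \<open>\<tau>\<close>, the pairs \<open>(i, j)\<close> and \<open>(j, i)\<close> give the same normal-normal moment, so only
  \<open>i \<le> j\<close> is listed.
\<close>

definition face_dofs :: "((real^'n) set \<Rightarrow> (real^'n \<Rightarrow> real) set) \<Rightarrow> nat \<Rightarrow> (real^'n) set \<Rightarrow> 'n dof set"
  where "face_dofs Q d F =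
    {TN F l i q | l i q. l \<in> {1..d} \<and> i \<in> {1..CARD('n) - d} \<and> q \<in> Q F} \<union>
    {NN F i j q | i j q. i \<in> {1..CARD('n) - d} \<and> j \<in> {1..CARD('n) - d} \<and> i \<le> j \<and> q \<in> Q F}"

end

theory Submission
  imports Defs
begin

text \<open>
  Write \<open>n\<close> for the dimension and \<open>m = k + n - 1\<close>. Since divergence lowers degrees by one, the shape
  functions are exactly the symmetric matrix fields \<open>\<tau>\<close> of degree at most \<open>m\<close> whose divergence has
  degree at most \<open>k - 1\<close> (\<open>P_star_eq\<close>). Unisolvence then follows from an injectivity statement and a count.

  For injectivity, let all degrees of freedom vanish. The face moments are dual to what remains of a
  polynomial of degree \<open>m\<close> that vanishes on the boundary of a face: such a polynomial is the product of
  the \<open>d + 1\<close> barycentric coordinates of the face with a polynomial of degree \<open>m - (d + 1)\<close>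
  (\<open>polys_factor_on_face\<close>). Normals of a face are normals of its subfaces, so induction on \<open>d\<close> shows
  that \<open>\<tau> \<nu>\<close> vanishes on every face for all its normals \<open>\<nu>\<close>
  (\<open>face_moments_imp_normal_trace_zero\<close>). Integration by parts has no boundary term now, and the strain
  moments make \<open>div \<tau>\<close> orthogonal to all vector fields of degree \<open>k - 1\<close>, hence to itself. So \<open>\<tau>\<close> lies in
  \<open>M_space\<close>, and the last degrees of freedom make it orthogonal to itself.

  The count rests on the structure of fields with vanishing normal traces. With \<open>g\<^sub>a\<close> the gradient of
  the barycentric coordinate of the vertex \<open>a\<close>, a symmetric matrix is
  \<open>A = - \<Sum> (g\<^sub>a \<bullet> A g\<^sub>b) (b - a) (b - a)\<^sup>T\<close>, summed over the \<open>n (n + 1) / 2\<close> edges (\<open>sym_mats_expansion\<close>). A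
  field of degree \<open>m\<close> therefore has vanishing normal traces if and only if each coefficient is divisible
  by the barycentric coordinates of both end points of the edge (\<open>bubbles_coefficient\<close>). This gives the
  dimension of these fields, and it reduces integration by parts to the vanishing of
  \<open>\<integral> \<partial>(\<lambda>\<^sub>a \<lambda>\<^sub>b q) / \<partial>(b - a)\<close> over the simplex (\<open>simplex_integral_edge_derivative\<close>). A vector field \<open>v\<close> orthogonal to
  all divergences of such fields satisfies \<open>(b - a) \<bullet> \<epsilon>(v) (b - a) = 0\<close> for every edge, as one sees by
  testing with \<open>\<lambda>\<^sub>a \<lambda>\<^sub>b\<close> times this quantity; so it is a rigid motion
  (\<open>orthogonal_to_divergences_imp_rigid\<close>). Equality of the ranks on both sides of the pairing
  \<open>\<integral> div \<tau> \<bullet> v\<close> yields the dimension of \<open>M_space\<close> (\<open>dim_divergence_free_bubbles\<close>), and the affine vector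
  fields, which \<open>\<epsilon>\<close> maps onto the constant symmetric matrices, give \<open>n (n + 1) / 2\<close> for the rigid motions.

  Finally, rank-nullity for the divergence bounds the dimension of the shape functions from below
  (\<open>dim_P_star_ge\<close>), injectivity bounds it from above by the number of degrees of freedom, and a
  Vandermonde convolution (\<open>face_dof_count\<close>) shows that the two bounds agree.
\<close>

section \<open>Dimension counts in finite-dimensional subspaces\<close>

definition finite_dim :: "'v::real_vector set \<Rightarrow> bool"
  where "finite_dim V \<longleftrightarrow> (\<exists>S. finite S \<and> V \<subseteq> span S)"

text \<open>
  Differentiation and integration are linear only on the spaces of polynomials, not on the type of
  all functions; hence a relativised notion of linearity.
\<close>

definition linear_map_on :: "'v::real_vector set \<Rightarrow> ('v \<Rightarrow> 'w::real_vector) \<Rightarrow> bool"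
  where "linear_map_on V f \<longleftrightarrow>
    (\<forall>x\<in>V. \<forall>y\<in>V. f (x + y) = f x + f y) \<and> (\<forall>c. \<forall>x\<in>V. f (c *\<^sub>R x) = c *\<^sub>R f x)"

text \<open>
  Unlike independence of the image, this also says that the family has no repetitions, so that
  dimensions can be read off from the index set.
\<close>

definition indep_family :: "'i set \<Rightarrow> ('i \<Rightarrow> 'v::real_vector) \<Rightarrow> bool"
  where "indep_family I f \<longleftrightarrow> (\<forall>c. (\<Sum>i\<in>I. c i *\<^sub>R f i) = 0 \<longrightarrow> (\<forall>i\<in>I. c i = 0))"

lemma linear_map_onD:
  assumes "linear_map_on V f"
  shows "x \<in> V \<Longrightarrow> y \<in> V \<Longrightarrow> f (x + y) = f x + f y" and "x \<in> V \<Longrightarrow> f (c *\<^sub>R x) = c *\<^sub>R f x"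
  using assms by (auto simp: linear_map_on_def)

lemma linear_map_on_zero: "linear_map_on V f \<Longrightarrow> subspace V \<Longrightarrow> f 0 = 0"
  using linear_map_onD(2)[of V f 0 0] by (simp add: subspace_0)

lemma linear_map_on_sum:
  assumes "linear_map_on V f" "subspace V" "finite I" "\<And>i. i \<in> I \<Longrightarrow> g i \<in> V"
  shows "f (\<Sum>i\<in>I. c i *\<^sub>R g i) = (\<Sum>i\<in>I. c i *\<^sub>R f (g i))"
  using assms(3,4)
proof (induction I rule: finite_induct)
  case empty
  then show ?case using linear_map_on_zero[OF assms(1,2)] by simp
next
  case (insert i I)
  have "(\<Sum>i\<in>I. c i *\<^sub>R g i) \<in> V"
    using insert by (auto intro!: subspace_sum subspace_scale assms(2))
  moreover have "c i *\<^sub>R g i \<in> V" using insert by (auto intro!: subspace_scale assms(2))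
  ultimately show ?case
    using insert linear_map_onD[OF assms(1)] by simp
qed

lemma linear_map_on_subset: "linear_map_on V f \<Longrightarrow> U \<subseteq> V \<Longrightarrow> linear_map_on U f"
  unfolding linear_map_on_def by blast

lemma linear_map_on_compose:
  "linear_map_on V f \<Longrightarrow> linear_map_on W g \<Longrightarrow> f ` V \<subseteq> W \<Longrightarrow> linear_map_on V (\<lambda>x. g (f x))"
  unfolding linear_map_on_def by (metis image_subset_iff)

lemma subspace_kernel_on:
  "linear_map_on V f \<Longrightarrow> subspace V \<Longrightarrow> subspace {v \<in> V. f v = 0}"
  using linear_map_on_zero[of V f] by (auto simp: subspace_def linear_map_on_def)

lemma subspace_image_on:
  assumes "linear_map_on V f" "subspace V" shows "subspace (f ` V)"
  unfolding subspace_def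
proof (safe)
  show "0 \<in> f ` V"
    using linear_map_on_zero[OF assms] subspace_0[OF assms(2)] by (metis image_eqI)
  show "f x + f y \<in> f ` V" if "x \<in> V" "y \<in> V" for x y
    using that linear_map_onD(1)[OF assms(1)] subspace_add[OF assms(2)] by (metis image_eqI)
  show "c *\<^sub>R f x \<in> f ` V" if "x \<in> V" for x c
    using that linear_map_onD(2)[OF assms(1)] subspace_scale[OF assms(2)] by (metis image_eqI)
qed

lemma subspace_preimage_on:
  assumes f: "linear_map_on V f" and "subspace V" "subspace U"
  shows "subspace {v \<in> V. f v \<in> U}"
  using assms(2,3) linear_map_onD[OF f] linear_map_on_zero[OF f] by (auto simp: subspace_def)

lemma linear_map_on_set_integral:
  fixes g :: "'v::real_vector \<Rightarrow> 'x \<Rightarrow> real"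
  assumes "\<And>v. v \<in> V \<Longrightarrow> set_integrable M A (g v)" and "\<And>x. linear_map_on V (\<lambda>v. g v x)"
  shows "linear_map_on V (\<lambda>v. LINT x:A|M. g v x)"
  unfolding linear_map_on_def
proof (intro conjI ballI allI)
  fix u v c assume u: "u \<in> V"
  show "(LINT x:A|M. g (c *\<^sub>R u) x) = c *\<^sub>R (LINT x:A|M. g u x)"
    using linear_map_onD(2)[OF assms(2) u] by simp
  assume v: "v \<in> V"
  show "(LINT x:A|M. g (u + v) x) = (LINT x:A|M. g u x) + (LINT x:A|M. g v x)"
    using linear_map_onD(1)[OF assms(2) u v] set_integral_add(2)[OF assms(1)[OF u] assms(1)[OF v]] by simp
qed

lemma finite_dim_basis:
  assumes "finite_dim V"
  obtains B where "B \<subseteq> V" "independent B" "V \<subseteq> span B" "finite B" "card B = dim V"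
proof -
  obtain B where B: "B \<subseteq> V" "independent B" "V \<subseteq> span B" "card B = dim V"
    using basis_exists[of V] by metis
  moreover have "finite B"
    using assms B independent_span_bound unfolding finite_dim_def by (metis order_trans)
  ultimately show ?thesis using that by blast
qed

lemma finite_dim_subset: "finite_dim V \<Longrightarrow> U \<subseteq> V \<Longrightarrow> finite_dim U"
  unfolding finite_dim_def by blast

lemma dim_subset_finite_dim:
  assumes "finite_dim V" "U \<subseteq> V" shows "dim U \<le> dim V"
  by (metis assms dim_le_card finite_dim_basis order_trans)

lemma indep_family_imp:
  assumes "indep_family I f" "finite I"
  shows "inj_on f I" "independent (f ` I)"
proof -
  show inj: "inj_on f I"
  proof (rule inj_onI, rule ccontr)
    fix i j assume ij: "i \<in> I" "j \<in> I" "f i = f j" "i \<noteq> j"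
    let ?c = "\<lambda>l. if l = i then 1 else if l = j then - 1 else (0::real)"
    have "(\<Sum>l\<in>I. ?c l *\<^sub>R f l) = (\<Sum>l\<in>{i,j}. ?c l *\<^sub>R f l)"
      using ij assms(2) by (intro sum.mono_neutral_right) auto
    also have "\<dots> = 0" using ij by simp
    finally have "?c i = 0"
      using assms(1)[unfolded indep_family_def, rule_format, of ?c i] ij(1) by blast
    then show False by simp
  qed
  show "independent (f ` I)"
  proof (rule independent_if_scalars_zero)
    show "finite (f ` I)" using assms(2) by simp
    fix u x assume "(\<Sum>x\<in>f ` I. u x *\<^sub>R x) = 0" "x \<in> f ` I"
    then show "u x = 0"
      using assms(1) inj unfolding indep_family_def
      by (auto simp: sum.reindex)
  qed
qed

lemma indep_familyI_basis:
  assumes "independent B" "finite B"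
  shows "indep_family B (\<lambda>b. b)"
  using assms by (auto simp: indep_family_def independent_explicit_module)

lemma span_family:
  assumes "finite I"
  shows "span (f ` I) = {\<Sum>i\<in>I. c i *\<^sub>R f i | c. True}"
proof (rule span_unique)
  show "f ` I \<subseteq> {\<Sum>i\<in>I. c i *\<^sub>R f i |c. True}"
  proof safe
    fix i assume i: "i \<in> I"
    have "(\<Sum>l\<in>I. (if l = i then 1 else 0) *\<^sub>R f l) = f i"
      using i assms by (simp add: if_distrib[of "\<lambda>x. x *\<^sub>R _"] cong: if_cong)
    then show "\<exists>c. f i = (\<Sum>l\<in>I. c l *\<^sub>R f l) \<and> True" by metis
  qed
  show "subspace {\<Sum>i\<in>I. c i *\<^sub>R f i |c. True}"
    unfolding subspace_def
  proof safe
    show "\<exists>c. 0 = (\<Sum>i\<in>I. c i *\<^sub>R f i) \<and> True" by (rule exI[of _ "\<lambda>_. 0"]) simp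
    show "\<exists>c'. (\<Sum>i\<in>I. c i *\<^sub>R f i) + (\<Sum>i\<in>I. d i *\<^sub>R f i) = (\<Sum>i\<in>I. c' i *\<^sub>R f i) \<and> True" for c d
      by (rule exI[of _ "\<lambda>i. c i + d i"]) (simp add: scaleR_add_left sum.distrib)
    show "\<exists>c'. a *\<^sub>R (\<Sum>i\<in>I. c i *\<^sub>R f i) = (\<Sum>i\<in>I. c' i *\<^sub>R f i) \<and> True" for a c
      by (rule exI[of _ "\<lambda>i. a * c i"]) (simp add: scaleR_sum_right)
  qed
  show "{\<Sum>i\<in>I. c i *\<^sub>R f i |c. True} \<subseteq> T" if "f ` I \<subseteq> T" "subspace T" for T
    using that by (auto intro!: subspace_sum subspace_scale)
qed

lemma dim_indep_family:
  assumes "indep_family I f" "finite I" "V = {\<Sum>i\<in>I. c i *\<^sub>R f i | c. True}"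
  shows "dim V = card I" "finite_dim V" "subspace V"
proof -
  have V: "V = span (f ` I)" using assms span_family by blast
  show "dim V = card I"
    using V indep_family_imp[OF assms(1,2)] card_image dim_span dim_eq_card_independent by metis
  show "finite_dim V" "subspace V"
    using V assms(2) unfolding finite_dim_def by auto
qed

proposition rank_nullity_on:
  assumes f: "linear_map_on V f" and V: "subspace V" "finite_dim V"
  shows "dim V = dim {v \<in> V. f v = 0} + dim (f ` V)"
    and "finite_dim (f ` V)"
proof -
  let ?W = "{v \<in> V. f v = 0}"
  obtain B where B: "B \<subseteq> ?W" "independent B" "?W \<subseteq> span B" "finite B" "card B = dim ?W"
    using finite_dim_basis[OF finite_dim_subset[OF V(2), of ?W]] by blast
  obtain B' where B': "B \<subseteq> B'" "B' \<subseteq> V" "independent B'" "V \<subseteq> span B'"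
    using maximal_independent_subset_extend[of B V] B by blast
  have fB': "finite B'"
    using V(2) B' independent_span_bound unfolding finite_dim_def by (metis order_trans)
  have dV: "dim V = card B'"
    using B' basis_card_eq_dim by metis
  have span_B': "\<exists>c. v = (\<Sum>b\<in>B'. c b *\<^sub>R b)" if "v \<in> V" for v
    using that B'(4) span_family[OF fB', of "\<lambda>b. b"] by auto
  have ind: "indep_family (B' - B) f"
    unfolding indep_family_def
  proof (intro allI impI)
    fix c assume "(\<Sum>b\<in>B' - B. c b *\<^sub>R f b) = 0"
    then have "f (\<Sum>b\<in>B' - B. c b *\<^sub>R b) = 0"
      using linear_map_on_sum[OF f V(1), of "B' - B" "\<lambda>b. b" c] fB' B'(2) by auto
    moreover have "(\<Sum>b\<in>B' - B. c b *\<^sub>R b) \<in> V"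
      using B'(2) by (intro subspace_sum subspace_scale V(1)) auto
    ultimately have "(\<Sum>b\<in>B' - B. c b *\<^sub>R b) \<in> span B" using B(3) by blast
    then obtain d where d: "(\<Sum>b\<in>B' - B. c b *\<^sub>R b) = (\<Sum>b\<in>B. d b *\<^sub>R b)"
      using span_family[OF B(4), of "\<lambda>b. b"] by auto
    let ?e = "\<lambda>b. if b \<in> B then - d b else c b"
    have "(\<Sum>b\<in>B'. ?e b *\<^sub>R b) = (\<Sum>b\<in>B' - B. ?e b *\<^sub>R b) + (\<Sum>b\<in>B. ?e b *\<^sub>R b)"
      using sum.subset_diff[OF B'(1) fB'] by blast
    also have "(\<Sum>b\<in>B' - B. ?e b *\<^sub>R b) = (\<Sum>b\<in>B' - B. c b *\<^sub>R b)"
      by (rule sum.cong) auto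
    also have "(\<Sum>b\<in>B. ?e b *\<^sub>R b) = - (\<Sum>b\<in>B. d b *\<^sub>R b)"
      by (simp add: sum_negf)
    finally have "(\<Sum>b\<in>B'. ?e b *\<^sub>R b) = 0" using d by simp
    then have "\<forall>b\<in>B'. ?e b = 0"
      using indep_familyI_basis[OF B'(3) fB', unfolded indep_family_def, rule_format, of ?e] by blast
    then show "\<forall>b\<in>B' - B. c b = 0" by auto
  qed
  have im: "f ` V = {\<Sum>b\<in>B' - B. c b *\<^sub>R f b | c. True}"
  proof safe
    fix v assume "v \<in> V"
    then obtain c where "v = (\<Sum>b\<in>B'. c b *\<^sub>R b)" using span_B' by blast
    then have "f v = (\<Sum>b\<in>B'. c b *\<^sub>R f b)"
      using linear_map_on_sum[OF f V(1), of B' "\<lambda>b. b" c] fB' B'(2) by auto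
    also have "\<dots> = (\<Sum>b\<in>B' - B. c b *\<^sub>R f b)"
      using B(1) fB' by (intro sum.mono_neutral_right) auto
    finally show "\<exists>c. f v = (\<Sum>b\<in>B' - B. c b *\<^sub>R f b) \<and> True" by blast
  next
    fix c
    have "(\<Sum>b\<in>B' - B. c b *\<^sub>R f b) = f (\<Sum>b\<in>B' - B. c b *\<^sub>R b)"
      using linear_map_on_sum[OF f V(1), of "B' - B" "\<lambda>b. b" c] fB' B'(2)
      by (metis DiffD1 finite_Diff subsetD)
    moreover have "(\<Sum>b\<in>B' - B. c b *\<^sub>R b) \<in> V"
      using B'(2) by (intro subspace_sum subspace_scale V(1)) auto
    ultimately show "(\<Sum>b\<in>B' - B. c b *\<^sub>R f b) \<in> f ` V" by blast
  qed
  have "dim (f ` V) = card (B' - B)" "finite_dim (f ` V)"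
    using dim_indep_family[OF ind _ im] fB' by auto
  then show "dim V = dim ?W + dim (f ` V)" "finite_dim (f ` V)"
    using dV B(5) fB' B'(1) B(4) card_mono[OF fB' B'(1)] by (auto simp: card_Diff_subset)
qed

text \<open>By rank-nullity, restricting to the kernel of one scalar functional costs at most one dimension.\<close>

lemma dim_le_dim_annihilator:
  fixes \<phi> :: "'i \<Rightarrow> 'v::real_vector \<Rightarrow> real"
  assumes "finite I" "subspace V" "finite_dim V" "\<And>i. i \<in> I \<Longrightarrow> linear_map_on V (\<phi> i)"
  shows "dim V \<le> dim {v \<in> V. \<forall>i\<in>I. \<phi> i v = 0} + card I"
  using assms(1,4)
proof (induction I rule: finite_induct)
  case empty
  then show ?case by simp
next
  case (insert i I)
  let ?U = "{v \<in> V. \<forall>i\<in>I. \<phi> i v = 0}"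
  have lin: "linear_map_on V (\<phi> j)" if "j \<in> insert i I" for j using insert that by auto
  have U: "subspace ?U"
    using assms(2) linear_map_on_zero[OF lin assms(2)] linear_map_onD[OF lin]
    by (auto simp: subspace_def)
  have "linear_map_on ?U (\<phi> i)" by (rule linear_map_on_subset[OF lin]) auto
  moreover have "finite_dim ?U" by (rule finite_dim_subset[OF assms(3)]) auto
  ultimately have "dim ?U = dim {v \<in> ?U. \<phi> i v = 0} + dim (\<phi> i ` ?U)"
    using rank_nullity_on(1) U by blast
  moreover have "dim (\<phi> i ` ?U) \<le> 1"
    using dim_subset_UNIV[of "\<phi> i ` ?U"] by simp
  moreover have "{v \<in> ?U. \<phi> i v = 0} = {v \<in> V. \<forall>i\<in>insert i I. \<phi> i v = 0}" by auto
  ultimately show ?case using insert by simp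
qed

text \<open>
  One half of "row rank equals column rank": the functionals \<open>\<beta> b\<close> for \<open>b\<close> in a complement of the
  left kernel already cut out the right kernel.
\<close>

lemma pairing_rank_le:
  fixes \<beta> :: "'v::real_vector \<Rightarrow> 'w::real_vector \<Rightarrow> real"
  assumes V: "subspace V" "finite_dim V" and W: "subspace W" "finite_dim W"
    and l: "\<And>w. w \<in> W \<Longrightarrow> linear_map_on V (\<lambda>v. \<beta> v w)"
    and r: "\<And>v. v \<in> V \<Longrightarrow> linear_map_on W (\<beta> v)"
  shows "dim W + dim {v \<in> V. \<forall>w\<in>W. \<beta> v w = 0} \<le> dim {w \<in> W. \<forall>v\<in>V. \<beta> v w = 0} + dim V"
proof -
  let ?L = "{v \<in> V. \<forall>w\<in>W. \<beta> v w = 0}" and ?R = "{w \<in> W. \<forall>v\<in>V. \<beta> v w = 0}"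
  obtain B where B: "B \<subseteq> ?L" "independent B" "?L \<subseteq> span B" "finite B" "card B = dim ?L"
    using finite_dim_basis[OF finite_dim_subset[OF V(2), of ?L]] by blast
  obtain B' where B': "B \<subseteq> B'" "B' \<subseteq> V" "independent B'" "V \<subseteq> span B'"
    using maximal_independent_subset_extend[of B V] B by blast
  have fB': "finite B'"
    using V(2) B' independent_span_bound unfolding finite_dim_def by (metis order_trans)
  have dV: "dim V = card B'" using B' basis_card_eq_dim by metis
  have "dim W \<le> dim {w \<in> W. \<forall>b\<in>B' - B. \<beta> b w = 0} + card (B' - B)"
  proof (rule dim_le_dim_annihilator[OF _ W])
    show "finite (B' - B)" using fB' by simp
    show "linear_map_on W (\<beta> b)" if "b \<in> B' - B" for b
      using that B'(2) by (intro r) blast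
  qed
  moreover have "{w \<in> W. \<forall>b\<in>B' - B. \<beta> b w = 0} \<subseteq> ?R"
  proof (intro subsetI CollectI conjI ballI)
    fix w assume w': "w \<in> {w \<in> W. \<forall>b\<in>B' - B. \<beta> b w = 0}"
    then show "w \<in> W" by simp
    from w' have w: "w \<in> W" "\<forall>b\<in>B' - B. \<beta> b w = 0" by auto
    fix v assume v: "v \<in> V"
    then obtain c where c: "v = (\<Sum>b\<in>B'. c b *\<^sub>R b)"
      using B'(4) span_family[OF fB', of "\<lambda>b. b"] by auto
    have "\<beta> b w = 0" if "b \<in> B'" for b using that w B(1) by blast
    moreover have "\<beta> v w = (\<Sum>b\<in>B'. c b *\<^sub>R \<beta> b w)"
      using linear_map_on_sum[OF l[OF w(1)] V(1) fB', of "\<lambda>b. b" c] B'(2) c by auto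
    ultimately show "\<beta> v w = 0" by simp
  qed
  then have "dim {w \<in> W. \<forall>b\<in>B' - B. \<beta> b w = 0} \<le> dim ?R"
    by (rule dim_subset_finite_dim[rotated]) (rule finite_dim_subset[OF W(2)], blast)
  moreover have "card (B' - B) + dim ?L = dim V"
    using dV B(5) fB' B'(1) B(4) card_mono[OF fB' B'(1)] by (auto simp: card_Diff_subset)
  ultimately show ?thesis by linarith
qed

proposition pairing_rank:
  fixes \<beta> :: "'v::real_vector \<Rightarrow> 'w::real_vector \<Rightarrow> real"
  assumes V: "subspace V" "finite_dim V" and W: "subspace W" "finite_dim W"
    and l: "\<And>w. w \<in> W \<Longrightarrow> linear_map_on V (\<lambda>v. \<beta> v w)"
    and r: "\<And>v. v \<in> V \<Longrightarrow> linear_map_on W (\<beta> v)"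
  shows "dim W + dim {v \<in> V. \<forall>w\<in>W. \<beta> v w = 0} = dim {w \<in> W. \<forall>v\<in>V. \<beta> v w = 0} + dim V"
proof (rule antisym)
  show "dim W + dim {v \<in> V. \<forall>w\<in>W. \<beta> v w = 0} \<le> dim {w \<in> W. \<forall>v\<in>V. \<beta> v w = 0} + dim V"
    by (rule pairing_rank_le[where \<beta> = \<beta>, OF V W l r])
  have "dim V + dim {w \<in> W. \<forall>v\<in>V. \<beta> v w = 0} \<le> dim {v \<in> V. \<forall>w\<in>W. \<beta> v w = 0} + dim W"
    by (rule pairing_rank_le[where \<beta> = "\<lambda>w v. \<beta> v w", OF W V r l])
  then show "dim {w \<in> W. \<forall>v\<in>V. \<beta> v w = 0} + dim V \<le> dim W + dim {v \<in> V. \<forall>w\<in>W. \<beta> v w = 0}"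
    by linarith
qed

lemma exists_linear_map_with_kernel:
  fixes U Y :: "'v::real_vector set"
  assumes "subspace U" "U \<subseteq> Y" "finite_dim Y"
  obtains q :: "'v \<Rightarrow> 'v" where "linear q" "{y \<in> Y. q y = 0} = U"
proof -
  obtain B where B: "B \<subseteq> U" "independent B" "U \<subseteq> span B" "finite B"
    by (rule finite_dim_basis[OF finite_dim_subset[OF assms(3,2)]])
  have "B \<subseteq> Y" using B(1) assms(2) by (rule order_trans)
  then obtain B' where B': "B \<subseteq> B'" "B' \<subseteq> Y" "independent B'" "Y \<subseteq> span B'"
    using maximal_independent_subset_extend[of B Y] B(2) by blast
  have fB': "finite B'"
    using assms(3) B' independent_span_bound unfolding finite_dim_def by (metis order_trans)
  obtain q where q: "linear q" "\<forall>b\<in>B'. q b = (if b \<in> B then 0 else b)"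
    using linear_independent_extend[OF B'(3), of "\<lambda>b. if b \<in> B then 0 else b"] by blast
  have spB: "span B = U"
    using B assms(1) by (metis span_minimal subset_antisym)
  have qv: "q v = 0 \<longleftrightarrow> v \<in> U" if v: "v \<in> Y" for v
  proof
    assume "v \<in> U"
    then have "v \<in> span B" using B(3) by blast
    then show "q v = 0"
      using linear_eq_0_on_span[OF q(1), of B v] q(2) B'(1) by (metis subsetD)
  next
    assume 0: "q v = 0"
    obtain c where c: "v = (\<Sum>b\<in>B'. c b *\<^sub>R b)"
      using v B'(4) span_family[OF fB', of "\<lambda>b. b"] by auto
    have "q v = (\<Sum>b\<in>B'. (if b \<in> B then 0 else c b) *\<^sub>R b)"
      unfolding c linear_sum[OF q(1)] using q(2)
      by (intro sum.cong) (auto simp: linear_scale[OF q(1)])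
    then have "\<forall>b\<in>B'. (if b \<in> B then 0 else c b) = 0"
      using 0 indep_familyI_basis[OF B'(3) fB', unfolded indep_family_def, rule_format,
          of "\<lambda>b. if b \<in> B then 0 else c b"] by simp
    then have "\<forall>b\<in>B' - B. c b = 0" by auto
    then have "v = (\<Sum>b\<in>B. c b *\<^sub>R b)"
      unfolding c using fB' B'(1) by (intro sum.mono_neutral_right) auto
    then show "v \<in> U"
      using B(1) assms(1) by (auto intro!: subspace_sum subspace_scale)
  qed
  show ?thesis by (rule that[OF q(1)]) (use qv assms(2) in auto)
qed

text \<open>
  Composing \<open>f\<close> with a map on \<open>Y\<close> whose kernel is \<open>U\<close> turns the condition \<open>f v \<in> U\<close> into membership in a
  kernel, and the image of the composition has dimension at most \<open>dim Y - dim U\<close>.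
\<close>

lemma dim_preimage_ge:
  assumes f: "linear_map_on V f" "f ` V \<subseteq> Y" and V: "subspace V" "finite_dim V"
    and Y: "finite_dim Y" "subspace Y" and U: "subspace U" "U \<subseteq> Y"
  shows "dim V + dim U \<le> dim {v \<in> V. f v \<in> U} + dim Y"
proof -
  obtain q :: "'b \<Rightarrow> 'b" where q: "linear q" "{y \<in> Y. q y = 0} = U"
    using exists_linear_map_with_kernel[OF U Y(1)] by blast
  have lq: "linear_map_on Y q"
    using q(1) by (auto simp: linear_map_on_def linear_add linear_scale)
  have Yd: "dim Y = dim U + dim (q ` Y)" "finite_dim (q ` Y)"
    using rank_nullity_on[OF lq Y(2,1)] q(2) by auto
  let ?h = "\<lambda>v. q (f v)"
  have "linear_map_on V ?h" using linear_map_on_compose[OF f(1) lq f(2)] .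
  then have "dim V = dim {v \<in> V. ?h v = 0} + dim (?h ` V)"
    using rank_nullity_on(1) V by blast
  moreover have "dim (?h ` V) \<le> dim (q ` Y)"
    using f(2) by (intro dim_subset_finite_dim[OF Yd(2)]) auto
  moreover have "{v \<in> V. ?h v = 0} = {v \<in> V. f v \<in> U}" using q(2) f(2) by auto
  ultimately show ?thesis using Yd(1) by simp
qed

lemma is_basis_card:
  assumes "is_basis B V" "finite_dim V"
  shows "finite B" "card B = dim V"
proof -
  show "finite B"
    using assms independent_span_bound unfolding is_basis_def finite_dim_def by (metis order_trans)
  show "card B = dim V"
    using assms basis_card_eq_dim unfolding is_basis_def by metis
qed

lemma is_basis_annihilates:
  fixes \<phi> :: "'v::real_vector \<Rightarrow> real"
  assumes "is_basis B V" "finite_dim V" "subspace V" "linear_map_on V \<phi>"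
    and "\<And>b. b \<in> B \<Longrightarrow> \<phi> b = 0" and "v \<in> V"
  shows "\<phi> v = 0"
proof -
  have B: "finite B" "B \<subseteq> V" "V \<subseteq> span B"
    using assms is_basis_card unfolding is_basis_def by auto
  then obtain c where "v = (\<Sum>b\<in>B. c b *\<^sub>R b)"
    using assms(6) span_family[of B "\<lambda>b. b"] by auto
  then show ?thesis
    using linear_map_on_sum[OF assms(4,3) B(1), of "\<lambda>b. b" c] B(2) assms(5) by auto
qed

section \<open>Multi-indices and polynomials\<close>

lemma sum_fun: "(\<Sum>i\<in>I. f i) = (\<lambda>x. \<Sum>i\<in>I. f i x)"
  by (induction I rule: infinite_finite_induct) (auto simp: zero_fun_def plus_fun_def)

definition multi_indices :: "'a set \<Rightarrow> nat \<Rightarrow> ('a \<Rightarrow> nat) set"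
  where "multi_indices S m = {\<alpha>. (\<forall>v. v \<notin> S \<longrightarrow> \<alpha> v = 0) \<and> sum \<alpha> S = m}"

lemma multi_indices_insert:
  assumes "finite S" "v \<notin> S"
  shows "multi_indices (insert v S) (Suc m) =
    multi_indices S (Suc m) \<union> (\<lambda>\<alpha>. \<alpha>(v := Suc (\<alpha> v))) ` multi_indices (insert v S) m" (is "?L = ?A \<union> ?B")
proof (intro equalityI subsetI)
  fix \<alpha> assume \<alpha>: "\<alpha> \<in> ?L"
  show "\<alpha> \<in> ?A \<union> ?B"
  proof (cases "\<alpha> v")
    case 0
    then have "\<alpha> \<in> ?A" using \<alpha> assms by (auto simp: multi_indices_def) (metis)
    then show ?thesis by blast
  next
    case (Suc j)
    have "(\<Sum>w\<in>S. (\<alpha>(v := j)) w) = sum \<alpha> S"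
      using assms by (intro sum.cong) auto
    then have "\<alpha>(v := j) \<in> multi_indices (insert v S) m"
      using \<alpha> assms Suc by (auto simp: multi_indices_def)
    moreover have "\<alpha> = (\<lambda>\<alpha>. \<alpha>(v := Suc (\<alpha> v))) (\<alpha>(v := j))" using Suc by auto
    ultimately show ?thesis by blast
  qed
next
  fix \<alpha> assume "\<alpha> \<in> ?A \<union> ?B"
  then show "\<alpha> \<in> ?L"
  proof
    assume "\<alpha> \<in> ?A"
    then show ?thesis using assms by (auto simp: multi_indices_def)
  next
    assume "\<alpha> \<in> ?B"
    then obtain \<beta> where \<beta>: "\<beta> \<in> multi_indices (insert v S) m" "\<alpha> = \<beta>(v := Suc (\<beta> v))" by blast
    have "(\<Sum>w\<in>S. \<alpha> w) = sum \<beta> S"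
      using assms \<beta>(2) by (intro sum.cong) auto
    then show ?thesis using \<beta> assms by (auto simp: multi_indices_def)
  qed
qed

lemma multi_indices_0: "finite S \<Longrightarrow> multi_indices S 0 = {\<lambda>_. 0}"
  by (auto simp: multi_indices_def fun_eq_iff)

lemma finite_multi_indices:
  assumes "finite S" shows "finite (multi_indices S m)"
  using assms
proof (induction S arbitrary: m rule: finite_induct)
  case empty
  have "multi_indices {} m \<subseteq> {\<lambda>_::'a. 0}" by (auto simp: multi_indices_def)
  then show ?case using finite_subset by blast
next
  case (insert v S)
  show ?case
  proof (induction m)
    case 0
    then show ?case using insert multi_indices_0[of "insert v S"] by simp
  next
    case (Suc m)
    then show ?case using insert multi_indices_insert[OF insert(1,2)] by simp
  qed
qed

lemma card_multi_indices:
  assumes "finite S" "S \<noteq> {}"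
  shows "card (multi_indices S m) = (m + card S - 1) choose m"
  using assms
proof (induction S arbitrary: m rule: finite_ne_induct)
  case (singleton x)
  have "multi_indices {x} m = {\<lambda>v. if v = x then m else 0}"
    by (auto simp: multi_indices_def fun_eq_iff)
  then show ?case by simp
next
  case (insert v S)
  show ?case
  proof (induction m)
    case 0
    then show ?case using insert multi_indices_0[of "insert v S"] by simp
  next
    case (Suc m)
    let ?f = "\<lambda>\<alpha>::'a \<Rightarrow> nat. \<alpha>(v := Suc (\<alpha> v))"
    have "inj ?f" by (rule injI) (metis fun_upd_apply fun_upd_triv fun_upd_upd old.nat.inject)
    moreover have "multi_indices S (Suc m) \<inter> ?f ` multi_indices (insert v S) m = {}"
      using insert by (force simp: multi_indices_def)
    ultimately have "card (multi_indices (insert v S) (Suc m)) =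
        card (multi_indices S (Suc m)) + card (multi_indices (insert v S) m)"
      unfolding multi_indices_insert[OF insert(1,3)]
      using finite_multi_indices insert(1)
      by (subst card_Un_disjoint) (auto simp: card_image inj_on_subset)
    also have "\<dots> = ((Suc m + card S - 1) choose Suc m) + ((m + card (insert v S) - 1) choose m)"
      using insert.IH Suc by simp
    also have "\<dots> = (Suc m + card (insert v S) - 1) choose Suc m"
      using insert by simp
    finally show ?case .
  qed
qed

text \<open>
  Power products with distinct exponents are independent even on the positive orthant: for fixed
  values of the other variables, a polynomial in one variable has infinitely many roots.
\<close>

lemma power_products_independent:
  fixes c :: "('a \<Rightarrow> nat) \<Rightarrow> real"
  assumes "finite S" "finite A" "\<And>\<alpha> v. \<alpha> \<in> A \<Longrightarrow> v \<notin> S \<Longrightarrow> \<alpha> v = 0"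
    and "\<And>s. (\<And>v. s v > 0) \<Longrightarrow> (\<Sum>\<alpha>\<in>A. c \<alpha> * (\<Prod>v\<in>S. s v ^ \<alpha> v)) = 0"
    and "\<alpha> \<in> A"
  shows "c \<alpha> = 0"
  using assms
proof (induction S arbitrary: A c \<alpha> rule: finite_induct)
  case empty
  have "\<beta> = \<alpha>" if "\<beta> \<in> A" for \<beta>
    using that empty(2)[of \<beta>] empty(2)[OF empty(4)] by (auto simp: fun_eq_iff)
  then have "A = {\<alpha>}" using empty(4) by blast
  then show ?case using empty(3)[of "\<lambda>_. 1"] by simp
next
  case (insert v S)
  let ?j = "\<alpha> v"
  let ?A = "{\<beta> \<in> A. \<beta> v = ?j}"
  let ?z = "\<lambda>\<beta>::'a \<Rightarrow> nat. \<beta>(v := 0)"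
  define N where "N = Max ((\<lambda>\<beta>. \<beta> v) ` A)"
  have N: "\<beta> v \<le> N" if "\<beta> \<in> A" for \<beta> using that insert(4) by (simp add: N_def)
  let ?c = "\<lambda>\<gamma>. c (\<gamma>(v := ?j))"
  have upd: "\<beta>(v := 0, v := ?j) = \<beta>" if "\<beta> \<in> ?A" for \<beta> using that by auto
  have inj: "inj_on ?z ?A" by (rule inj_on_inverseI[where g = "\<lambda>\<gamma>. \<gamma>(v := ?j)"]) (rule upd)
  have "?c (?z \<alpha>) = 0"
  proof (rule insert.IH[of "?z ` ?A" ?c "?z \<alpha>"])
    show "finite (?z ` ?A)" using insert by simp
    show "\<gamma> w = 0" if "\<gamma> \<in> ?z ` ?A" "w \<notin> S" for \<gamma> w using that insert(5) by auto
    show "?z \<alpha> \<in> ?z ` ?A" using insert(7) by auto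
    fix s :: "'a \<Rightarrow> real" assume s: "\<And>v. s v > 0"
    let ?p = "\<lambda>\<beta>. \<Prod>w\<in>S. s w ^ \<beta> w"
    have "(\<Sum>j\<le>N. (\<Sum>\<beta> | \<beta> \<in> A \<and> \<beta> v = j. c \<beta> * ?p \<beta>) * y ^ j) = 0" if y: "y > 0" for y
    proof -
      have "0 = (\<Sum>\<beta>\<in>A. c \<beta> * (\<Prod>w\<in>insert v S. (s(v := y)) w ^ \<beta> w))"
        using insert(6)[of "s(v := y)"] s y by simp
      also have "\<dots> = (\<Sum>\<beta>\<in>A. c \<beta> * ?p \<beta> * y ^ \<beta> v)"
      proof (rule sum.cong[OF refl])
        fix \<beta>
        have "(\<Prod>w\<in>S. (s(v := y)) w ^ \<beta> w) = ?p \<beta>"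
          using insert(2) by (intro prod.cong) auto
        then show "c \<beta> * (\<Prod>w\<in>insert v S. (s(v := y)) w ^ \<beta> w) = c \<beta> * ?p \<beta> * y ^ \<beta> v"
          using insert by simp
      qed
      also have "\<dots> = (\<Sum>j\<le>N. \<Sum>\<beta> | \<beta> \<in> A \<and> \<beta> v = j. c \<beta> * ?p \<beta> * y ^ \<beta> v)"
        using insert(4) N by (intro sum.group[symmetric]) auto
      also have "\<dots> = (\<Sum>j\<le>N. (\<Sum>\<beta> | \<beta> \<in> A \<and> \<beta> v = j. c \<beta> * ?p \<beta>) * y ^ j)"
        by (intro sum.cong refl) (auto simp: sum_distrib_right intro!: sum.cong)
      finally show ?thesis by simp
    qed
    then have "{0<..} \<subseteq> {y. (\<Sum>j\<le>N. (\<Sum>\<beta> | \<beta> \<in> A \<and> \<beta> v = j. c \<beta> * ?p \<beta>) * y ^ j) = 0}" by auto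
    then have "infinite {y. (\<Sum>j\<le>N. (\<Sum>\<beta> | \<beta> \<in> A \<and> \<beta> v = j. c \<beta> * ?p \<beta>) * y ^ j) = 0}"
      using infinite_Ioi finite_subset by blast
    then have "(\<Sum>\<beta> | \<beta> \<in> A \<and> \<beta> v = ?j. c \<beta> * ?p \<beta>) = 0"
      using polyfun_finite_roots[of "\<lambda>j. \<Sum>\<beta> | \<beta> \<in> A \<and> \<beta> v = j. c \<beta> * ?p \<beta>" N] N[OF insert(7)] by blast
    moreover have "(\<Sum>\<gamma>\<in>?z ` ?A. ?c \<gamma> * (\<Prod>w\<in>S. s w ^ \<gamma> w)) = (\<Sum>\<beta>\<in>?A. c \<beta> * ?p \<beta>)"
      unfolding sum.reindex[OF inj]
    proof (rule sum.cong[OF refl])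
      fix \<beta> assume \<beta>: "\<beta> \<in> ?A"
      have "(\<Prod>w\<in>S. s w ^ (?z \<beta>) w) = ?p \<beta>"
        using insert(2) by (intro prod.cong) auto
      then show "((\<lambda>\<gamma>. ?c \<gamma> * (\<Prod>w\<in>S. s w ^ \<gamma> w)) \<circ> ?z) \<beta> = c \<beta> * ?p \<beta>"
        using upd[OF \<beta>] by simp
    qed
    ultimately show "(\<Sum>\<gamma>\<in>?z ` ?A. ?c \<gamma> * (\<Prod>w\<in>S. s w ^ \<gamma> w)) = 0" by simp
  qed
  then show ?case by simp
qed

definition mon :: "('n \<Rightarrow> nat) \<Rightarrow> real^'n \<Rightarrow> real"
  where "mon \<alpha> x = (\<Prod>i\<in>UNIV. x $ i ^ \<alpha> i)"

abbreviation exponents :: "nat set \<Rightarrow> ('n::finite \<Rightarrow> nat) set"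
  where "exponents J \<equiv> {\<alpha>. (\<Sum>i\<in>UNIV. \<alpha> i) \<in> J}"

lemma finite_exponents: "finite J \<Longrightarrow> finite (exponents J :: ('n::finite \<Rightarrow> nat) set)"
proof -
  assume "finite J"
  moreover have "exponents J = (\<Union>j\<in>J. multi_indices (UNIV :: 'n set) j)"
    by (auto simp: multi_indices_def)
  ultimately show ?thesis by (simp add: finite_multi_indices)
qed

lemma polys_eq: "polys J X = {\<lambda>x. \<Sum>\<alpha>\<in>exponents J. mon \<alpha> x *\<^sub>R c \<alpha> | c. range c \<subseteq> X}"
  by (simp add: polys_def mon_def)

lemma subspace_polys:
  assumes "subspace X" shows "subspace (polys J X :: (real^'n \<Rightarrow> _) set)"
  unfolding subspace_def
proof (intro conjI ballI allI)
  show "(0 :: real^'n \<Rightarrow> 'a) \<in> polys J X"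
    unfolding polys_eq using subspace_0[OF assms]
    by (auto simp: zero_fun_def intro!: exI[of _ "\<lambda>_. 0"])
  fix p :: "real^'n \<Rightarrow> 'a" assume "p \<in> polys J X"
  then obtain c where c: "range c \<subseteq> X" "p = (\<lambda>x. \<Sum>\<alpha>\<in>exponents J. mon \<alpha> x *\<^sub>R c \<alpha>)"
    unfolding polys_eq by blast
  show "a *\<^sub>R p \<in> polys J X" for a
    unfolding polys_eq c(2)
    by (intro CollectI exI[of _ "\<lambda>\<alpha>. a *\<^sub>R c \<alpha>"])
      (use c(1) subspace_scale[OF assms] in \<open>auto simp: scaleR_fun_def scaleR_sum_right ac_simps\<close>)
  fix q :: "real^'n \<Rightarrow> 'a" assume "q \<in> polys J X"
  then obtain d where d: "range d \<subseteq> X" "q = (\<lambda>x. \<Sum>\<alpha>\<in>exponents J. mon \<alpha> x *\<^sub>R d \<alpha>)"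
    unfolding polys_eq by blast
  show "p + q \<in> polys J X"
    unfolding polys_eq c(2) d(2)
    by (intro CollectI exI[of _ "\<lambda>\<alpha>. c \<alpha> + d \<alpha>"])
      (use c(1) d(1) subspace_add[OF assms] in
        \<open>auto simp: plus_fun_def scaleR_add_right sum.distrib\<close>)
qed

lemma polys_sum:
  fixes p :: "'i \<Rightarrow> real^'n \<Rightarrow> 'x::real_vector"
  assumes "subspace X" "\<And>i. i \<in> I \<Longrightarrow> p i \<in> polys J X"
  shows "(\<lambda>x. \<Sum>i\<in>I. p i x) \<in> polys J X"
  unfolding sum_fun[symmetric] using assms by (intro subspace_sum subspace_polys)

lemma polys_add:
  fixes p q :: "real^'n \<Rightarrow> 'x::real_vector"
  shows "subspace X \<Longrightarrow> p \<in> polys J X \<Longrightarrow> q \<in> polys J X \<Longrightarrow> (\<lambda>x. p x + q x) \<in> polys J X"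
  using subspace_add[OF subspace_polys, of X p J q] by (simp add: plus_fun_def)

lemma polys_linear_image:
  assumes "p \<in> polys J X" "linear \<psi>" "\<psi> ` X \<subseteq> Y"
  shows "(\<lambda>x. \<psi> (p x)) \<in> polys J Y"
proof -
  obtain c where c: "range c \<subseteq> X" "p = (\<lambda>x. \<Sum>\<alpha>\<in>exponents J. mon \<alpha> x *\<^sub>R c \<alpha>)"
    using assms(1) unfolding polys_eq by blast
  show ?thesis unfolding polys_eq c(2)
    by (intro CollectI exI[of _ "\<lambda>\<alpha>. \<psi> (c \<alpha>)"])
      (use c(1) assms(3) in \<open>auto simp: linear_sum[OF assms(2)] linear_scale[OF assms(2)]\<close>)
qed

lemma polys_scaleR:
  fixes p :: "real^'n \<Rightarrow> real"
  assumes "p \<in> polys J UNIV" "subspace X" "c \<in> X"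
  shows "(\<lambda>x. p x *\<^sub>R c) \<in> polys J X"
proof (rule polys_linear_image[OF assms(1)])
  show "linear (\<lambda>r. r *\<^sub>R c)" by (simp add: linear_iff scaleR_add_left)
  show "(\<lambda>r. r *\<^sub>R c) ` UNIV \<subseteq> X" using assms(2,3) subspace_scale by blast
qed

lemma polys_cmult: "(p :: real^'n \<Rightarrow> real) \<in> polys J UNIV \<Longrightarrow> (\<lambda>x. c * p x) \<in> polys J UNIV"
  by (rule polys_linear_image) (auto simp: linear_iff algebra_simps)

lemma polys_mono:
  assumes "J \<subseteq> J'" "finite J'" "0 \<in> X" "X \<subseteq> X'"
  shows "polys J X \<subseteq> polys J' X'"
proof
  fix p assume "p \<in> polys J X"
  then obtain c where c: "range c \<subseteq> X" "p = (\<lambda>x. \<Sum>\<alpha>\<in>exponents J. mon \<alpha> x *\<^sub>R c \<alpha>)"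
    unfolding polys_eq by blast
  have "p = (\<lambda>x. \<Sum>\<alpha>\<in>exponents J'. mon \<alpha> x *\<^sub>R (if \<alpha> \<in> exponents J then c \<alpha> else 0))"
    unfolding c(2)
  proof
    fix x
    show "(\<Sum>\<alpha>\<in>exponents J. mon \<alpha> x *\<^sub>R c \<alpha>) =
      (\<Sum>\<alpha>\<in>exponents J'. mon \<alpha> x *\<^sub>R (if \<alpha> \<in> exponents J then c \<alpha> else 0))"
      using finite_exponents[OF assms(2)] assms(1) by (intro sum.mono_neutral_cong_left) auto
  qed
  then show "p \<in> polys J' X'" unfolding polys_eq
    by (intro CollectI exI[of _ "\<lambda>\<alpha>. if \<alpha> \<in> exponents J then c \<alpha> else 0"])
      (use c(1) assms in auto)
qed

lemma polys_real_eq_span: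
  assumes "finite J"
  shows "(polys J UNIV :: (real^'n \<Rightarrow> real) set) = span (mon ` exponents J)"
  unfolding span_family[OF finite_exponents[OF assms]] polys_eq sum_fun
  by (simp add: scaleR_fun_def mult.commute)

lemma mon_in_polys: "finite J \<Longrightarrow> (\<Sum>i\<in>UNIV. \<alpha> i) \<in> J \<Longrightarrow> mon \<alpha> \<in> polys J UNIV"
  by (auto simp: polys_real_eq_span intro!: span_base)

lemma span_times:
  fixes C :: "('a \<Rightarrow> real) set"
  assumes "\<And>a b. a \<in> A \<Longrightarrow> b \<in> B \<Longrightarrow> (\<lambda>x. a x * b x) \<in> span C"
    and p: "p \<in> span A" and q: "q \<in> span B"
  shows "(\<lambda>x. p x * q x) \<in> span C"
  using p
proof (induction rule: span_induct_alt)
  case base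
  then show ?case using span_zero[of C] by (simp add: zero_fun_def)
next
  case (step c a p)
  have "(\<lambda>x. a x * q x) \<in> span C" using q
  proof (induction rule: span_induct_alt)
    case base
    then show ?case using span_zero[of C] by (simp add: zero_fun_def)
  next
    case (step d b q)
    have "d *\<^sub>R (\<lambda>x. a x * b x) + (\<lambda>x. a x * q x) \<in> span C"
      using step assms(1) \<open>a \<in> A\<close> by (intro span_add span_scale) auto
    then show ?case by (simp add: plus_fun_def scaleR_fun_def algebra_simps)
  qed
  then have "c *\<^sub>R (\<lambda>x. a x * q x) + (\<lambda>x. p x * q x) \<in> span C"
    using step by (intro span_add span_scale) auto
  then show ?case by (simp add: plus_fun_def scaleR_fun_def algebra_simps)
qed

lemma polys_mult:
  fixes p q :: "real^'n \<Rightarrow> real"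
  assumes "p \<in> polys {..a} UNIV" "q \<in> polys {..b} UNIV"
  shows "(\<lambda>x. p x * q x) \<in> polys {..a + b} UNIV"
  unfolding polys_real_eq_span[OF finite_atMost]
proof (rule span_times[OF _ assms[unfolded polys_real_eq_span[OF finite_atMost]]])
  fix f g :: "real^'n \<Rightarrow> real"
  assume "f \<in> mon ` exponents {..a}" "g \<in> mon ` exponents {..b}"
  then obtain \<alpha> \<beta> where f: "f = mon \<alpha>" "\<alpha> \<in> exponents {..a}" and g: "g = mon \<beta>" "\<beta> \<in> exponents {..b}"
    by blast
  have "(\<lambda>x. f x * g x) = mon (\<lambda>i. \<alpha> i + \<beta> i)"
    by (simp add: f g mon_def power_add prod.distrib fun_eq_iff)
  moreover have "(\<lambda>i. \<alpha> i + \<beta> i) \<in> exponents {..a + b}"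
    using f g by (simp add: sum.distrib)
  ultimately show "(\<lambda>x. f x * g x) \<in> span (mon ` exponents {..a + b})"
    by (intro span_base) (rule image_eqI)
qed

lemma polys_const: "c \<in> X \<Longrightarrow> subspace X \<Longrightarrow> (\<lambda>_. c) \<in> polys {..m} X"
proof -
  assume c: "c \<in> X" "subspace X"
  have "mon (\<lambda>_. 0) \<in> polys {..m} UNIV" by (rule mon_in_polys) auto
  from polys_scaleR[OF this c(2,1)] show ?thesis by (simp add: mon_def)
qed

lemma polys_inner: "(\<lambda>x::real^'n. g \<bullet> x) \<in> polys {..1} UNIV"
proof -
  have "(\<lambda>x. x $ i) \<in> polys {..1} UNIV" for i :: 'n
  proof -
    have "mon (\<lambda>j. if j = i then 1 else 0) \<in> polys {..1} UNIV" by (rule mon_in_polys) simp_all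
    moreover have "mon (\<lambda>j. if j = i then 1 else 0) x = x $ i" for x :: "real^'n"
    proof -
      have "mon (\<lambda>j. if j = i then 1 else 0) x = (\<Prod>j\<in>UNIV. if j = i then x $ j else 1)"
        unfolding mon_def by (intro prod.cong) auto
      then show ?thesis by simp
    qed
    then have "mon (\<lambda>j. if j = i then 1 else 0) = (\<lambda>x::real^'n. x $ i)" by blast
    ultimately show ?thesis by simp
  qed
  then show ?thesis unfolding inner_vec_def inner_real_def
    by (intro polys_sum polys_cmult) auto
qed

lemma polys_affine: "(\<lambda>x::real^'n. a + g \<bullet> x) \<in> polys {..1} UNIV"
  using polys_const[of a UNIV 1] by (intro polys_add polys_inner) auto

lemma polys_power:
  fixes p :: "real^'n \<Rightarrow> real"
  assumes "p \<in> polys {..1} UNIV" shows "(\<lambda>x. p x ^ m) \<in> polys {..m} UNIV"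
proof (induction m)
  case 0
  then show ?case using polys_const[of 1 UNIV 0] by simp
next
  case (Suc m)
  then show ?case using polys_mult[OF assms Suc] by simp
qed

lemma polys_prod:
  fixes p :: "'a \<Rightarrow> real^'n \<Rightarrow> real"
  assumes "finite I" "\<And>i. i \<in> I \<Longrightarrow> p i \<in> polys {..d i} UNIV"
  shows "(\<lambda>x. \<Prod>i\<in>I. p i x) \<in> polys {..sum d I} UNIV"
  using assms
proof (induction I rule: finite_induct)
  case empty
  then show ?case using polys_const[of 1 UNIV 0] by simp
next
  case (insert i I)
  then show ?case using polys_mult[of "p i" "d i" "\<lambda>x. \<Prod>i\<in>I. p i x" "sum d I"] by simp
qed

lemma polys_split:
  fixes p :: "real^'n \<Rightarrow> 'x::real_vector"
  assumes "p \<in> polys (J \<union> J') X" "J \<inter> J' = {}" "finite J" "finite J'"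
  obtains q r where "q \<in> polys J X" "r \<in> polys J' X" "p = q + r"
proof -
  obtain c where c: "range c \<subseteq> X" "p = (\<lambda>x. \<Sum>\<alpha>\<in>exponents (J \<union> J'). mon \<alpha> x *\<^sub>R c \<alpha>)"
    using assms(1) unfolding polys_eq by blast
  have e: "exponents (J \<union> J') = exponents J \<union> (exponents J' :: ('n \<Rightarrow> nat) set)" by auto
  have "p = (\<lambda>x. \<Sum>\<alpha>\<in>exponents J. mon \<alpha> x *\<^sub>R c \<alpha>) + (\<lambda>x. \<Sum>\<alpha>\<in>exponents J'. mon \<alpha> x *\<^sub>R c \<alpha>)"
    unfolding c(2) plus_fun_def e
    using finite_exponents[OF assms(3)] finite_exponents[OF assms(4)] assms(2)
    by (subst sum.union_disjoint) auto
  then show ?thesis using c(1) by (intro that) (auto simp: polys_eq)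
qed

lemma polys_disjoint_zero:
  fixes p :: "real^'n \<Rightarrow> real"
  assumes "p \<in> polys J UNIV" "p \<in> polys J' UNIV" "J \<inter> J' = {}" "finite J" "finite J'"
  shows "p = 0"
proof -
  obtain c where c: "p = (\<lambda>x. \<Sum>\<alpha>\<in>exponents J. mon \<alpha> x * c \<alpha>)"
    using assms(1) unfolding polys_eq by auto
  obtain d where d: "p = (\<lambda>x. \<Sum>\<alpha>\<in>exponents J'. mon \<alpha> x * d \<alpha>)"
    using assms(2) unfolding polys_eq by auto
  let ?e = "\<lambda>\<alpha>. if \<alpha> \<in> exponents J then c \<alpha> else - d \<alpha>"
  have fin: "finite (exponents J :: ('n \<Rightarrow> nat) set)" "finite (exponents J' :: ('n \<Rightarrow> nat) set)"
    using assms finite_exponents by auto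
  have 0: "(\<Sum>\<alpha>\<in>exponents J \<union> exponents J'. ?e \<alpha> * mon \<alpha> x) = 0" for x
  proof -
    have "(\<Sum>\<alpha>\<in>exponents J \<union> exponents J'. ?e \<alpha> * mon \<alpha> x) =
        (\<Sum>\<alpha>\<in>exponents J. ?e \<alpha> * mon \<alpha> x) + (\<Sum>\<alpha>\<in>exponents J'. ?e \<alpha> * mon \<alpha> x)"
      using fin assms(3) by (intro sum.union_disjoint) auto
    also have "(\<Sum>\<alpha>\<in>exponents J. ?e \<alpha> * mon \<alpha> x) = p x"
      unfolding c by (intro sum.cong) auto
    also have "(\<Sum>\<alpha>\<in>exponents J'. ?e \<alpha> * mon \<alpha> x) = - p x"
      unfolding d sum_negf[symmetric] using assms(3) by (intro sum.cong) auto
    finally show ?thesis by simp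
  qed
  have "c \<alpha> = 0" if "\<alpha> \<in> exponents J" for \<alpha>
  proof -
    have "?e \<alpha> = 0"
    proof (rule power_products_independent[of UNIV "exponents J \<union> exponents J'" ?e])
      show "(\<Sum>\<alpha>\<in>exponents J \<union> exponents J'. ?e \<alpha> * (\<Prod>v\<in>UNIV. s v ^ \<alpha> v)) = 0" for s
        using 0[of "\<chi> i. s i"] by (simp add: mon_def)
    qed (use fin that in auto)
    then show ?thesis using that by simp
  qed
  then show ?thesis unfolding c by (auto simp: zero_fun_def)
qed

subsection \<open>Differentiation\<close>

definition dderiv :: "real^'n \<Rightarrow> (real^'n \<Rightarrow> real) \<Rightarrow> real^'n \<Rightarrow> real"
  where "dderiv t f x = frechet_derivative f (at x) t"

lemma dderiv_eq: "(f has_derivative f') (at x) \<Longrightarrow> dderiv t f x = f' t"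
  unfolding dderiv_def using frechet_derivative_at by metis

lemma mon_has_derivative:
  "(mon \<alpha> has_derivative (\<lambda>t. \<Sum>i\<in>UNIV. (real (\<alpha> i) * t $ i) * mon (\<alpha>(i := \<alpha> i - 1)) x)) (at x)"
proof -
  have 1: "((\<lambda>x. x $ i ^ \<alpha> i) has_derivative (\<lambda>t. of_nat (\<alpha> i) * t $ i * x $ i ^ (\<alpha> i - 1))) (at x)" for i
    by (rule has_derivative_power) (auto intro!: derivative_intros bounded_linear_imp_has_derivative)
  have 2: "mon (\<alpha>(i := \<alpha> i - 1)) x = x $ i ^ (\<alpha> i - 1) * (\<Prod>j\<in>UNIV - {i}. x $ j ^ \<alpha> j)" for i
    unfolding mon_def by (subst prod.remove[of _ i]) (auto intro!: prod.cong)
  show ?thesis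
    using has_derivative_prod[of UNIV "\<lambda>i x. x $ i ^ \<alpha> i", OF 1]
    unfolding 2 unfolding mon_def[abs_def] by (simp add: mult.assoc)
qed

lemma polys_differentiable:
  fixes p :: "real^'n \<Rightarrow> real"
  assumes "p \<in> polys J UNIV" "finite J"
  shows "p differentiable (at x)"
  using assms unfolding polys_real_eq_span[OF assms(2)]
proof (induction rule: span_induct_alt)
  case base
  then show ?case by (simp add: zero_fun_def)
next
  case (step c a p)
  then have "a differentiable (at x)"
    using mon_has_derivative unfolding differentiable_def by blast
  then show ?case using step by (simp add: plus_fun_def scaleR_fun_def)
qed

lemma polys_has_derivative:
  fixes p :: "real^'n \<Rightarrow> real"
  assumes "p \<in> polys J UNIV" "finite J"
  shows "(p has_derivative (\<lambda>t. dderiv t p x)) (at x)"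
  using polys_differentiable[OF assms] unfolding dderiv_def frechet_derivative_works by simp

lemma polys_continuous:
  fixes p :: "real^'n \<Rightarrow> real"
  assumes "p \<in> polys J UNIV" "finite J"
  shows "continuous_on S p"
  using polys_differentiable[OF assms] differentiable_imp_continuous_within continuous_at_imp_continuous_on
  by blast

lemma dderiv_polys:
  fixes p :: "real^'n \<Rightarrow> real"
  assumes "p \<in> polys J UNIV" "finite J" "finite J'" "\<And>d. d \<in> J \<Longrightarrow> d > 0 \<Longrightarrow> d - 1 \<in> J'"
  shows "dderiv t p \<in> polys J' UNIV"
proof -
  have "(\<forall>x. p differentiable (at x)) \<and> dderiv t p \<in> polys J' UNIV"
    using assms(1) unfolding polys_real_eq_span[OF assms(2)]
  proof (induction rule: span_induct_alt)
    case base
    have "dderiv t (0 :: real^'n \<Rightarrow> real) = 0"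
      by (auto simp: fun_eq_iff zero_fun_def intro!: dderiv_eq[where f' = "\<lambda>_. 0", simplified] has_derivative_const)
    then have "dderiv t (0 :: real^'n \<Rightarrow> real) \<in> polys J' UNIV"
      using subspace_0[OF subspace_polys, of UNIV J'] by (metis subspace_UNIV)
    then show ?case by (simp add: zero_fun_def)
  next
    case (step c a p)
    then obtain \<alpha> where \<alpha>: "a = mon \<alpha>" "\<alpha> \<in> exponents J" by blast
    have p: "(p has_derivative (\<lambda>t. dderiv t p x)) (at x)" for x
      using step unfolding dderiv_def frechet_derivative_works by simp
    have a: "dderiv t a = (\<lambda>x. \<Sum>i\<in>UNIV. (real (\<alpha> i) * t $ i) * mon (\<alpha>(i := \<alpha> i - 1)) x)"
      unfolding \<alpha>(1) by (rule ext) (rule dderiv_eq[OF mon_has_derivative])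
    have "dderiv t a \<in> polys J' UNIV"
      unfolding a
    proof (rule polys_sum)
      fix i :: 'n
      show "(\<lambda>x. (real (\<alpha> i) * t $ i) * mon (\<alpha>(i := \<alpha> i - 1)) x) \<in> polys J' UNIV"
      proof (cases "\<alpha> i = 0")
        case True
        then show ?thesis using subspace_0[OF subspace_polys, of UNIV J'] by (simp add: zero_fun_def)
      next
        case False
        have s: "sum \<alpha> UNIV = \<alpha> i + sum \<alpha> (UNIV - {i})" by (simp add: sum.remove)
        have "sum (\<alpha>(i := \<alpha> i - 1)) UNIV = (\<alpha> i - 1) + sum (\<alpha>(i := \<alpha> i - 1)) (UNIV - {i})"
          by (subst sum.remove[of _ i]) auto
        also have "sum (\<alpha>(i := \<alpha> i - 1)) (UNIV - {i}) = sum \<alpha> (UNIV - {i})"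
          by (intro sum.cong) auto
        finally have "sum (\<alpha>(i := \<alpha> i - 1)) UNIV = sum \<alpha> UNIV - 1" "sum \<alpha> UNIV > 0" using s False by auto
        then show ?thesis using assms(3,4) \<alpha>(2) by (intro polys_cmult mon_in_polys) auto
      qed
    qed simp
    moreover have *: "((c *\<^sub>R a + p) has_derivative (\<lambda>t. c * dderiv t a x + dderiv t p x)) (at x)" for x
    proof -
      have "(a has_derivative (\<lambda>t. dderiv t a x)) (at x)"
        using \<alpha> by (intro polys_has_derivative[OF _ assms(2)]) (auto intro!: mon_in_polys assms(2))
      then have "((\<lambda>x. c * a x + p x) has_derivative (\<lambda>t. c * dderiv t a x + dderiv t p x)) (at x)"
        using p by (intro derivative_intros)
      then show ?thesis by (simp add: plus_fun_def scaleR_fun_def)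
    qed
    then have "dderiv t (c *\<^sub>R a + p) = c *\<^sub>R dderiv t a + dderiv t p"
      using dderiv_eq[OF *, of t] by (simp add: fun_eq_iff plus_fun_def scaleR_fun_def)
    ultimately have "dderiv t (c *\<^sub>R a + p) \<in> polys J' UNIV"
      using step subspace_polys[of "UNIV :: real set" J'] by (metis subspace_UNIV subspace_add subspace_scale)
    moreover have "\<forall>x. (c *\<^sub>R a + p) differentiable (at x)"
      using * unfolding differentiable_def by blast
    ultimately show ?case by blast
  qed
  then show ?thesis by blast
qed

section \<open>Barycentric coordinates and the Bernstein basis\<close>

locale simplex_vertices =
  fixes V :: "(real^'n) set"
  assumes indep: "\<not> affine_dependent V" and card_V: "card V = CARD('n) + 1"
begin

lemma finite_V: "finite V"
  using card_V card.infinite by fastforce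

definition bary :: "real^'n \<Rightarrow> real^'n \<Rightarrow> real"
  where "bary v x = (SOME u. sum u V = 1 \<and> (\<Sum>v\<in>V. u v *\<^sub>R v) = x) v"

lemma
  shows sum_bary: "(\<Sum>v\<in>V. bary v x) = 1"
    and bary_expansion: "(\<Sum>v\<in>V. bary v x *\<^sub>R v) = x"
proof -
  have "x \<in> affine hull V"
    using affine_independent_span_eq[OF indep] card_V by simp
  then have "\<exists>u. sum u V = 1 \<and> (\<Sum>v\<in>V. u v *\<^sub>R v) = x"
    unfolding affine_hull_finite[OF finite_V] by blast
  from someI_ex[OF this]
  show "(\<Sum>v\<in>V. bary v x) = 1" and "(\<Sum>v\<in>V. bary v x *\<^sub>R v) = x"
    unfolding bary_def by auto
qed

lemma bary_unique:
  assumes "sum u V = 1" "(\<Sum>v\<in>V. u v *\<^sub>R v) = x" "v \<in> V"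
  shows "bary v x = u v"
proof -
  let ?d = "\<lambda>v. bary v x - u v"
  have "sum ?d V = 0" using assms(1) by (simp add: sum_subtractf sum_bary)
  moreover have "(\<Sum>v\<in>V. ?d v *\<^sub>R v) = 0"
    using assms(2) by (simp add: scaleR_diff_left sum_subtractf bary_expansion)
  ultimately have "?d v = 0"
    using indep assms(3) unfolding affine_dependent_explicit_finite[OF finite_V] by blast
  then show ?thesis by simp
qed

lemma bary_vertex:
  assumes "v \<in> V" "w \<in> V" shows "bary v w = (if v = w then 1 else 0)"
  using assms finite_V
  by (intro bary_unique) (auto simp: if_distrib[of "\<lambda>c. c *\<^sub>R _"] cong: if_cong)

lemma bary_line:
  assumes "v \<in> V"
  shows "bary v (x + s *\<^sub>R (y - z)) = bary v x + s * (bary v y - bary v z)"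
proof (rule bary_unique[OF _ _ assms])
  show "(\<Sum>v\<in>V. bary v x + s * (bary v y - bary v z)) = 1"
    by (simp add: sum.distrib sum_subtractf sum_bary flip: sum_distrib_left)
  have "(\<Sum>v\<in>V. (bary v x + s * (bary v y - bary v z)) *\<^sub>R v) =
      (\<Sum>v\<in>V. bary v x *\<^sub>R v) + s *\<^sub>R ((\<Sum>v\<in>V. bary v y *\<^sub>R v) - (\<Sum>v\<in>V. bary v z *\<^sub>R v))"
    by (simp add: scaleR_add_left scaleR_diff_left sum.distrib sum_subtractf scaleR_sum_right
        algebra_simps)
  then show "(\<Sum>v\<in>V. (bary v x + s * (bary v y - bary v z)) *\<^sub>R v) = x + s *\<^sub>R (y - z)"
    by (simp add: bary_expansion)
qed

text \<open>The gradient of the affine function \<open>bary v\<close>, an inner normal of the facet opposite to \<open>v\<close>.\<close>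

definition bgrad :: "real^'n \<Rightarrow> real^'n"
  where "bgrad v = adjoint (\<lambda>x. bary v x - bary v 0) 1"

lemma bgrad_inner:
  assumes "v \<in> V" shows "bgrad v \<bullet> x = bary v x - bary v 0"
proof -
  have "linear (\<lambda>x. bary v x - bary v 0)"
  proof (rule linearI)
    show "bary v (x + y) - bary v 0 = bary v x - bary v 0 + (bary v y - bary v 0)" for x y
      using bary_line[OF assms, of x 1 y 0] by simp
    show "bary v (r *\<^sub>R x) - bary v 0 = r *\<^sub>R (bary v x - bary v 0)" for r x
      using bary_line[OF assms, of 0 r x 0] by simp
  qed
  from adjoint_works[OF this, of x 1] show ?thesis
    unfolding bgrad_def by (simp add: inner_commute)
qed

lemma bary_affine: "v \<in> V \<Longrightarrow> bary v x = bary v 0 + bgrad v \<bullet> x"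
  by (simp add: bgrad_inner)

lemma bary_add: "v \<in> V \<Longrightarrow> bary v (x + h) = bary v x + bgrad v \<bullet> h"
  by (simp add: bary_affine[of v "x + h"] bary_affine[of v x] inner_add_right)

lemma bgrad_edge:
  "v \<in> V \<Longrightarrow> a \<in> V \<Longrightarrow> b \<in> V \<Longrightarrow>
    bgrad v \<bullet> (b - a) = (if v = b then 1 else 0) - (if v = a then 1 else 0)"
  by (simp add: inner_diff_right bgrad_inner bary_vertex)

lemma sum_bgrad: "(\<Sum>v\<in>V. bgrad v) = 0"
proof -
  have "(\<Sum>v\<in>V. bgrad v) \<bullet> x = 0" for x
    unfolding inner_sum_left using sum_bary[of x] sum_bary[of 0]
    by (simp add: bgrad_inner sum_subtractf cong: sum.cong)
  then show ?thesis using inner_eq_zero_iff by blast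
qed

lemma bgrad_expansion: "(\<Sum>v\<in>V. (bgrad v \<bullet> h) *\<^sub>R v) = h"
  using bary_expansion[of h] bary_expansion[of 0]
  by (simp add: bgrad_inner scaleR_diff_left sum_subtractf cong: sum.cong)

lemma continuous_bary: "v \<in> V \<Longrightarrow> continuous_on S (bary v)"
  by (subst continuous_on_cong[OF refl bary_affine]) (auto intro!: continuous_intros)

lemma bary_polys: "v \<in> V \<Longrightarrow> bary v \<in> polys {..1} UNIV"
proof -
  assume "v \<in> V"
  then have "bary v = (\<lambda>x. bary v 0 + bgrad v \<bullet> x)" using bary_affine by blast
  then show ?thesis using polys_affine by metis
qed

lemma face_iff:
  assumes "C \<subseteq> V"
  shows "x \<in> convex hull C \<longleftrightarrow> (\<forall>v\<in>C. 0 \<le> bary v x) \<and> (\<forall>v\<in>V - C. bary v x = 0)"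
proof -
  have fC: "finite C" using assms finite_V finite_subset by blast
  show ?thesis
  proof
    assume "x \<in> convex hull C"
    then obtain u where u: "\<forall>v\<in>C. 0 \<le> u v" "sum u C = 1" "(\<Sum>v\<in>C. u v *\<^sub>R v) = x"
      unfolding convex_hull_finite[OF fC] by auto
    let ?u = "\<lambda>v. if v \<in> C then u v else 0"
    have "sum ?u V = sum u C"
      using assms finite_V by (intro sum.mono_neutral_cong_right) auto
    moreover have "(\<Sum>v\<in>V. ?u v *\<^sub>R v) = (\<Sum>v\<in>C. u v *\<^sub>R v)"
      using assms finite_V by (intro sum.mono_neutral_cong_right) auto
    ultimately have "bary v x = ?u v" if "v \<in> V" for v
      using that u by (intro bary_unique) auto
    then show "(\<forall>v\<in>C. 0 \<le> bary v x) \<and> (\<forall>v\<in>V - C. bary v x = 0)" using u assms by auto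
  next
    assume *: "(\<forall>v\<in>C. 0 \<le> bary v x) \<and> (\<forall>v\<in>V - C. bary v x = 0)"
    have "(\<Sum>v\<in>C. bary v x) = 1"
      using * assms finite_V sum_bary[of x] by (subst (asm) sum.mono_neutral_right[of V C]) auto
    moreover have "(\<Sum>v\<in>C. bary v x *\<^sub>R v) = x"
      using * assms finite_V bary_expansion[of x] by (subst (asm) sum.mono_neutral_right[of V C]) auto
    ultimately show "x \<in> convex hull C"
      unfolding convex_hull_finite[OF fC] using * by (auto intro!: exI[of _ "\<lambda>v. bary v x"])
  qed
qed

subsection \<open>Bernstein polynomials\<close>

text \<open>
  The Bernstein polynomials without their multinomial factors, which would only rescale the basis.
\<close>

definition bern :: "(real^'n \<Rightarrow> nat) \<Rightarrow> real^'n \<Rightarrow> real"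
  where "bern \<alpha> x = (\<Prod>v\<in>V. bary v x ^ \<alpha> v)"

lemma bern_in_polys:
  assumes "\<alpha> \<in> multi_indices V m" shows "bern \<alpha> \<in> polys {..m} UNIV"
proof -
  have "(\<lambda>x. \<Prod>v\<in>V. bary v x ^ \<alpha> v) \<in> polys {..sum \<alpha> V} UNIV"
    by (intro polys_prod polys_power bary_polys finite_V)
  then show ?thesis using assms by (simp add: bern_def[abs_def] multi_indices_def)
qed

lemma bern_span_times:
  assumes "p \<in> span (bern ` multi_indices V a)" "q \<in> span (bern ` multi_indices V b)"
  shows "(\<lambda>x. p x * q x) \<in> span (bern ` multi_indices V (a + b))"
proof (rule span_times[OF _ assms])
  fix f g assume "f \<in> bern ` multi_indices V a" "g \<in> bern ` multi_indices V b"
  then obtain \<alpha> \<beta> where f: "f = bern \<alpha>" "\<alpha> \<in> multi_indices V a"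
    and g: "g = bern \<beta>" "\<beta> \<in> multi_indices V b" by blast
  have "(\<lambda>x. f x * g x) = bern (\<lambda>v. \<alpha> v + \<beta> v)"
    by (simp add: f g bern_def power_add prod.distrib fun_eq_iff)
  moreover have "(\<lambda>v. \<alpha> v + \<beta> v) \<in> multi_indices V (a + b)"
    using f g by (simp add: multi_indices_def sum.distrib)
  ultimately show "(\<lambda>x. f x * g x) \<in> span (bern ` multi_indices V (a + b))"
    by (intro span_base) (rule image_eqI)
qed

lemma span_sum_fun:
  assumes "\<And>i. i \<in> I \<Longrightarrow> p i \<in> span S" shows "(\<lambda>x. \<Sum>i\<in>I. p i x :: real) \<in> span S"
  unfolding sum_fun[symmetric] using assms by (rule span_sum)

lemma bary_in_span_bern: "v \<in> V \<Longrightarrow> bary v \<in> span (bern ` multi_indices V 1)"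
proof -
  assume v: "v \<in> V"
  let ?e = "\<lambda>w. if w = v then 1 else (0::nat)"
  have "bern ?e x = bary v x" for x
  proof -
    have "bern ?e x = (\<Prod>w\<in>V. if w = v then bary w x else 1)"
      unfolding bern_def by (intro prod.cong) auto
    then show ?thesis using v finite_V by simp
  qed
  then have "bary v = bern ?e" by (simp add: fun_eq_iff)
  moreover have "?e \<in> multi_indices V 1" using v finite_V by (auto simp: multi_indices_def)
  ultimately show ?thesis by (intro span_base) (rule image_eqI)
qed

lemma affine_in_span_bern: "(\<lambda>x. a + g \<bullet> x) \<in> span (bern ` multi_indices V 1)"
proof -
  have "(\<lambda>x. \<Sum>v\<in>V. ((a + g \<bullet> v) *\<^sub>R bary v) x) \<in> span (bern ` multi_indices V 1)"
    by (intro span_sum_fun span_scale bary_in_span_bern)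
  moreover have "(\<Sum>v\<in>V. ((a + g \<bullet> v) *\<^sub>R bary v) x) = a + g \<bullet> x" for x
  proof -
    have "a + g \<bullet> x = a * (\<Sum>v\<in>V. bary v x) + g \<bullet> (\<Sum>v\<in>V. bary v x *\<^sub>R v)"
      by (simp add: sum_bary bary_expansion)
    then show ?thesis
      by (simp add: scaleR_fun_def inner_sum_right sum_distrib_left algebra_simps sum.distrib)
  qed
  ultimately show ?thesis by simp
qed

lemma one_in_span_bern: "(\<lambda>x. 1) \<in> span (bern ` multi_indices V m)"
proof (induction m)
  case 0
  have "(\<lambda>x. 1) = bern (\<lambda>_. 0)" by (simp add: bern_def fun_eq_iff)
  moreover have "(\<lambda>_. 0) \<in> multi_indices V 0" by (simp add: multi_indices_def)
  ultimately show ?case by (intro span_base) (rule image_eqI)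
next
  case (Suc m)
  have "(\<lambda>x. 1) \<in> span (bern ` multi_indices V 1)" using affine_in_span_bern[of 1 0] by simp
  from bern_span_times[OF this Suc] show ?case by simp
qed

text \<open>
  Homogenising with \<open>1 = (\<Sum>v\<in>V. bary v x)\<close> turns polynomials of degree at most \<open>m\<close> into
  homogeneous polynomials of degree \<open>m\<close> in the barycentric coordinates.
\<close>

proposition polys_eq_span_bern: "polys {..m} UNIV = span (bern ` multi_indices V m)"
proof
  show "span (bern ` multi_indices V m) \<subseteq> polys {..m} UNIV"
    using bern_in_polys subspace_polys[OF subspace_UNIV] by (intro span_minimal) auto
  have "mon \<alpha> \<in> span (bern ` multi_indices V m)" if "\<alpha> \<in> exponents {..m}" for \<alpha>
  proof -
    have pow: "(\<lambda>x. (x $ i) ^ k) \<in> span (bern ` multi_indices V k)" for i k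
    proof (induction k)
      case 0
      then show ?case using one_in_span_bern[of 0] by simp
    next
      case (Suc k)
      have "(\<lambda>x. x $ i) \<in> span (bern ` multi_indices V 1)"
        using affine_in_span_bern[of 0 "axis i 1"] by (simp add: inner_axis')
      from bern_span_times[OF this Suc] show ?case by simp
    qed
    have "(\<lambda>x. \<Prod>i\<in>I. x $ i ^ \<alpha> i) \<in> span (bern ` multi_indices V (sum \<alpha> I))" if "finite I" for I
      using that
    proof (induction I rule: finite_induct)
      case empty
      then show ?case using one_in_span_bern[of 0] by simp
    next
      case (insert i I)
      then show ?case using bern_span_times[OF pow[of i "\<alpha> i"]] by simp
    qed
    from bern_span_times[OF this[of UNIV] one_in_span_bern[of "m - sum \<alpha> UNIV"]] that
    show ?thesis by (simp add: mon_def[abs_def])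
  qed
  then show "polys {..m} UNIV \<subseteq> span (bern ` multi_indices V m)"
    unfolding polys_real_eq_span[OF finite_atMost] by (intro span_minimal) auto
qed

lemma polys_bernE:
  assumes "p \<in> polys {..m} UNIV"
  obtains c where "p = (\<lambda>x. \<Sum>\<alpha>\<in>multi_indices V m. c \<alpha> * bern \<alpha> x)"
proof -
  obtain c where "p = (\<Sum>\<alpha>\<in>multi_indices V m. c \<alpha> *\<^sub>R bern \<alpha>)"
    using assms unfolding polys_eq_span_bern span_family[OF finite_multi_indices[OF finite_V]] by blast
  then show ?thesis by (intro that[of c]) (simp add: sum_fun scaleR_fun_def)
qed

lemma bern_face:
  assumes "C \<subseteq> V" "x \<in> convex hull C" "\<alpha> \<in> multi_indices V m" "\<alpha> \<notin> multi_indices C m"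
  shows "bern \<alpha> x = 0"
proof -
  have "\<exists>v\<in>V - C. \<alpha> v \<noteq> 0"
  proof (rule ccontr)
    assume "\<not> ?thesis"
    then have "sum \<alpha> V = sum \<alpha> C" and "\<forall>v. v \<notin> C \<longrightarrow> \<alpha> v = 0"
      using assms(1,3) finite_V by (auto intro!: sum.mono_neutral_right simp: multi_indices_def)
    then show False using assms(3,4) by (simp add: multi_indices_def)
  qed
  then obtain v where v: "v \<in> V - C" "\<alpha> v \<noteq> 0" by blast
  then have "bary v x ^ \<alpha> v = 0" using face_iff[OF assms(1)] assms(2) by simp
  then show ?thesis unfolding bern_def using v finite_V by (intro prod_zero) auto
qed

lemma multi_indices_mono:
  assumes "C \<subseteq> V" shows "multi_indices C m \<subseteq> multi_indices V m"
proof
  fix \<alpha> assume a: "\<alpha> \<in> multi_indices C m"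
  then have "sum \<alpha> V = sum \<alpha> C"
    using assms finite_V by (intro sum.mono_neutral_right) (auto simp: multi_indices_def)
  then show "\<alpha> \<in> multi_indices V m" using a assms by (auto simp: multi_indices_def)
qed

lemma bern_sum_on_face:
  assumes "C \<subseteq> V" "x \<in> convex hull C"
  shows "(\<Sum>\<alpha>\<in>multi_indices V m. c \<alpha> * bern \<alpha> x) = (\<Sum>\<alpha>\<in>multi_indices C m. c \<alpha> * bern \<alpha> x)"
  using multi_indices_mono[OF assms(1)] bern_face[OF assms]
  by (intro sum.mono_neutral_right finite_multi_indices finite_V) auto

text \<open>
  By homogeneity of degree \<open>m\<close>, a relation that holds in the relative interior of the face holds for
  arbitrary positive weights \<open>s\<close> in place of the barycentric coordinates. Asking for the relation only
  where the coordinates are positive permits to divide by them first.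
\<close>

lemma bern_independent_on_face:
  assumes C: "C \<subseteq> V" "C \<noteq> {}"
    and z: "\<And>x. x \<in> convex hull C \<Longrightarrow> (\<And>v. v \<in> C \<Longrightarrow> 0 < bary v x) \<Longrightarrow>
      (\<Sum>\<alpha>\<in>multi_indices C m. c \<alpha> * bern \<alpha> x) = 0"
    and \<alpha>: "\<alpha> \<in> multi_indices C m"
  shows "c \<alpha> = 0"
proof -
  have fC: "finite C" using C finite_V finite_subset by blast
  show ?thesis
  proof (rule power_products_independent[of C "multi_indices C m" c])
    fix s :: "real^'n \<Rightarrow> real" assume s: "\<And>v. s v > 0"
    define S where "S = sum s C"
    have S: "S > 0" unfolding S_def using s fC C(2) by (intro sum_pos) auto
    define x where "x = (\<Sum>v\<in>C. (s v / S) *\<^sub>R v)"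
    let ?u = "\<lambda>v. if v \<in> C then s v / S else 0"
    have "sum ?u V = (\<Sum>v\<in>C. s v / S)"
      using C finite_V by (intro sum.mono_neutral_cong_right) auto
    also have "\<dots> = 1" using S by (simp add: S_def flip: sum_divide_distrib)
    finally have 1: "sum ?u V = 1" .
    have 2: "(\<Sum>v\<in>V. ?u v *\<^sub>R v) = x"
      unfolding x_def using C finite_V by (intro sum.mono_neutral_cong_right) auto
    have u: "bary v x = ?u v" if "v \<in> V" for v by (rule bary_unique[OF 1 2 that])
    have x: "x \<in> convex hull C"
      unfolding face_iff[OF C(1)] using u C(1) s S by (auto simp: subset_iff less_imp_le)
    have pos: "0 < bary v x" if "v \<in> C" for v using u that C(1) s S by auto
    have b: "bern \<beta> x = (\<Prod>v\<in>C. s v ^ \<beta> v) / S ^ m" if \<beta>: "\<beta> \<in> multi_indices C m" for \<beta>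
    proof -
      have "bern \<beta> x = (\<Prod>v\<in>C. (s v / S) ^ \<beta> v)"
        unfolding bern_def using \<beta> u C finite_V
        by (intro prod.mono_neutral_cong_right) (auto simp: multi_indices_def)
      also have "\<dots> = (\<Prod>v\<in>C. s v ^ \<beta> v) / S ^ m"
        using \<beta> by (simp add: power_divide prod_dividef power_sum[symmetric] multi_indices_def)
      finally show ?thesis .
    qed
    have "(\<Sum>\<beta>\<in>multi_indices C m. c \<beta> * (\<Prod>v\<in>C. s v ^ \<beta> v)) =
        S ^ m * (\<Sum>\<beta>\<in>multi_indices C m. c \<beta> * bern \<beta> x)"
      unfolding sum_distrib_left using S b by (intro sum.cong) auto
    then show "(\<Sum>\<beta>\<in>multi_indices C m. c \<beta> * (\<Prod>v\<in>C. s v ^ \<beta> v)) = 0" using z[OF x pos] by simp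
  qed (use fC \<alpha> finite_multi_indices in \<open>auto simp: multi_indices_def\<close>)
qed

lemma V_nonempty: "V \<noteq> {}" using card_V by auto

lemma polys_zero_on_simplex:
  fixes p :: "real^'n \<Rightarrow> real"
  assumes p: "p \<in> polys {..m} UNIV"
    and z: "\<And>x. x \<in> convex hull V \<Longrightarrow> (\<And>v. v \<in> V \<Longrightarrow> 0 < bary v x) \<Longrightarrow> p x = 0"
  shows "p x = 0"
proof -
  obtain c where c: "p = (\<lambda>x. \<Sum>\<alpha>\<in>multi_indices V m. c \<alpha> * bern \<alpha> x)"
    using polys_bernE[OF p] by blast
  have "c \<alpha> = 0" if "\<alpha> \<in> multi_indices V m" for \<alpha>
  proof (rule bern_independent_on_face[OF order_refl V_nonempty _ that])
    show "(\<Sum>\<alpha>\<in>multi_indices V m. c \<alpha> * bern \<alpha> x) = 0"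
      if "x \<in> convex hull V" "\<And>v. v \<in> V \<Longrightarrow> 0 < bary v x" for x
      using z[OF that] by (simp add: c)
  qed
  then show ?thesis by (simp add: c)
qed

text \<open>
  In the Bernstein basis, restriction to the face opposite to \<open>a\<close> keeps exactly the coefficients
  with \<open>\<alpha> a = 0\<close>; if they vanish for all \<open>a \<in> D\<close>, every remaining basis polynomial contains the
  factor \<open>\<Prod>a\<in>D. bary a\<close>.
\<close>

proposition polys_factor_on_face:
  fixes p :: "real^'n \<Rightarrow> real"
  assumes C: "C \<subseteq> V" "D \<subseteq> C" and p: "p \<in> polys {..m} UNIV" and m: "m > 0"
    and z: "\<And>a x. a \<in> D \<Longrightarrow> x \<in> convex hull (C - {a}) \<Longrightarrow> p x = 0"
  obtains r where "r \<in> polys {..m - card D} UNIV"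
    and "\<And>x. x \<in> convex hull C \<Longrightarrow> p x = (\<Prod>a\<in>D. bary a x) * r x"
proof -
  have fC: "finite C" using C finite_V finite_subset by blast
  then have fD: "finite D" using C finite_subset by blast
  have DV: "D \<subseteq> V" using C by blast
  obtain c where c: "p = (\<lambda>x. \<Sum>\<alpha>\<in>multi_indices V m. c \<alpha> * bern \<alpha> x)"
    using polys_bernE[OF p] by blast
  have c0: "c \<alpha> = 0" if \<alpha>: "\<alpha> \<in> multi_indices C m" and a: "a \<in> D" "\<alpha> a = 0" for \<alpha> a
  proof -
    have \<alpha>': "\<alpha> \<in> multi_indices (C - {a}) m"
      using \<alpha> a C fC by (auto simp: multi_indices_def sum.remove[of C a])
    moreover have "C - {a} \<noteq> {}"
    proof
      assume "C - {a} = {}"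
      with \<alpha>' have "\<alpha> \<in> multi_indices {} m" by simp
      then show False using m by (simp add: multi_indices_def)
    qed
    moreover have "C - {a} \<subseteq> V" using C(1) by blast
    moreover have "(\<Sum>\<alpha>\<in>multi_indices (C - {a}) m. c \<alpha> * bern \<alpha> x) = 0"
      if "x \<in> convex hull (C - {a})" for x
      using z[OF a(1) that] bern_sum_on_face[OF \<open>C - {a} \<subseteq> V\<close> that, of c m] by (simp add: c)
    ultimately show ?thesis
      using bern_independent_on_face[of "C - {a}" c m \<alpha>] by blast
  qed
  let ?A = "{\<alpha> \<in> multi_indices C m. \<forall>a\<in>D. \<alpha> a > 0}"
  let ?red = "\<lambda>\<alpha> v. \<alpha> v - (if v \<in> D then 1 else 0 :: nat)"
  define r where "r = (\<lambda>x. \<Sum>\<alpha>\<in>?A. c \<alpha> * bern (?red \<alpha>) x)"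
  show ?thesis
  proof
    show "r \<in> polys {..m - card D} UNIV"
      unfolding r_def
    proof (intro polys_sum polys_cmult)
      fix \<alpha> assume \<alpha>: "\<alpha> \<in> ?A"
      then have "\<alpha> \<in> multi_indices V m" using multi_indices_mono[OF C(1)] by blast
      have "sum (?red \<alpha>) V = sum \<alpha> V - (\<Sum>v\<in>V. if v \<in> D then 1 else 0)"
        using \<alpha> by (intro sum_subtractf_nat) (auto simp: Suc_le_eq)
      also have "(\<Sum>v\<in>V. if v \<in> D then 1 else 0 :: nat) = card D"
        using DV finite_V by (simp add: sum.If_cases Int_absorb1)
      finally have "?red \<alpha> \<in> multi_indices V (m - card D)"
        using \<open>\<alpha> \<in> multi_indices V m\<close> by (auto simp: multi_indices_def)
      then show "bern (?red \<alpha>) \<in> polys {..m - card D} UNIV" by (rule bern_in_polys)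
    qed simp
    fix x assume x: "x \<in> convex hull C"
    have "p x = (\<Sum>\<alpha>\<in>multi_indices C m. c \<alpha> * bern \<alpha> x)"
      unfolding c by (rule bern_sum_on_face[OF C(1) x])
    also have "\<dots> = (\<Sum>\<alpha>\<in>?A. c \<alpha> * bern \<alpha> x)"
      using c0 by (intro sum.mono_neutral_right finite_multi_indices fC) auto
    also have "\<dots> = (\<Sum>\<alpha>\<in>?A. c \<alpha> * ((\<Prod>a\<in>D. bary a x) * bern (?red \<alpha>) x))"
    proof (rule sum.cong[OF refl])
      fix \<alpha> assume \<alpha>: "\<alpha> \<in> ?A"
      have "bern \<alpha> x = (\<Prod>v\<in>V. (if v \<in> D then bary v x else 1) * bary v x ^ ?red \<alpha> v)"
        unfolding bern_def
      proof (intro prod.cong refl)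
        fix v
        show "bary v x ^ \<alpha> v = (if v \<in> D then bary v x else 1) * bary v x ^ ?red \<alpha> v"
          using \<alpha> by (cases "\<alpha> v") auto
      qed
      also have "\<dots> = (\<Prod>a\<in>D. bary a x) * bern (?red \<alpha>) x"
        using DV finite_V by (simp add: prod.distrib bern_def prod.If_cases Int_absorb1)
      finally show "c \<alpha> * bern \<alpha> x = c \<alpha> * ((\<Prod>a\<in>D. bary a x) * bern (?red \<alpha>) x)" by simp
    qed
    also have "\<dots> = (\<Prod>a\<in>D. bary a x) * r x"
      by (simp add: r_def sum_distrib_left mult.left_commute)
    finally show "p x = (\<Prod>a\<in>D. bary a x) * r x" .
  qed
qed

lemma card_multi_indices_V: "card (multi_indices V m) = (m + CARD('n)) choose CARD('n)"
  using card_multi_indices[OF finite_V V_nonempty, of m] card_V binomial_symmetric[of m "m + CARD('n)"]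
  by simp

proposition dim_polys_on_face:
  assumes C: "C \<subseteq> V" "C \<noteq> {}"
  shows "dim (polys_on (convex hull C) m) = (m + (card C - 1)) choose (card C - 1)"
    and "finite_dim (polys_on (convex hull C) m)" and "subspace (polys_on (convex hull C) m)"
proof -
  have fC: "finite C" using C finite_V finite_subset by blast
  let ?f = "\<lambda>\<alpha> x. if x \<in> convex hull C then bern \<alpha> x else 0"
  let ?I = "multi_indices C m"
  have fI: "finite ?I" using fC finite_multi_indices by blast
  have ind: "indep_family ?I ?f"
    unfolding indep_family_def
  proof (intro allI impI ballI)
    fix c \<alpha> assume "(\<Sum>\<alpha>\<in>?I. c \<alpha> *\<^sub>R ?f \<alpha>) = 0" and \<alpha>: "\<alpha> \<in> ?I"
    then have "(\<Sum>\<alpha>\<in>?I. c \<alpha> * ?f \<alpha> x) = 0" for x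
      unfolding sum_fun by (simp add: scaleR_fun_def zero_fun_def fun_eq_iff)
    then have "(\<Sum>\<alpha>\<in>?I. c \<alpha> * bern \<alpha> x) = 0" if "x \<in> convex hull C" for x
      using that \<open>\<And>x. (\<Sum>\<alpha>\<in>?I. c \<alpha> * ?f \<alpha> x) = 0\<close>[of x] by simp
    then show "c \<alpha> = 0" using bern_independent_on_face[OF C _ \<alpha>, of c] by blast
  qed
  have V: "polys_on (convex hull C) m = {\<Sum>\<alpha>\<in>?I. c \<alpha> *\<^sub>R ?f \<alpha> | c. True}"
  proof safe
    fix q assume "q \<in> polys_on (convex hull C) m"
    then obtain p where p: "p \<in> polys {..m} UNIV" "q = (\<lambda>x. if x \<in> convex hull C then p x else 0)"
      unfolding polys_on_def by blast
    obtain c where c: "p = (\<lambda>x. \<Sum>\<alpha>\<in>multi_indices V m. c \<alpha> * bern \<alpha> x)"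
      using polys_bernE[OF p(1)] by blast
    have "q = (\<Sum>\<alpha>\<in>?I. c \<alpha> *\<^sub>R ?f \<alpha>)"
      unfolding p(2) c sum_fun using bern_sum_on_face[OF C(1)] by (auto simp: scaleR_fun_def fun_eq_iff)
    then show "\<exists>c. q = (\<Sum>\<alpha>\<in>?I. c \<alpha> *\<^sub>R ?f \<alpha>) \<and> True" by blast
  next
    fix c
    let ?p = "\<lambda>x. \<Sum>\<alpha>\<in>?I. c \<alpha> * bern \<alpha> x"
    have p: "?p \<in> polys {..m} UNIV"
      using multi_indices_mono[OF C(1)] by (intro polys_sum polys_cmult bern_in_polys) auto
    have eq: "(\<Sum>\<alpha>\<in>?I. c \<alpha> *\<^sub>R ?f \<alpha>) = (\<lambda>x. if x \<in> convex hull C then ?p x else 0)"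
      unfolding sum_fun by (auto simp: scaleR_fun_def fun_eq_iff)
    show "(\<Sum>\<alpha>\<in>?I. c \<alpha> *\<^sub>R ?f \<alpha>) \<in> polys_on (convex hull C) m"
      unfolding polys_on_def using eq p by (rule image_eqI)
  qed
  have "card ?I = (m + (card C - 1)) choose (card C - 1)"
    using card_multi_indices[OF fC C(2), of m] binomial_symmetric[of m "m + (card C - 1)"]
      C(2) fC card_gt_0_iff[of C] by simp
  then show "dim (polys_on (convex hull C) m) = (m + (card C - 1)) choose (card C - 1)"
    and "finite_dim (polys_on (convex hull C) m)" and "subspace (polys_on (convex hull C) m)"
    using dim_indep_family[OF ind fI V] by auto
qed

end

section \<open>Symmetric matrices and the edges of the simplex\<close>

definition osq :: "real^'n \<Rightarrow> real^'n^'n"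
  where "osq t = (\<chi> i j. t $ i * t $ j)"

lemma inner_osq: "A \<bullet> osq t = t \<bullet> (A *v t)"
  by (simp add: osq_def inner_vec_def matrix_vector_mult_def sum_distrib_left ac_simps)

lemma osq_mult_vec: "osq t *v x = (t \<bullet> x) *\<^sub>R t"
  by (simp add: osq_def vec_eq_iff matrix_vector_mult_def inner_vec_def sum_distrib_left ac_simps)

lemma osq_in_sym_mats: "osq t \<in> sym_mats"
  by (simp add: sym_mats_def osq_def transpose_def vec_eq_iff mult.commute)

lemma sym_matsD: "A \<in> sym_mats \<Longrightarrow> A $ i $ j = A $ j $ i"
  by (auto simp: sym_mats_def transpose_def vec_eq_iff)

lemma subspace_sym_mats: "subspace sym_mats"
  by (auto simp: subspace_def sym_mats_def transpose_def vec_eq_iff)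

lemma sym_mats_inner:
  assumes "A \<in> sym_mats" shows "x \<bullet> (A *v y) = y \<bullet> (A *v x)"
proof -
  have "x \<bullet> (A *v y) = (x v* A) \<bullet> y" by (rule dot_lmul_matrix[symmetric])
  also have "x v* A = A *v x"
    using assms transpose_matrix_vector[of A x] by (simp add: sym_mats_def)
  finally show ?thesis by (simp add: inner_commute)
qed

context simplex_vertices
begin

lemma bgrad_dual_expansion: "(\<Sum>a\<in>V. (a \<bullet> h) *\<^sub>R bgrad a) = h"
proof -
  have "(\<Sum>a\<in>V. (a \<bullet> h) *\<^sub>R bgrad a) \<bullet> x = h \<bullet> x" for x
  proof -
    have "(\<Sum>a\<in>V. (a \<bullet> h) *\<^sub>R bgrad a) \<bullet> x = h \<bullet> (\<Sum>a\<in>V. (bgrad a \<bullet> x) *\<^sub>R a)"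
      by (simp add: inner_sum_left inner_sum_right inner_commute mult.commute)
    then show ?thesis by (simp add: bgrad_expansion)
  qed
  then show ?thesis by (metis vector_eq_ldot inner_commute)
qed

text \<open>
  An arbitrary orientation of the edges of the simplex, so that each edge is counted once.
\<close>

definition edges :: "((real^'n) \<times> (real^'n)) set"
  where "edges = (let h = (SOME h :: real^'n \<Rightarrow> nat. inj_on h V) in
    {(a, b). a \<in> V \<and> b \<in> V \<and> h a < h b})"

lemma
  shows edges_subset: "edges \<subseteq> V \<times> V"
    and finite_edges: "finite edges"
    and edges_oriented: "(a, b) \<in> edges \<Longrightarrow> (b, a) \<notin> edges"
    and edges_total: "a \<in> V \<Longrightarrow> b \<in> V \<Longrightarrow> a \<noteq> b \<Longrightarrow> (a, b) \<in> edges \<or> (b, a) \<in> edges"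
proof -
  define h where "h = (SOME h :: real^'n \<Rightarrow> nat. inj_on h V)"
  have "\<exists>h :: real^'n \<Rightarrow> nat. inj_on h V"
    using finite_imp_inj_to_nat_seg[OF finite_V] by blast
  then have h: "inj_on h V" unfolding h_def by (rule someI_ex)
  have e: "edges = {(a, b). a \<in> V \<and> b \<in> V \<and> h a < h b}"
    unfolding edges_def h_def[symmetric] by (simp add: Let_def)
  show 1: "edges \<subseteq> V \<times> V" unfolding e by auto
  show "finite edges" using finite_subset[OF 1] finite_V by blast
  show "(a, b) \<in> edges \<Longrightarrow> (b, a) \<notin> edges" unfolding e by auto
  show "a \<in> V \<Longrightarrow> b \<in> V \<Longrightarrow> a \<noteq> b \<Longrightarrow> (a, b) \<in> edges \<or> (b, a) \<in> edges"
    unfolding e using inj_onD[OF h, of a b] less_linear[of "h a" "h b"] by auto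
qed

lemma edges_distinct: "(a, b) \<in> edges \<Longrightarrow> a \<in> V \<and> b \<in> V \<and> a \<noteq> b"
  using edges_subset edges_oriented by blast

lemma square_decomposition:
  "V \<times> V = (\<lambda>a. (a, a)) ` V \<union> edges \<union> prod.swap ` edges"
  "(\<lambda>a. (a, a)) ` V \<inter> edges = {}"
  "((\<lambda>a. (a, a)) ` V \<union> edges) \<inter> prod.swap ` edges = {}"
proof -
  show "V \<times> V = (\<lambda>a. (a, a)) ` V \<union> edges \<union> prod.swap ` edges"
  proof (intro equalityI subsetI)
    fix p assume "p \<in> V \<times> V"
    then show "p \<in> (\<lambda>a. (a, a)) ` V \<union> edges \<union> prod.swap ` edges"
      using edges_total by (cases p) (force simp: image_iff)
  next
    fix p assume "p \<in> (\<lambda>a. (a, a)) ` V \<union> edges \<union> prod.swap ` edges"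
    then show "p \<in> V \<times> V" using edges_subset by auto
  qed
  show "(\<lambda>a. (a, a)) ` V \<inter> edges = {}" using edges_distinct by blast
  show "((\<lambda>a. (a, a)) ` V \<union> edges) \<inter> prod.swap ` edges = {}"
    using edges_distinct edges_oriented by fastforce
qed

lemma sum_edges:
  fixes f :: "real^'n \<Rightarrow> real^'n \<Rightarrow> 'z::real_vector"
  assumes "\<And>a. f a a = 0" "\<And>a b. f a b = f b a"
  shows "(\<Sum>a\<in>V. \<Sum>b\<in>V. f a b) = 2 *\<^sub>R (\<Sum>(a, b)\<in>edges. f a b)"
proof -
  have "(\<Sum>a\<in>V. \<Sum>b\<in>V. f a b) = (\<Sum>(a, b)\<in>V \<times> V. f a b)"
    by (simp add: sum.cartesian_product)
  also have "\<dots> = (\<Sum>(a, b)\<in>(\<lambda>a. (a, a)) ` V. f a b) + (\<Sum>(a, b)\<in>edges. f a b) +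
      (\<Sum>(a, b)\<in>prod.swap ` edges. f a b)"
    unfolding square_decomposition(1)
    using square_decomposition(2,3) finite_V finite_edges by (simp add: sum.union_disjoint)
  also have "(\<Sum>(a, b)\<in>(\<lambda>a. (a, a)) ` V. f a b) = 0"
    using assms(1) by (auto intro!: sum.neutral)
  also have "(\<Sum>(a, b)\<in>prod.swap ` edges. f a b) = (\<Sum>(a, b)\<in>edges. f a b)"
    using assms(2) by (subst sum.reindex) (auto simp: case_prod_beta inj_on_def intro!: sum.cong)
  finally show ?thesis by (simp add: scaleR_2)
qed

lemma card_edges: "2 * card edges = CARD('n) * (CARD('n) + 1)"
proof -
  have "card V * card V = card (V \<times> V)" by (simp add: card_cartesian_product)
  also have "\<dots> = card ((\<lambda>a. (a, a)) ` V) + card edges + card (prod.swap ` edges)"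
    unfolding square_decomposition(1)
    using square_decomposition(2,3) finite_V finite_edges by (simp add: card_Un_disjoint)
  also have "\<dots> = card V + 2 * card edges"
    by (simp add: card_image[of "\<lambda>a. (a, a)"] card_image[of prod.swap] inj_on_def prod_eq_iff)
  finally show ?thesis by (simp add: card_V)
qed

text \<open>
  Writing \<open>A = \<Sum>a b. (g\<^sub>a \<bullet> A g\<^sub>b) a b\<^sup>T\<close> with \<open>g\<^sub>v = bgrad v\<close>, the rows of the coefficient matrix sum
  to zero because the \<open>g\<^sub>v\<close> do; this turns \<open>a b\<^sup>T + b a\<^sup>T\<close> into \<open>- (b - a) (b - a)\<^sup>T\<close>.
\<close>

proposition sym_mats_expansion:
  assumes A: "A \<in> sym_mats"
  shows "A = (\<Sum>(a, b)\<in>edges. (- (bgrad a \<bullet> (A *v bgrad b))) *\<^sub>R osq (b - a))"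
proof -
  define T where "T = (\<lambda>a b. bgrad a \<bullet> (A *v bgrad b))"
  have sym: "T a b = T b a" for a b unfolding T_def by (rule sym_mats_inner[OF A])
  have row: "(\<Sum>a\<in>V. T a b) = 0" for b
    unfolding T_def inner_sum_left[symmetric] by (simp add: sum_bgrad)
  have rowb: "(\<Sum>b\<in>V. T a b) = 0" for a using row[of a] sym by simp
  have full: "(\<Sum>a\<in>V. \<Sum>b\<in>V. T a b * (a $ i * b $ j)) = A $ i $ j" for i j
  proof -
    have e: "(\<Sum>a\<in>V. (a $ i) *\<^sub>R bgrad a) = axis i 1" for i
      using bgrad_dual_expansion[of "axis i 1"] by (simp add: inner_axis)
    have "(\<Sum>a\<in>V. \<Sum>b\<in>V. T a b * (a $ i * b $ j)) =
        (\<Sum>a\<in>V. (a $ i) *\<^sub>R bgrad a) \<bullet> (A *v (\<Sum>b\<in>V. (b $ j) *\<^sub>R bgrad b))"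
      unfolding inner_sum_left linear_sum[OF matrix_vector_mul_linear]
      by (simp add: T_def inner_sum_right matrix_vector_mult_scaleR sum_distrib_left mult_ac)
    also have "\<dots> = A $ i $ j"
      unfolding e by (simp add: inner_axis' matrix_vector_mul_component inner_axis)
    finally show ?thesis .
  qed
  have 1: "(\<Sum>a\<in>V. \<Sum>b\<in>V. T a b * (a $ i * a $ j)) = 0" for i j
    by (simp add: sum_distrib_right[symmetric] rowb)
  have 2: "(\<Sum>a\<in>V. \<Sum>b\<in>V. T a b * (b $ i * b $ j)) = 0" for i j
    by (subst sum.swap) (simp add: sum_distrib_right[symmetric] row)
  have "(\<Sum>a\<in>V. \<Sum>b\<in>V. T a b *\<^sub>R osq (b - a)) = (- 2) *\<^sub>R A"
  proof -
    have "(\<Sum>a\<in>V. \<Sum>b\<in>V. T a b * ((b - a) $ i * (b - a) $ j)) = - 2 * A $ i $ j" for i j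
    proof -
      have "(\<Sum>a\<in>V. \<Sum>b\<in>V. T a b * ((b - a) $ i * (b - a) $ j)) =
          (\<Sum>a\<in>V. \<Sum>b\<in>V. T a b * (b $ i * b $ j)) + (\<Sum>a\<in>V. \<Sum>b\<in>V. T a b * (a $ i * a $ j))
          - (\<Sum>a\<in>V. \<Sum>b\<in>V. T a b * (a $ i * b $ j)) - (\<Sum>a\<in>V. \<Sum>b\<in>V. T a b * (a $ j * b $ i))"
        by (simp add: sum.distrib sum_subtractf algebra_simps)
      then show ?thesis using sym_matsD[OF A, of i j] by (simp add: full 1 2)
    qed
    then show ?thesis by (simp add: vec_eq_iff osq_def)
  qed
  moreover have "(\<Sum>a\<in>V. \<Sum>b\<in>V. T a b *\<^sub>R osq (b - a)) = 2 *\<^sub>R (\<Sum>(a, b)\<in>edges. T a b *\<^sub>R osq (b - a))"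
    using sym by (intro sum_edges) (auto simp: osq_def vec_eq_iff algebra_simps)
  ultimately have "2 *\<^sub>R A = 2 *\<^sub>R (\<Sum>(a, b)\<in>edges. (- T a b) *\<^sub>R osq (b - a))"
    by (simp add: sum_negf case_prod_beta)
  then show ?thesis unfolding T_def using scaleR_cancel_left by simp
qed

lemma edge_dual:
  assumes "(a, b) \<in> edges" "(c, d) \<in> edges"
  shows "- (bgrad a \<bullet> (osq (d - c) *v bgrad b)) = (if (a, b) = (c, d) then 1 else 0)"
proof -
  have V: "a \<in> V" "b \<in> V" "c \<in> V" "d \<in> V" "a \<noteq> b" "c \<noteq> d" using assms edges_distinct by blast+
  have "\<not> (a = d \<and> b = c)" using assms edges_oriented by blast
  moreover have "bgrad a \<bullet> (osq (d - c) *v bgrad b) = (bgrad b \<bullet> (d - c)) * (bgrad a \<bullet> (d - c))"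
    unfolding osq_mult_vec by (simp add: inner_commute)
  ultimately show ?thesis using V by (auto simp: bgrad_edge)
qed

lemma sym_mats_zero_if_edges_zero:
  assumes A: "A \<in> sym_mats" and z: "\<And>a b. (a, b) \<in> edges \<Longrightarrow> (b - a) \<bullet> (A *v (b - a)) = 0"
  shows "A = 0"
proof -
  have "A \<bullet> A = A \<bullet> (\<Sum>(a, b)\<in>edges. (- (bgrad a \<bullet> (A *v bgrad b))) *\<^sub>R osq (b - a))"
    using sym_mats_expansion[OF A] by simp
  also have "\<dots> = (\<Sum>(a, b)\<in>edges. (- (bgrad a \<bullet> (A *v bgrad b))) * (A \<bullet> osq (b - a)))"
    by (simp add: inner_sum_right case_prod_beta)
  also have "\<dots> = 0" using z by (intro sum.neutral) (auto simp: inner_osq)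
  finally show ?thesis by simp
qed

section \<open>Dimensions of spaces of polynomial fields\<close>

text \<open>Coordinates \<open>\<psi>\<close> separate the components, so independence can be tested componentwise.\<close>

lemma indep_family_fields:
  fixes f :: "'e \<Rightarrow> 'i \<Rightarrow> 'y \<Rightarrow> real" and T :: "'e \<Rightarrow> 'x::real_vector" and \<psi> :: "'e \<Rightarrow> 'x \<Rightarrow> real"
  assumes fin: "finite E" "finite I"
    and lin: "\<And>e. e \<in> E \<Longrightarrow> linear (\<psi> e)"
    and dual: "\<And>e e'. e \<in> E \<Longrightarrow> e' \<in> E \<Longrightarrow> \<psi> e (T e') = (if e = e' then 1 else 0)"
    and ind: "\<And>e c i. e \<in> E \<Longrightarrow> (\<And>x. (\<Sum>i\<in>I. c i * f e i x) = 0) \<Longrightarrow> i \<in> I \<Longrightarrow> c i = 0"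
  shows "indep_family (E \<times> I) (\<lambda>(e, i) x. f e i x *\<^sub>R T e)"
  unfolding indep_family_def
proof (intro allI impI ballI)
  fix c p assume z: "(\<Sum>p\<in>E \<times> I. c p *\<^sub>R (case p of (e, i) \<Rightarrow> \<lambda>x. f e i x *\<^sub>R T e)) = 0"
    and p: "p \<in> E \<times> I"
  obtain e i where ei: "p = (e, i)" "e \<in> E" "i \<in> I" using p by blast
  have "(\<Sum>i\<in>I. c (e, i) * f e i x) = 0" for x
  proof -
    have "0 = (\<Sum>p\<in>E \<times> I. c p *\<^sub>R (case p of (e, i) \<Rightarrow> \<lambda>x. f e i x *\<^sub>R T e)) x"
      using z by (simp add: zero_fun_def)
    also have "\<dots> = (\<Sum>(e', i)\<in>E \<times> I. (c (e', i) * f e' i x) *\<^sub>R T e')"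
      unfolding sum_fun by (intro sum.cong) (auto simp: scaleR_fun_def)
    finally have "0 = \<psi> e (\<Sum>(e', i)\<in>E \<times> I. (c (e', i) * f e' i x) *\<^sub>R T e')"
      using linear_0[OF lin[OF ei(2)]] by simp
    also have "\<dots> = (\<Sum>(e', i)\<in>E \<times> I. c (e', i) * f e' i x * \<psi> e (T e'))"
      by (simp add: linear_sum[OF lin[OF ei(2)]] linear_scale[OF lin[OF ei(2)]] case_prod_beta)
    also have "\<dots> = (\<Sum>e'\<in>E. \<Sum>i\<in>I. c (e', i) * f e' i x * (if e = e' then 1 else 0))"
      unfolding sum.cartesian_product using dual[OF ei(2)] by (intro sum.cong) auto
    also have "\<dots> = (\<Sum>e'\<in>E. if e = e' then (\<Sum>i\<in>I. c (e', i) * f e' i x) else 0)"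
      by (intro sum.cong) auto
    also have "\<dots> = (\<Sum>i\<in>I. c (e, i) * f e i x)"
      using fin(1) ei(2) by simp
    finally show ?thesis by simp
  qed
  then show "c p = 0" using ind[OF ei(2) _ ei(3), of "\<lambda>i. c (e, i)"] ei(1) by simp
qed

text \<open>
  If the \<open>\<psi> e\<close>-coordinate of the fields in \<open>P\<close> ranges over the span of the scalar functions \<open>f e i\<close>,
  independently for each \<open>e\<close>, then the products \<open>f e i * T e\<close> are a basis of \<open>P\<close>.
\<close>

lemma dim_fields:
  fixes f :: "'e \<Rightarrow> 'i \<Rightarrow> 'y \<Rightarrow> real" and T :: "'e \<Rightarrow> 'x::real_vector" and \<psi> :: "'e \<Rightarrow> 'x \<Rightarrow> real"
  assumes fin: "finite E" "finite I"
    and lin: "\<And>e. e \<in> E \<Longrightarrow> linear (\<psi> e)"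
    and dual: "\<And>e e'. e \<in> E \<Longrightarrow> e' \<in> E \<Longrightarrow> \<psi> e (T e') = (if e = e' then 1 else 0)"
    and ind: "\<And>e c i. e \<in> E \<Longrightarrow> (\<And>x. (\<Sum>i\<in>I. c i * f e i x) = 0) \<Longrightarrow> i \<in> I \<Longrightarrow> c i = 0"
    and P: "subspace P" "\<And>e i. e \<in> E \<Longrightarrow> i \<in> I \<Longrightarrow> (\<lambda>x. f e i x *\<^sub>R T e) \<in> P"
    and expand: "\<And>\<tau> x. \<tau> \<in> P \<Longrightarrow> \<tau> x = (\<Sum>e\<in>E. \<psi> e (\<tau> x) *\<^sub>R T e)"
    and coord: "\<And>\<tau> e. \<tau> \<in> P \<Longrightarrow> e \<in> E \<Longrightarrow> \<exists>c. \<forall>x. \<psi> e (\<tau> x) = (\<Sum>i\<in>I. c i * f e i x)"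
  shows "dim P = card E * card I \<and> finite_dim P"
proof -
  let ?f = "\<lambda>(e, i) x. f e i x *\<^sub>R T e"
  have ind: "indep_family (E \<times> I) ?f"
  proof (rule indep_family_fields[where \<psi> = \<psi>, OF fin lin dual])
    show "c i = 0" if "e \<in> E" "\<And>x. (\<Sum>i\<in>I. c i * f e i x) = 0" "i \<in> I" for e c i
      using that by (rule ind)
  qed
  have P': "P = {\<Sum>p\<in>E \<times> I. c p *\<^sub>R ?f p | c. True}"
  proof safe
    fix \<tau> assume \<tau>: "\<tau> \<in> P"
    have "\<forall>e\<in>E. \<exists>c. \<forall>x. \<psi> e (\<tau> x) = (\<Sum>i\<in>I. c i * f e i x)" using coord[OF \<tau>] by (rule ballI)
    from bchoice[OF this] obtain c where c: "\<forall>e\<in>E. \<forall>x. \<psi> e (\<tau> x) = (\<Sum>i\<in>I. c e i * f e i x)" ..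
    have "\<tau> x = (\<Sum>p\<in>E \<times> I. (case p of (e, i) \<Rightarrow> c e i) *\<^sub>R ?f p) x" for x
    proof -
      have "\<tau> x = (\<Sum>e\<in>E. \<psi> e (\<tau> x) *\<^sub>R T e)" by (rule expand[OF \<tau>])
      also have "\<dots> = (\<Sum>e\<in>E. (\<Sum>i\<in>I. c e i * f e i x) *\<^sub>R T e)"
        using c by (intro sum.cong) simp_all
      also have "\<dots> = (\<Sum>e\<in>E. \<Sum>i\<in>I. c e i *\<^sub>R f e i x *\<^sub>R T e)"
        by (simp add: scaleR_sum_left)
      finally show ?thesis
        unfolding sum_fun sum.cartesian_product by (simp add: scaleR_fun_def case_prod_beta)
    qed
    then show "\<exists>c. \<tau> = (\<Sum>p\<in>E \<times> I. c p *\<^sub>R ?f p) \<and> True" by blast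
  next
    fix c
    show "(\<Sum>p\<in>E \<times> I. c p *\<^sub>R ?f p) \<in> P"
      using P(2) by (intro subspace_sum subspace_scale P(1)) auto
  qed
  show ?thesis
    using dim_indep_family[OF ind _ P'] fin by (auto simp: card_cartesian_product)
qed

lemma polys_range: "p \<in> polys J X \<Longrightarrow> subspace X \<Longrightarrow> p x \<in> X"
  unfolding polys_eq by (auto intro!: subspace_sum subspace_scale)

proposition dim_polys:
  fixes X :: "'x::real_vector set" and T :: "'e \<Rightarrow> 'x" and \<psi> :: "'e \<Rightarrow> 'x \<Rightarrow> real"
  assumes E: "finite E" and X: "subspace X" and T: "\<And>e. e \<in> E \<Longrightarrow> T e \<in> X"
    and lin: "\<And>e. e \<in> E \<Longrightarrow> linear (\<psi> e)"
    and dual: "\<And>e e'. e \<in> E \<Longrightarrow> e' \<in> E \<Longrightarrow> \<psi> e (T e') = (if e = e' then 1 else 0)"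
    and expand: "\<And>c. c \<in> X \<Longrightarrow> c = (\<Sum>e\<in>E. \<psi> e c *\<^sub>R T e)"
  shows "dim (polys {..m} X :: (real^'n \<Rightarrow> 'x) set) = card E * ((m + CARD('n)) choose CARD('n))"
    and "finite_dim (polys {..m} X :: (real^'n \<Rightarrow> 'x) set)"
proof -
  let ?I = "multi_indices V m" and ?P = "polys {..m} X :: (real^'n \<Rightarrow> 'x) set"
  have "dim ?P = card E * card ?I \<and> finite_dim ?P"
  proof (rule dim_fields[where \<psi> = \<psi> and f = "\<lambda>e. bern" and T = T,
        OF E finite_multi_indices[OF finite_V] lin dual _ subspace_polys[OF X]])
    show "c \<alpha> = 0" if "\<And>x. (\<Sum>\<alpha>\<in>?I. c \<alpha> * bern \<alpha> x) = 0" "\<alpha> \<in> ?I" for c \<alpha>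
      by (rule bern_independent_on_face[OF order_refl V_nonempty _ that(2)]) (rule that(1))
    show "(\<lambda>x. bern \<alpha> x *\<^sub>R T e) \<in> ?P" if "e \<in> E" "\<alpha> \<in> ?I" for e \<alpha>
      using that by (intro polys_scaleR bern_in_polys X T)
    fix p assume p: "p \<in> ?P"
    show "p x = (\<Sum>e\<in>E. \<psi> e (p x) *\<^sub>R T e)" for x
      by (rule expand[OF polys_range[OF p X]])
    show "\<exists>c. \<forall>x. \<psi> e (p x) = (\<Sum>\<alpha>\<in>?I. c \<alpha> * bern \<alpha> x)" if "e \<in> E" for e
    proof -
      from polys_bernE[OF polys_linear_image[OF p lin[OF that] subset_UNIV]]
      obtain c where "(\<lambda>x. \<psi> e (p x)) = (\<lambda>x. \<Sum>\<alpha>\<in>?I. c \<alpha> * bern \<alpha> x)" by blast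
      then show ?thesis by (auto simp: fun_eq_iff)
    qed
  qed
  then show "dim ?P = card E * ((m + CARD('n)) choose CARD('n))" and "finite_dim ?P"
    by (simp_all add: card_multi_indices_V)
qed

lemma
  shows dim_polys_vec: "dim (polys {..m} UNIV :: (real^'n \<Rightarrow> real^'n) set) =
      CARD('n) * ((m + CARD('n)) choose CARD('n))"
    and finite_dim_polys_vec: "finite_dim (polys {..m} UNIV :: (real^'n \<Rightarrow> real^'n) set)"
proof -
  have 1: "linear (\<lambda>x::real^'n. x $ i)" for i by (simp add: linear_iff)
  have 2: "c = (\<Sum>i\<in>UNIV. c $ i *\<^sub>R axis i 1)" for c :: "real^'n"
    using basis_expansion[of c] by (simp add: scalar_mult_eq_scaleR)
  show "dim (polys {..m} UNIV :: (real^'n \<Rightarrow> real^'n) set) = CARD('n) * ((m + CARD('n)) choose CARD('n))"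
    and "finite_dim (polys {..m} UNIV :: (real^'n \<Rightarrow> real^'n) set)"
    using dim_polys[of "UNIV :: 'n set" UNIV "\<lambda>i. axis i 1" "\<lambda>i x. x $ i" m] 1 2
    by (simp_all add: axis_def eq_commute)
qed

lemma linear_edge_coord: "linear (\<lambda>A :: real^'n^'n. - (bgrad a \<bullet> (A *v bgrad b)))"
  by (simp add: linear_iff matrix_vector_mult_add_rdistrib inner_add_right scaleR_matrix_vector_assoc[symmetric])

lemma
  shows dim_polys_sym: "dim (polys {..m} sym_mats :: (real^'n \<Rightarrow> real^'n^'n) set) =
      card edges * ((m + CARD('n)) choose CARD('n))"
    and finite_dim_polys_sym: "finite_dim (polys {..m} sym_mats :: (real^'n \<Rightarrow> real^'n^'n) set)"
  using dim_polys[of edges sym_mats "\<lambda>(a, b). osq (b - a)" "\<lambda>(a, b) A. - (bgrad a \<bullet> (A *v bgrad b))" m,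
      OF finite_edges subspace_sym_mats] sym_mats_expansion edge_dual linear_edge_coord
  by (auto simp: osq_in_sym_mats case_prod_beta)

section \<open>Matrix fields with vanishing normal components on the boundary\<close>

text \<open>
  One normal per facet is enough here, because \<open>bgrad a\<close> spans the normals of the facet opposite to \<open>a\<close>.
\<close>

definition bubbles :: "nat \<Rightarrow> (real^'n \<Rightarrow> real^'n^'n) set"
  where "bubbles m = {\<tau> \<in> polys {..m} sym_mats. \<forall>a\<in>V. \<forall>x\<in>convex hull (V - {a}). \<tau> x *v bgrad a = 0}"

lemma subspace_bubbles: "subspace (bubbles m)"
proof -
  have "subspace (polys {..m} sym_mats :: (real^'n \<Rightarrow> real^'n^'n) set)"
    by (rule subspace_polys[OF subspace_sym_mats])
  then show ?thesis
    by (auto simp: subspace_def bubbles_def zero_fun_def plus_fun_def scaleR_fun_def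
        matrix_vector_mult_add_rdistrib scaleR_matrix_vector_assoc[symmetric])
qed

lemma finite_dim_bubbles: "finite_dim (bubbles m)"
  by (rule finite_dim_subset[OF finite_dim_polys_sym[of m]]) (auto simp: bubbles_def)

text \<open>
  On the facet opposite to \<open>c\<close>, either \<open>c\<close> is an end point of the edge and a barycentric coordinate
  vanishes, or the edge \<open>b - a\<close> lies in the facet and is orthogonal to its normal.
\<close>

lemma edge_bubble_in_bubbles:
  assumes m: "m \<ge> 2" and ab: "a \<in> V" "b \<in> V" and q: "q \<in> polys {..m - 2} UNIV"
  shows "(\<lambda>x. (bary a x * bary b x * q x) *\<^sub>R osq (b - a)) \<in> bubbles m"
proof -
  have deg: "1 + 1 + (m - 2) = m" using m by simp
  have "(\<lambda>x. bary a x * bary b x * q x) \<in> polys {..1 + 1 + (m - 2)} UNIV"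
    by (intro polys_mult bary_polys ab q)
  then have "(\<lambda>x. (bary a x * bary b x * q x) *\<^sub>R osq (b - a)) \<in> polys {..m} sym_mats"
    unfolding deg by (rule polys_scaleR[OF _ subspace_sym_mats osq_in_sym_mats])
  moreover have "((bary a x * bary b x * q x) *\<^sub>R osq (b - a)) *v bgrad c = 0"
    if c: "c \<in> V" "x \<in> convex hull (V - {c})" for c x
  proof -
    have "bary c x = 0" using c face_iff[of "V - {c}" x] by auto
    moreover have "((b - a) \<bullet> bgrad c) = 0" if "c \<noteq> a" "c \<noteq> b"
      using bgrad_edge[OF c(1) ab] that by (simp add: inner_commute)
    ultimately show ?thesis
      by (cases "c = a \<or> c = b") (auto simp: scaleR_matrix_vector_assoc[symmetric] osq_mult_vec)
  qed
  ultimately show ?thesis by (simp add: bubbles_def)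
qed

text \<open>
  The coefficient of \<open>osq (b - a)\<close> in \<open>\<tau>\<close> is \<open>- g\<^sub>a \<bullet> \<tau> g\<^sub>b\<close>, which vanishes on both facets opposite to
  \<open>a\<close> and to \<open>b\<close>.
\<close>

proposition bubbles_coefficient:
  assumes m: "m \<ge> 2" and \<tau>: "\<tau> \<in> bubbles m" and e: "(a, b) \<in> edges"
  obtains q where "q \<in> polys {..m - 2} UNIV"
    and "\<And>x. - (bgrad a \<bullet> (\<tau> x *v bgrad b)) = bary a x * bary b x * q x"
proof -
  have ab: "a \<in> V" "b \<in> V" "a \<noteq> b" using edges_distinct[OF e] by auto
  let ?p = "\<lambda>x. - (bgrad a \<bullet> (\<tau> x *v bgrad b))"
  have \<tau>S: "\<tau> \<in> polys {..m} sym_mats" using \<tau> by (simp add: bubbles_def)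
  have p: "?p \<in> polys {..m} UNIV"
    by (rule polys_linear_image[OF \<tau>S linear_edge_coord]) simp
  have z: "?p x = 0" if "v \<in> {a, b}" "x \<in> convex hull (V - {v})" for v x
  proof -
    have "\<tau> x *v bgrad v = 0" using \<tau> that ab by (auto simp: bubbles_def)
    moreover have "bgrad a \<bullet> (\<tau> x *v bgrad b) = bgrad b \<bullet> (\<tau> x *v bgrad a)"
      by (rule sym_mats_inner[OF polys_range[OF \<tau>S subspace_sym_mats]])
    ultimately show ?thesis using that(1) by auto
  qed
  obtain q where q: "q \<in> polys {..m - card {a, b}} UNIV"
    "\<And>x. x \<in> convex hull V \<Longrightarrow> ?p x = (\<Prod>v\<in>{a, b}. bary v x) * q x"
  proof (rule polys_factor_on_face[of V "{a, b}" ?p m])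
    show "V \<subseteq> V" "{a, b} \<subseteq> V" "m > 0" using ab m by auto
    show "?p \<in> polys {..m} UNIV" by (rule p)
    show "?p x = 0" if "v \<in> {a, b}" "x \<in> convex hull (V - {v})" for v x by (rule z[OF that])
  qed (rule that)
  have q2: "q \<in> polys {..m - 2} UNIV" using q(1) ab(3) by (simp add: numeral_2_eq_2)
  have eq: "?p x = bary a x * bary b x * q x" if "x \<in> convex hull V" for x
    using q(2)[OF that] ab(3) by simp
  have deg: "1 + 1 + (m - 2) = m" using m by simp
  have r: "(\<lambda>x. bary a x * bary b x * q x) \<in> polys {..m} UNIV"
    using polys_mult[OF polys_mult[OF bary_polys[OF ab(1)] bary_polys[OF ab(2)]] q2] unfolding deg .
  have "?p x = bary a x * bary b x * q x" for x
  proof -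
    have "(\<lambda>x. ?p x + (- 1) * (bary a x * bary b x * q x)) \<in> polys {..m} UNIV"
      by (intro polys_add polys_cmult p r) simp
    from polys_zero_on_simplex[OF this] eq show ?thesis by fastforce
  qed
  then show ?thesis using q2 by (rule that[rotated])
qed

proposition dim_bubbles:
  assumes m: "m \<ge> 2"
  shows "dim (bubbles m) = card edges * ((m - 2 + CARD('n)) choose CARD('n))"
proof -
  let ?I = "multi_indices V (m - 2)"
  let ?g = "\<lambda>e \<beta> x. bary (fst e) x * bary (snd e) x * bern \<beta> x"
  let ?T = "\<lambda>e. osq (snd e - fst e)"
  let ?\<psi> = "\<lambda>e A. - (bgrad (fst e) \<bullet> (A *v bgrad (snd e)))"
  have "dim (bubbles m) = card edges * card ?I \<and> finite_dim (bubbles m)"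
  proof (rule dim_fields[where \<psi> = ?\<psi> and f = ?g and T = ?T,
        OF finite_edges finite_multi_indices[OF finite_V] linear_edge_coord _ _ subspace_bubbles])
    show "?\<psi> e (?T e') = (if e = e' then 1 else 0)" if "e \<in> edges" "e' \<in> edges" for e e'
      using edge_dual[of "fst e" "snd e" "fst e'" "snd e'"] that by simp
  next
    fix e assume e: "e \<in> edges"
    then have V: "fst e \<in> V" "snd e \<in> V" using edges_distinct[of "fst e" "snd e"] by auto
    show "(\<lambda>x. ?g e \<beta> x *\<^sub>R ?T e) \<in> bubbles m" if "\<beta> \<in> ?I" for \<beta>
      by (rule edge_bubble_in_bubbles[OF m V bern_in_polys[OF that]])
    show "c \<beta> = 0" if z: "\<And>x. (\<Sum>\<beta>\<in>?I. c \<beta> * ?g e \<beta> x) = 0" and \<beta>: "\<beta> \<in> ?I" for c \<beta>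
    proof (rule bern_independent_on_face[OF order_refl V_nonempty _ \<beta>])
      fix x assume "\<And>v. v \<in> V \<Longrightarrow> 0 < bary v x"
      then have "0 < bary (fst e) x" "0 < bary (snd e) x" using V by auto
      moreover have "bary (fst e) x * bary (snd e) x * (\<Sum>\<beta>\<in>?I. c \<beta> * bern \<beta> x) = 0"
        using z[of x] by (simp add: sum_distrib_left mult_ac)
      ultimately show "(\<Sum>\<beta>\<in>?I. c \<beta> * bern \<beta> x) = 0" by simp
    qed
    fix \<tau> assume \<tau>: "\<tau> \<in> bubbles m"
    obtain q where q: "q \<in> polys {..m - 2} UNIV" "\<And>x. ?\<psi> e (\<tau> x) = bary (fst e) x * bary (snd e) x * q x"
      using bubbles_coefficient[OF m \<tau>, of "fst e" "snd e"] e by auto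
    obtain c where "q = (\<lambda>x. \<Sum>\<beta>\<in>?I. c \<beta> * bern \<beta> x)" using polys_bernE[OF q(1)] by blast
    then show "\<exists>c. \<forall>x. ?\<psi> e (\<tau> x) = (\<Sum>\<beta>\<in>?I. c \<beta> * ?g e \<beta> x)"
      using q(2) by (intro exI[of _ c]) (simp add: sum_distrib_left mult_ac)
  next
    fix \<tau> x assume "\<tau> \<in> bubbles m"
    then have "\<tau> x \<in> sym_mats" using polys_range subspace_sym_mats by (auto simp: bubbles_def)
    then show "\<tau> x = (\<Sum>e\<in>edges. ?\<psi> e (\<tau> x) *\<^sub>R ?T e)"
      using sym_mats_expansion[of "\<tau> x"] by (simp add: case_prod_beta)
  qed
  then show ?thesis by (simp add: card_multi_indices_V)
qed

end

section \<open>Integration over the simplex\<close>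

lemma polys_line_derivative:
  fixes p :: "real^'n \<Rightarrow> real"
  assumes "p \<in> polys J UNIV" "finite J"
  shows "((\<lambda>s. p (x + s *\<^sub>R t)) has_real_derivative dderiv t p (x + s *\<^sub>R t)) (at s)"
proof -
  have "((\<lambda>s. x + s *\<^sub>R t) has_derivative (\<lambda>r. r *\<^sub>R t)) (at s)"
    by (auto intro!: derivative_eq_intros)
  from has_derivative_compose[OF this polys_has_derivative[OF assms]]
  have 1: "((\<lambda>s. p (x + s *\<^sub>R t)) has_derivative (\<lambda>r. dderiv (r *\<^sub>R t) p (x + s *\<^sub>R t))) (at s)" .
  have "dderiv (r *\<^sub>R t) p y = dderiv t p y * r" for r y
    using linear_scale[OF has_derivative_linear[OF polys_has_derivative[OF assms, of y]], of r t] by simp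
  with 1 show ?thesis unfolding has_field_derivative_def by (simp add: mult.commute[of _ "dderiv t p _"] ext)
qed

context simplex_vertices
begin

abbreviation simplex_integral :: "(real^'n \<Rightarrow> real) \<Rightarrow> real"
  where "simplex_integral g \<equiv> (LINT x:convex hull V|lborel. g x)"

lemma compact_simplex: "compact (convex hull V)"
  by (rule finite_imp_compact_convex_hull[OF finite_V])

lemma integrable_on_simplex:
  fixes g :: "real^'n \<Rightarrow> real"
  assumes "continuous_on UNIV g" shows "set_integrable lborel (convex hull V) g"
  unfolding set_integrable_def
  by (rule borel_integrable_compact[OF compact_simplex continuous_on_subset[OF assms subset_UNIV]])

lemma simplex_integral_add:
  "continuous_on UNIV f \<Longrightarrow> continuous_on UNIV g \<Longrightarrow>
    simplex_integral (\<lambda>x. f x + g x) = simplex_integral f + simplex_integral g"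
  by (intro set_integral_add integrable_on_simplex)

lemma simplex_integral_sum:
  assumes "finite I" "\<And>i. i \<in> I \<Longrightarrow> continuous_on UNIV (f i)"
  shows "simplex_integral (\<lambda>x. \<Sum>i\<in>I. f i x) = (\<Sum>i\<in>I. simplex_integral (f i))"
  using assms
proof (induction I rule: finite_induct)
  case empty
  then show ?case by (simp add: set_lebesgue_integral_def)
next
  case (insert i I)
  then show ?case by (simp add: simplex_integral_add continuous_on_sum)
qed

lemma open_bary_pos: "open {x. \<forall>v\<in>V. 0 < bary v x}"
  using finite_V continuous_bary[of _ UNIV]
  by (auto simp: Collect_ball_eq intro!: open_INT open_Collect_less)

text \<open>
  Otherwise \<open>g\<close> would be positive on a nonempty open set inside the simplex.
\<close>

lemma simplex_integral_zero_imp: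
  assumes g: "continuous_on UNIV g" "\<And>x. x \<in> convex hull V \<Longrightarrow> 0 \<le> g x"
    and z: "simplex_integral g = 0" and x: "\<And>v. v \<in> V \<Longrightarrow> 0 < bary v x"
  shows "g x = 0"
proof (rule ccontr)
  assume "g x \<noteq> 0"
  let ?W = "{x. \<forall>v\<in>V. 0 < bary v x} \<inter> {x. g x \<noteq> 0}"
  have W: "open ?W"
    using g(1) by (intro open_Int open_bary_pos open_Collect_neq continuous_on_const)
  have "AE x in lborel. indicator (convex hull V) x *\<^sub>R g x = 0"
    using integral_nonneg_eq_0_iff_AE[OF integrable_on_simplex[OF g(1), unfolded set_integrable_def]] g(2) z
    unfolding set_lebesgue_integral_def by (auto simp: indicator_def)
  then have "AE x in lborel. x \<notin> ?W"
  proof (rule AE_mp)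
    have "y \<in> convex hull V" if "\<forall>v\<in>V. 0 < bary v y" for y
      using that face_iff[OF order_refl, of y] by (auto intro: less_imp_le)
    then show "AE y in lborel. indicator (convex hull V) y *\<^sub>R g y = 0 \<longrightarrow> y \<notin> ?W"
      by (intro AE_I2) (auto simp: indicator_def split: if_splits)
  qed
  moreover have "?W \<in> sets lborel" using W by simp
  ultimately have "?W \<in> null_sets lborel"
    using AE_iff_null_sets by blast
  then have "negligible ?W"
    unfolding negligible_iff_null_sets by (rule null_sets_completionI)
  moreover have "x \<in> ?W" using x \<open>g x \<noteq> 0\<close> by simp
  ultimately show False using open_not_negligible[OF W] by blast
qed

lemma simplex_bounded_function:
  fixes g :: "real^'n \<Rightarrow> real"
  assumes "continuous_on UNIV g"
  obtains B where "B \<ge> 0" "\<And>x. x \<in> convex hull V \<Longrightarrow> \<bar>g x\<bar> \<le> B"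
proof -
  have "bounded (g ` (convex hull V))"
    using compact_simplex assms
    by (intro compact_imp_bounded compact_continuous_image continuous_on_subset[OF assms]) auto
  then obtain B where "\<forall>x\<in>convex hull V. \<bar>g x\<bar> \<le> B"
    by (auto simp: bounded_iff)
  then show ?thesis by (intro that[of "max 0 B"]) auto
qed

text \<open>
  The field \<open>f (b - a)\<close> with \<open>f = bary a * bary b * q\<close> has no flux through the boundary: a facet is
  either parallel to the edge \<open>b - a\<close>, or \<open>f\<close> vanishes on it. Concretely, the extension of \<open>f\<close> by zero
  is Lipschitz in the direction \<open>b - a\<close>, so its difference quotients, whose integrals vanish by
  translation invariance, converge dominatedly to the derivative.
\<close>

proposition simplex_integral_edge_derivative:
  assumes ab: "a \<in> V" "b \<in> V" "a \<noteq> b" and q: "q \<in> polys {..m} UNIV"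
  shows "simplex_integral (dderiv (b - a) (\<lambda>x. bary a x * bary b x * q x)) = 0"
proof -
  define K where "K = convex hull V"
  define t where "t = b - a"
  define f where "f = (\<lambda>x. bary a x * bary b x * q x)"
  define F where "F = (\<lambda>x. indicator K x * f x)"
  define h :: "nat \<Rightarrow> real" where "h = (\<lambda>k. 1 / real (Suc k))"
  have h: "h k > 0" "h k \<le> 1" for k by (auto simp: h_def)
  have h_lim: "h \<longlonglongrightarrow> 0" unfolding h_def using LIMSEQ_inverse_real_of_nat by (simp add: inverse_eq_divide)
  define D where "D = (\<lambda>k x. (F (x + h k *\<^sub>R t) - F x) / h k)"
  have f: "f \<in> polys {..1 + 1 + m} UNIV"
    unfolding f_def by (intro polys_mult bary_polys ab q)
  have df: "dderiv t f \<in> polys {..1 + 1 + m} UNIV"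
    by (rule dderiv_polys[OF f]) auto
  have cf: "continuous_on UNIV f" "continuous_on UNIV (dderiv t f)"
    using polys_continuous[OF f] polys_continuous[OF df] by auto
  have cK: "convex K" "closed K" "K \<in> sets borel" "bounded K"
    unfolding K_def using compact_simplex by (auto intro: compact_imp_closed compact_imp_bounded borel_closed)
  have Kpos: "x \<in> K \<longleftrightarrow> (\<forall>v\<in>V. 0 \<le> bary v x)" for x
    unfolding K_def using face_iff[OF order_refl, of x] by simp
  have step: "bary v (x + s *\<^sub>R t) = bary v x + s * ((if v = b then 1 else 0) - (if v = a then 1 else 0))"
    if "v \<in> V" for v x s
    using bary_line[OF that, of x s b a] bary_vertex[OF that] ab unfolding t_def by simp
  have F: "integrable lborel F"
    using integrable_on_simplex[OF cf(1)] unfolding F_def K_def set_integrable_def by simp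
  have cq: "continuous_on UNIV q" using polys_continuous[OF q] by auto
  obtain B0 where B0: "B0 \<ge> 0" "\<And>x. x \<in> K \<Longrightarrow> \<bar>dderiv t f x\<bar> \<le> B0"
    using simplex_bounded_function[OF cf(2)] unfolding K_def by blast
  obtain Ba where Ba: "Ba \<ge> 0" "\<And>x. x \<in> K \<Longrightarrow> \<bar>bary b x * q x\<bar> \<le> Ba"
    using simplex_bounded_function[OF continuous_on_mult[OF continuous_bary[OF ab(2)] cq]] unfolding K_def by blast
  obtain Bb where Bb: "Bb \<ge> 0" "\<And>x. x \<in> K \<Longrightarrow> \<bar>bary a x * q x\<bar> \<le> Bb"
    using simplex_bounded_function[OF continuous_on_mult[OF continuous_bary[OF ab(1)] cq]] unfolding K_def by blast
  define C where "C = B0 + Ba + Bb"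
  obtain R where R: "\<And>x. x \<in> K \<Longrightarrow> norm x \<le> R" using cK(4) unfolding bounded_iff by blast
  have bound: "\<bar>F (x + s *\<^sub>R t) - F x\<bar> \<le> s * C" if s: "0 < s" for x s
  proof -
    have sC: "s * B0 \<le> s * C" "s * Ba \<le> s * C" "s * Bb \<le> s * C" "0 \<le> s * C"
      using s B0(1) Ba(1) Bb(1) by (auto simp: C_def)
    consider "x \<in> K" "x + s *\<^sub>R t \<in> K" | "x \<in> K" "x + s *\<^sub>R t \<notin> K" | "x \<notin> K" "x + s *\<^sub>R t \<in> K"
      | "x \<notin> K" "x + s *\<^sub>R t \<notin> K" by blast
    then show ?thesis
    proof cases
      case 1
      obtain z where z: "0 < z" "z < s" "f (x + s *\<^sub>R t) - f (x + 0 *\<^sub>R t) = (s - 0) * dderiv t f (x + z *\<^sub>R t)"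
        using MVT2[OF s polys_line_derivative[OF f finite_atMost]] by blast
      have "x + z *\<^sub>R t \<in> K"
        unfolding Kpos
      proof
        fix v assume v: "v \<in> V"
        have "0 \<le> bary v x" "0 \<le> bary v (x + s *\<^sub>R t)" using 1 v Kpos by auto
        then show "0 \<le> bary v (x + z *\<^sub>R t)" using step[OF v] z(1,2) by (auto split: if_splits)
      qed
      then have "s * \<bar>dderiv t f (x + z *\<^sub>R t)\<bar> \<le> s * B0" using B0(2) s by (intro mult_left_mono) auto
      then show ?thesis using 1 z(3) s sC by (simp add: F_def abs_mult)
    next
      \<comment> \<open>Only \<open>bary a\<close> decreases in the direction \<open>t\<close>, so the point leaves through the facet opposite to \<open>a\<close>.\<close>
      case 2
      then obtain v where v: "v \<in> V" "bary v (x + s *\<^sub>R t) < 0" using Kpos by force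
      have "0 \<le> bary v x" using 2 v Kpos by auto
      then have "v = a" using step[OF v(1), of x s] v(2) s by (auto split: if_splits)
      then have "bary a x \<le> s" "0 \<le> bary a x"
        using step[OF v(1), of x s] v(2) \<open>0 \<le> bary v x\<close> ab(3) by auto
      then have "\<bar>f x\<bar> \<le> s * Ba"
        unfolding f_def mult.assoc[of "bary a x"] abs_mult[of "bary a x"] using Ba(2)[OF 2(1)] s
        by (intro mult_mono) auto
      then show ?thesis using 2 sC by (simp add: F_def)
    next
      \<comment> \<open>Only \<open>bary b\<close> increases in the direction \<open>t\<close>, so the point enters through the facet opposite to \<open>b\<close>.\<close>
      case 3
      let ?y = "x + s *\<^sub>R t"
      obtain v where v: "v \<in> V" "bary v x < 0" using 3 Kpos by force
      have "0 \<le> bary v ?y" using 3 v Kpos by auto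
      then have "v = b" using step[OF v(1), of x s] v(2) s by (auto split: if_splits)
      then have "bary b ?y \<le> s" "0 \<le> bary b ?y"
        using step[OF v(1), of x s] v(2) \<open>0 \<le> bary v ?y\<close> ab(3) by auto
      then have "\<bar>bary b ?y\<bar> * \<bar>bary a ?y * q ?y\<bar> \<le> s * Bb"
        using Bb(2)[OF 3(2)] s by (intro mult_mono) auto
      then have "\<bar>f ?y\<bar> \<le> s * Bb"
        unfolding f_def by (simp add: abs_mult mult_ac)
      then show ?thesis using 3 sC by (simp add: F_def)
    next
      case 4
      then show ?thesis using sC by (simp add: F_def)
    qed
  qed
  have int_D: "integrable lborel (D k)" "integral\<^sup>L lborel (D k) = 0" for k
  proof -
    have shift: "distr lborel borel ((+) (h k *\<^sub>R t)) = lborel" by (rule lborel_distr_plus)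
    have 1: "integrable lborel (\<lambda>x. F (h k *\<^sub>R t + x))"
      using F integrable_distr_eq[of "(+) (h k *\<^sub>R t)" lborel borel F] shift borel_measurable_integrable[OF F] by simp
    have 2: "integral\<^sup>L lborel (\<lambda>x. F (h k *\<^sub>R t + x)) = integral\<^sup>L lborel F"
      using integral_distr[of "(+) (h k *\<^sub>R t)" lborel borel F] shift borel_measurable_integrable[OF F] by simp
    have D: "D k = (\<lambda>x. (F (h k *\<^sub>R t + x) - F x) / h k)" by (simp add: D_def add.commute)
    show "integrable lborel (D k)" unfolding D using 1 F by (intro integrable_divide Bochner_Integration.integrable_diff)
    show "integral\<^sup>L lborel (D k) = 0" unfolding D using 1 2 F by simp
  qed
  define w where "w = (\<lambda>x::real^'n. indicator (cball 0 (R + norm t)) x * C)"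
  have w: "integrable lborel w"
    using borel_integrable_compact[of "cball 0 (R + norm t)" "\<lambda>_::real^'n. C"] unfolding w_def by simp
  have C0: "0 \<le> C" using B0 Ba Bb by (simp add: C_def)
  have D_le: "\<bar>D k x\<bar> \<le> w x" for k x
  proof (cases "x \<in> cball 0 (R + norm t)")
    case True
    have "\<bar>D k x\<bar> = \<bar>F (x + h k *\<^sub>R t) - F x\<bar> / h k" using h[of k] by (simp add: D_def)
    also have "\<dots> \<le> (h k * C) / h k" using bound[OF h(1)[of k], of x] h[of k] by (intro divide_right_mono) auto
    finally show ?thesis using True h[of k] by (simp add: w_def)
  next
    case False
    then have nx: "norm x > R + norm t" by simp
    then have "x \<notin> K" using R[of x] norm_ge_zero[of t] by linarith
    moreover have "x + h k *\<^sub>R t \<notin> K"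
    proof
      assume "x + h k *\<^sub>R t \<in> K"
      then have "norm (x + h k *\<^sub>R t) \<le> R" by (rule R)
      moreover have "norm x \<le> norm (x + h k *\<^sub>R t) + norm (h k *\<^sub>R t)"
        using norm_triangle_sub[of x "- (h k *\<^sub>R t)"] by simp
      moreover have "norm (h k *\<^sub>R t) \<le> norm t" using h[of k] by (simp add: mult_left_le_one_le)
      ultimately show False using nx by linarith
    qed
    ultimately show ?thesis using C0 by (simp add: D_def F_def w_def)
  qed
  have D_lim: "(\<lambda>k. D k x) \<longlonglongrightarrow> indicator K x * dderiv t f x" if x: "x \<notin> frontier K" for x
  proof -
    have lim: "(\<lambda>k. x + h k *\<^sub>R t) \<longlonglongrightarrow> x"
      using tendsto_add[OF tendsto_const[of x] tendsto_scaleR[OF h_lim tendsto_const[of t]]] by simp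
    show ?thesis
    proof (cases "x \<in> K")
      case True
      then have xi: "x \<in> interior K" using x cK(2) by (simp add: frontier_def)
      have "eventually (\<lambda>k. x + h k *\<^sub>R t \<in> interior K) sequentially"
        using topological_tendstoD[OF lim open_interior xi] .
      then have ev: "eventually (\<lambda>k. (f (x + h k *\<^sub>R t) - f x) / h k = D k x) sequentially"
      proof (rule eventually_mono)
        fix k assume "x + h k *\<^sub>R t \<in> interior K"
        then have "x + h k *\<^sub>R t \<in> K" using interior_subset by blast
        then show "(f (x + h k *\<^sub>R t) - f x) / h k = D k x" using True by (simp add: D_def F_def)
      qed
      have "((\<lambda>s. (f (x + s *\<^sub>R t) - f x) / s) \<longlongrightarrow> dderiv t f x) (at 0)"
        using polys_line_derivative[OF f finite_atMost, of x t 0] unfolding has_field_derivative_iff by simp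
      moreover have "filterlim h (at 0) sequentially"
        using h_lim h(1) by (auto simp: filterlim_at intro!: always_eventually less_imp_neq[symmetric])
      ultimately have "(\<lambda>k. (f (x + h k *\<^sub>R t) - f x) / h k) \<longlonglongrightarrow> dderiv t f x"
        by (rule filterlim_compose)
      from Lim_transform_eventually[OF this ev] show ?thesis using True by simp
    next
      case False
      have "eventually (\<lambda>k. x + h k *\<^sub>R t \<in> - K) sequentially"
        using topological_tendstoD[OF lim, of "- K"] cK(2) False by auto
      then have "eventually (\<lambda>k. 0 = D k x) sequentially"
        by (rule eventually_mono) (use False in \<open>simp add: D_def F_def\<close>)
      from Lim_transform_eventually[OF tendsto_const this] show ?thesis using False by simp
    qed
  qed
  have "negligible (frontier K)" by (rule negligible_convex_frontier[OF cK(1)])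
  then have "frontier K \<in> null_sets lborel"
    unfolding negligible_iff_null_sets using null_sets_completion_iff[of "frontier K" lborel] by simp
  then have AE: "AE x in lborel. x \<notin> frontier K" by (rule AE_not_in)
  have meas: "(\<lambda>x. indicator K x * dderiv t f x) \<in> borel_measurable lborel"
    using integrable_on_simplex[OF cf(2)] unfolding set_integrable_def K_def
    by (auto dest: borel_measurable_integrable)
  have "(\<lambda>k. integral\<^sup>L lborel (D k)) \<longlonglongrightarrow> integral\<^sup>L lborel (\<lambda>x. indicator K x * dderiv t f x)"
  proof (rule integral_dominated_convergence[OF meas _ w])
    show "D k \<in> borel_measurable lborel" for k using int_D(1) by (rule borel_measurable_integrable)
    show "AE x in lborel. (\<lambda>k. D k x) \<longlonglongrightarrow> indicator K x * dderiv t f x"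
      using AE by (rule AE_mp) (use D_lim in \<open>auto intro!: AE_I2\<close>)
    show "AE x in lborel. norm (D k x) \<le> w x" for k using D_le by (auto intro!: AE_I2)
  qed
  then have "integral\<^sup>L lborel (\<lambda>x. indicator K x * dderiv t f x) = 0"
    unfolding int_D(2) using LIMSEQ_unique tendsto_const by blast
  then show ?thesis
    unfolding set_lebesgue_integral_def K_def t_def f_def by simp
qed

end

section \<open>Divergence and symmetric gradient of polynomial fields\<close>

lemma dderiv_add:
  fixes p q :: "real^'n \<Rightarrow> real"
  assumes "p \<in> polys J UNIV" "q \<in> polys J' UNIV" "finite J" "finite J'"
  shows "dderiv t (\<lambda>y. p y + q y) x = dderiv t p x + dderiv t q x"
  using assms by (intro dderiv_eq[THEN trans[rotated], OF _ refl] dderiv_eq has_derivative_add polys_has_derivative)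

lemma dderiv_cmult:
  fixes p :: "real^'n \<Rightarrow> real"
  assumes "p \<in> polys J UNIV" "finite J"
  shows "dderiv t (\<lambda>y. c * p y) x = c * dderiv t p x"
  using has_derivative_mult_right[OF polys_has_derivative[OF assms], of c x] by (rule dderiv_eq)

lemma dderiv_sum:
  fixes p :: "'i \<Rightarrow> real^'n \<Rightarrow> real"
  assumes "\<And>i. i \<in> I \<Longrightarrow> p i \<in> polys J UNIV" "finite J"
  shows "dderiv t (\<lambda>y. \<Sum>i\<in>I. p i y) x = (\<Sum>i\<in>I. dderiv t (p i) x)"
proof (rule dderiv_eq)
  show "((\<lambda>y. \<Sum>i\<in>I. p i y) has_derivative (\<lambda>t. \<Sum>i\<in>I. dderiv t (p i) x)) (at x)"
    by (intro has_derivative_sum polys_has_derivative[OF assms(1) assms(2)])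
qed

lemma dderiv_mult:
  fixes p q :: "real^'n \<Rightarrow> real"
  assumes "p \<in> polys J UNIV" "q \<in> polys J' UNIV" "finite J" "finite J'"
  shows "dderiv t (\<lambda>y. p y * q y) x = dderiv t p x * q x + p x * dderiv t q x"
proof (rule trans[OF dderiv_eq])
  show "((\<lambda>y. p y * q y) has_derivative (\<lambda>t. p x * dderiv t q x + dderiv t p x * q x)) (at x)"
    by (intro has_derivative_mult polys_has_derivative[OF assms(1,3)] polys_has_derivative[OF assms(2,4)])
qed simp

lemma dderiv_components:
  fixes p :: "real^'n \<Rightarrow> real"
  assumes "p \<in> polys J UNIV" "finite J"
  shows "dderiv t p x = (\<Sum>j\<in>UNIV. t $ j * dderiv (axis j 1) p x)"
proof -
  have lin: "linear (\<lambda>t. dderiv t p x)"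
    by (rule has_derivative_linear[OF polys_has_derivative[OF assms]])
  have "dderiv t p x = dderiv (\<Sum>j\<in>UNIV. t $ j *\<^sub>R axis j 1) p x"
    using basis_expansion[of t] by (simp add: scalar_mult_eq_scaleR)
  then show ?thesis by (simp add: linear_sum[OF lin] linear_scale[OF lin])
qed

lemma polys_component:
  "v \<in> polys J UNIV \<Longrightarrow> (\<lambda>y. (v y :: real^'m) $ i) \<in> polys J UNIV"
  by (rule polys_linear_image) (auto simp: linear_iff)

lemma polys_vecI:
  fixes v :: "real^'n \<Rightarrow> real^'m"
  assumes "\<And>i. (\<lambda>y. v y $ i) \<in> polys J UNIV"
  shows "v \<in> polys J UNIV"
proof -
  define w where "w = (\<lambda>y. \<Sum>i\<in>UNIV. v y $ i *\<^sub>R (axis i 1 :: real^'m))"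
  have "w \<in> polys J UNIV"
    unfolding w_def by (intro polys_sum polys_scaleR assms) auto
  moreover have "w = v"
    unfolding w_def using basis_expansion[of "v _"] by (auto simp: scalar_mult_eq_scaleR)
  ultimately show ?thesis by simp
qed

lemma polys_entry:
  "\<tau> \<in> polys J sym_mats \<Longrightarrow> (\<lambda>y. (\<tau> y :: real^'m^'m) $ i $ j) \<in> polys J UNIV"
  by (rule polys_linear_image) (auto simp: linear_iff)

lemma polys_inner_const:
  fixes v :: "real^'n \<Rightarrow> real^'m"
  shows "v \<in> polys J UNIV \<Longrightarrow> (\<lambda>y. t \<bullet> v y) \<in> polys J UNIV"
  by (rule polys_linear_image) (auto simp: linear_iff inner_add_right)

lemma polys_vec_has_derivative:
  fixes v :: "real^'n \<Rightarrow> real^'m"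
  assumes "v \<in> polys J UNIV" "finite J"
  shows "(v has_derivative (\<lambda>t. \<chi> i. dderiv t (\<lambda>y. v y $ i) x)) (at x)"
proof -
  have "(v has_derivative (\<lambda>t. \<chi> i. dderiv t (\<lambda>y. v y $ i) x)) (at x within UNIV)"
    unfolding has_derivative_componentwise_within[of v]
  proof
    fix b :: "real^'m" assume "b \<in> Basis"
    then obtain i where b: "b = axis i 1" by (auto simp: Basis_vec_def)
    show "((\<lambda>y. v y \<bullet> b) has_derivative (\<lambda>t. (\<chi> i. dderiv t (\<lambda>y. v y $ i) x) \<bullet> b)) (at x within UNIV)"
      using polys_has_derivative[OF polys_component[OF assms(1), of i] assms(2), of x]
      by (simp add: b inner_axis)
  qed
  then show ?thesis by simp
qed

lemma jacobian_entry:
  fixes v :: "real^'n \<Rightarrow> real^'m"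
  assumes "v \<in> polys J UNIV" "finite J"
  shows "jacobian v (at x) $ i $ j = dderiv (axis j 1) (\<lambda>y. v y $ i) x"
proof -
  have "frechet_derivative v (at x) = (\<lambda>t. \<chi> i. dderiv t (\<lambda>y. v y $ i) x)"
    by (rule frechet_derivative_at[OF polys_vec_has_derivative[OF assms], symmetric])
  then show ?thesis by (simp add: jacobian_def matrix_def)
qed

lemma row_div_component:
  fixes \<tau> :: "real^'n \<Rightarrow> real^'n^'n"
  assumes "\<And>i j. (\<lambda>y. \<tau> y $ i $ j) \<in> polys J UNIV" "finite J"
  shows "row_div \<tau> x $ i = (\<Sum>j\<in>UNIV. dderiv (axis j 1) (\<lambda>y. \<tau> y $ i $ j) x)"
proof -
  have "(\<lambda>y. \<tau> y $ i) \<in> polys J UNIV" by (rule polys_vecI) (rule assms(1))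
  then show ?thesis by (simp add: row_div_def trace_def jacobian_entry[OF _ assms(2)])
qed

lemma row_div_polys:
  fixes \<tau> :: "real^'n \<Rightarrow> real^'n^'n"
  assumes "\<tau> \<in> polys J sym_mats" "finite J" "finite J'" "\<And>d. d \<in> J \<Longrightarrow> d > 0 \<Longrightarrow> d - 1 \<in> J'"
  shows "row_div \<tau> \<in> polys J' UNIV"
proof (rule polys_vecI)
  fix i
  have "(\<lambda>x. \<Sum>j\<in>UNIV. dderiv (axis j 1) (\<lambda>y. \<tau> y $ i $ j) x) \<in> polys J' UNIV"
    by (intro polys_sum dderiv_polys[OF polys_entry[OF assms(1)] assms(2,3,4)]) auto
  then show "(\<lambda>x. row_div \<tau> x $ i) \<in> polys J' UNIV"
    by (simp add: row_div_component[OF polys_entry[OF assms(1)] assms(2)])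
qed

lemma linear_row_div:
  assumes "finite J"
  shows "linear_map_on (polys J sym_mats) (row_div :: (real^'n \<Rightarrow> real^'n^'n) \<Rightarrow> _)"
  unfolding linear_map_on_def
proof (intro conjI ballI allI ext)
  fix \<sigma> \<tau> :: "real^'n \<Rightarrow> real^'n^'n" and x c
  assume \<sigma>: "\<sigma> \<in> polys J sym_mats"
  have "c *\<^sub>R \<sigma> \<in> polys J sym_mats" by (rule subspace_scale[OF subspace_polys[OF subspace_sym_mats] \<sigma>])
  note c = polys_entry[OF this]
  show "row_div (c *\<^sub>R \<sigma>) x = (c *\<^sub>R row_div \<sigma>) x"
  proof (subst vec_eq_iff, rule allI)
    fix i
    show "row_div (c *\<^sub>R \<sigma>) x $ i = (c *\<^sub>R row_div \<sigma>) x $ i"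
      using row_div_component[OF c assms, of x i] row_div_component[OF polys_entry[OF \<sigma>] assms, of x i]
      by (simp add: scaleR_fun_def dderiv_cmult[OF polys_entry[OF \<sigma>] assms] sum_distrib_left)
  qed
  assume \<tau>: "\<tau> \<in> polys J sym_mats"
  have "\<sigma> + \<tau> \<in> polys J sym_mats" by (rule subspace_add[OF subspace_polys[OF subspace_sym_mats] \<sigma> \<tau>])
  note s = polys_entry[OF this]
  show "row_div (\<sigma> + \<tau>) x = (row_div \<sigma> + row_div \<tau>) x"
  proof (subst vec_eq_iff, rule allI)
    fix i
    show "row_div (\<sigma> + \<tau>) x $ i = (row_div \<sigma> + row_div \<tau>) x $ i"
      using row_div_component[OF s assms, of x i] row_div_component[OF polys_entry[OF \<sigma>] assms, of x i]
        row_div_component[OF polys_entry[OF \<tau>] assms, of x i]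
      by (simp add: plus_fun_def dderiv_add[OF polys_entry[OF \<sigma>] polys_entry[OF \<tau>] assms assms] sum.distrib)
  qed
qed

lemma sym_grad_entry:
  fixes v :: "real^'n \<Rightarrow> real^'n"
  assumes "v \<in> polys J UNIV" "finite J"
  shows "sym_grad v x $ i $ j =
    (1 / 2) * (dderiv (axis j 1) (\<lambda>y. v y $ i) x + dderiv (axis i 1) (\<lambda>y. v y $ j) x)"
  by (simp add: sym_grad_def transpose_def jacobian_entry[OF assms])

lemma sym_grad_sym: "sym_grad v x \<in> sym_mats"
  by (simp add: sym_grad_def sym_mats_def transpose_def vec_eq_iff add.commute)

lemma linear_sym_grad:
  assumes "finite J"
  shows "linear_map_on (polys J UNIV) (sym_grad :: (real^'n \<Rightarrow> real^'n) \<Rightarrow> _)"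
  unfolding linear_map_on_def
proof (intro conjI ballI allI ext)
  fix u v :: "real^'n \<Rightarrow> real^'n" and x c
  assume u: "u \<in> polys J UNIV"
  have cu: "c *\<^sub>R u \<in> polys J UNIV" by (rule subspace_scale[OF subspace_polys[OF subspace_UNIV] u])
  have "sym_grad (c *\<^sub>R u) x $ i $ j = (c *\<^sub>R sym_grad u) x $ i $ j" for i j
    using sym_grad_entry[OF cu assms, of x i j] sym_grad_entry[OF u assms, of x i j]
    by (simp add: scaleR_fun_def dderiv_cmult[OF polys_component[OF u] assms] algebra_simps)
  then show "sym_grad (c *\<^sub>R u) x = (c *\<^sub>R sym_grad u) x" by (simp add: vec_eq_iff)
  assume v: "v \<in> polys J UNIV"
  have uv: "u + v \<in> polys J UNIV" by (rule subspace_add[OF subspace_polys[OF subspace_UNIV] u v])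
  have "sym_grad (u + v) x $ i $ j = (sym_grad u + sym_grad v) x $ i $ j" for i j
    using sym_grad_entry[OF uv assms, of x i j] sym_grad_entry[OF u assms, of x i j]
      sym_grad_entry[OF v assms, of x i j]
    by (simp add: plus_fun_def dderiv_add[OF polys_component[OF u] polys_component[OF v] assms assms]
        algebra_simps)
  then show "sym_grad (u + v) x = (sym_grad u + sym_grad v) x" by (simp add: vec_eq_iff)
qed

lemma sym_grad_inner_osq:
  fixes v :: "real^'n \<Rightarrow> real^'n"
  assumes "v \<in> polys J UNIV" "finite J"
  shows "sym_grad v x \<bullet> osq t = dderiv t (\<lambda>y. t \<bullet> v y) x"
proof -
  let ?d = "\<lambda>i j. dderiv (axis j 1) (\<lambda>y. v y $ i) x"
  have "dderiv t (\<lambda>y. t \<bullet> v y) x = dderiv t (\<lambda>y. \<Sum>i\<in>UNIV. t $ i * v y $ i) x"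
    by (simp add: inner_vec_def)
  also have "\<dots> = (\<Sum>i\<in>UNIV. dderiv t (\<lambda>y. t $ i * v y $ i) x)"
    by (rule dderiv_sum[OF polys_cmult[OF polys_component[OF assms(1)]] assms(2)])
  also have "\<dots> = (\<Sum>i\<in>UNIV. t $ i * dderiv t (\<lambda>y. v y $ i) x)"
    by (simp add: dderiv_cmult[OF polys_component[OF assms(1)] assms(2)])
  also have "\<dots> = (\<Sum>i\<in>UNIV. \<Sum>j\<in>UNIV. t $ i * t $ j * ?d i j)"
    unfolding dderiv_components[OF polys_component[OF assms(1)] assms(2), of t]
    by (simp add: sum_distrib_left mult.assoc)
  finally have 1: "dderiv t (\<lambda>y. t \<bullet> v y) x = (\<Sum>i\<in>UNIV. \<Sum>j\<in>UNIV. t $ i * t $ j * ?d i j)" .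
  have 2: "(\<Sum>i\<in>UNIV. \<Sum>j\<in>UNIV. t $ i * t $ j * ?d j i) = (\<Sum>i\<in>UNIV. \<Sum>j\<in>UNIV. t $ i * t $ j * ?d i j)"
    by (subst sum.swap) (simp add: mult_ac)
  have "sym_grad v x \<bullet> osq t = (\<Sum>i\<in>UNIV. \<Sum>j\<in>UNIV. (1 / 2) * (t $ i * t $ j * ?d i j) + (1 / 2) * (t $ i * t $ j * ?d j i))"
    unfolding inner_vec_def by (simp add: sym_grad_entry[OF assms] osq_def algebra_simps)
  also have "\<dots> = (1 / 2) * (\<Sum>i\<in>UNIV. \<Sum>j\<in>UNIV. t $ i * t $ j * ?d i j)
      + (1 / 2) * (\<Sum>i\<in>UNIV. \<Sum>j\<in>UNIV. t $ i * t $ j * ?d j i)"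
    by (simp add: sum.distrib sum_distrib_left)
  finally show ?thesis unfolding 1 2 by simp
qed

text \<open>
  A polynomial vector field without strain preserves lengths infinitesimally along every segment;
  this makes \<open>x \<mapsto> v x - v 0\<close> a skew-adjoint, hence linear, map.
\<close>

lemma sym_grad_zero_imp_affine:
  fixes v :: "real^'n \<Rightarrow> real^'n"
  assumes v: "v \<in> polys J UNIV" "finite J" and z: "\<And>x. sym_grad v x = 0"
  shows "v \<in> polys {..1} UNIV"
proof -
  have chord: "(v x - v y) \<bullet> (x - y) = 0" for x y
  proof -
    let ?t = "x - y"
    have d: "((\<lambda>s. ?t \<bullet> v (y + s *\<^sub>R ?t)) has_real_derivative 0) (at s)" for s
      using polys_line_derivative[OF polys_inner_const[OF v(1), of ?t] v(2), of y ?t s]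
        sym_grad_inner_osq[OF v, of "y + s *\<^sub>R ?t" ?t] by (simp add: z)
    have "?t \<bullet> v (y + 1 *\<^sub>R ?t) = ?t \<bullet> v (y + 0 *\<^sub>R ?t)"
      using DERIV_const_ratio_const[of 0 1 "\<lambda>s. ?t \<bullet> v (y + s *\<^sub>R ?t)" 0] d by simp
    then show ?thesis by (simp add: inner_diff_left inner_diff_right inner_commute)
  qed
  define w where "w = (\<lambda>x. v x - v 0)"
  have skew: "w x \<bullet> y = - (w y \<bullet> x)" for x y
  proof -
    have "w x \<bullet> x = 0" "w y \<bullet> y = 0" using chord[of x 0] chord[of y 0] by (auto simp: w_def)
    moreover have "(w x - w y) \<bullet> (x - y) = 0" using chord[of x y] by (simp add: w_def)
    ultimately show ?thesis by (simp add: inner_diff_left inner_diff_right)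
  qed
  have "v x $ i = v 0 $ i + (- w (axis i 1)) \<bullet> x" for x i
    using skew[of x "axis i 1"] by (simp add: w_def inner_axis inner_diff_left)
  then have "(\<lambda>x. v x $ i) = (\<lambda>x. v 0 $ i + (- w (axis i 1)) \<bullet> x)" for i by blast
  then show ?thesis by (intro polys_vecI) (simp only: polys_affine)
qed

context simplex_vertices
begin

lemma polys_symI:
  fixes \<tau> :: "real^'n \<Rightarrow> real^'n^'n"
  assumes "\<And>i j. (\<lambda>y. \<tau> y $ i $ j) \<in> polys J UNIV" "\<And>x. \<tau> x \<in> sym_mats"
  shows "\<tau> \<in> polys J sym_mats"
proof -
  have entry: "bgrad a \<bullet> (\<tau> x *v bgrad b) = (\<Sum>i\<in>UNIV. bgrad a $ i * (\<Sum>j\<in>UNIV. bgrad b $ j * \<tau> x $ i $ j))" for a b x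
    by (simp add: inner_vec_def matrix_vector_mult_def mult.commute)
  have "(\<lambda>x. \<Sum>e\<in>edges. (- 1 * (\<Sum>i\<in>UNIV. bgrad (fst e) $ i * (\<Sum>j\<in>UNIV. bgrad (snd e) $ j * \<tau> x $ i $ j)))
      *\<^sub>R osq (snd e - fst e)) \<in> polys J sym_mats"
    by (intro polys_sum polys_scaleR polys_cmult assms osq_in_sym_mats subspace_sym_mats subspace_UNIV)
  moreover have "(\<Sum>e\<in>edges. (- 1 * (\<Sum>i\<in>UNIV. bgrad (fst e) $ i * (\<Sum>j\<in>UNIV. bgrad (snd e) $ j * \<tau> x $ i $ j)))
      *\<^sub>R osq (snd e - fst e)) = \<tau> x" for x
    using sym_mats_expansion[OF assms(2)[of x]] by (simp add: entry case_prod_beta)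
  ultimately show ?thesis by simp
qed

lemma sym_grad_polys:
  fixes v :: "real^'n \<Rightarrow> real^'n"
  assumes v: "v \<in> polys {..r} UNIV"
  shows "sym_grad v \<in> polys {..r - 1} sym_mats"
proof (rule polys_symI)
  show "sym_grad v x \<in> sym_mats" for x by (rule sym_grad_sym)
  fix i j
  have "(\<lambda>x. (1 / 2) * (dderiv (axis j 1) (\<lambda>y. v y $ i) x + dderiv (axis i 1) (\<lambda>y. v y $ j) x)) \<in> polys {..r - 1} UNIV"
    by (intro polys_cmult polys_add dderiv_polys[OF polys_component[OF v]]) auto
  then show "(\<lambda>y. sym_grad v y $ i $ j) \<in> polys {..r - 1} UNIV"
    by (simp only: sym_grad_entry[OF v finite_atMost])
qed

text \<open>
  The symmetric gradient maps the affine vector fields onto the constant symmetric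
  matrices, so rank-nullity gives the dimension of its kernel.
\<close>

proposition dim_rigid_motions:
  assumes "r \<ge> 1"
  shows "2 * dim {v \<in> polys {..r} UNIV. \<forall>x. sym_grad v x = (0 :: real^'n^'n)} = CARD('n) * (CARD('n) + 1)"
proof -
  let ?P = "polys {..1} UNIV :: (real^'n \<Rightarrow> real^'n) set"
  have "{v \<in> polys {..r} UNIV. \<forall>x. sym_grad v x = 0} = {v \<in> ?P. sym_grad v = 0}"
    using sym_grad_zero_imp_affine[OF _ finite_atMost] polys_mono[of "{..1}" "{..r}" "UNIV :: (real^'n) set" UNIV] assms
    by (auto simp: fun_eq_iff zero_fun_def)
  moreover have "dim ?P = dim {v \<in> ?P. sym_grad v = 0} + dim (sym_grad ` ?P)"
    by (intro rank_nullity_on linear_sym_grad subspace_polys finite_dim_polys_vec) auto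
  moreover have "sym_grad ` ?P = polys {..0} sym_mats"
  proof
    show "sym_grad ` ?P \<subseteq> polys {..0} sym_mats" using sym_grad_polys[of _ 1] by auto
    show "polys {..0} sym_mats \<subseteq> sym_grad ` ?P"
    proof
      fix \<tau> :: "real^'n \<Rightarrow> real^'n^'n" assume \<tau>: "\<tau> \<in> polys {..0} sym_mats"
      then obtain c where c: "\<tau> = (\<lambda>x. \<Sum>\<alpha>\<in>exponents {..0}. mon \<alpha> x *\<^sub>R c \<alpha>)"
        unfolding polys_eq by blast
      have "exponents {..0} = {\<lambda>_::'n. 0::nat}" by (auto simp: fun_eq_iff)
      then have const: "\<tau> x = \<tau> 0" for x unfolding c by (simp add: mon_def)
      define A where "A = \<tau> 0"
      have A: "A \<in> sym_mats" unfolding A_def by (rule polys_range[OF \<tau> subspace_sym_mats])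
      have comp: "(\<lambda>x. (A *v x) $ i) = (\<lambda>x. 0 + A $ i \<bullet> x)" for i
        by (simp add: fun_eq_iff matrix_vector_mul_component)
      have v: "(\<lambda>x. A *v x) \<in> ?P" by (rule polys_vecI) (simp only: comp polys_affine)
      have d: "dderiv t (\<lambda>x. (A *v x) $ i) x = A $ i \<bullet> t" for t i x
        unfolding comp by (rule dderiv_eq) (auto intro!: derivative_eq_intros)
      have "sym_grad (\<lambda>x. A *v x) x $ i $ j = A $ i $ j" for x i j
        using sym_matsD[OF A, of i j] by (simp add: sym_grad_entry[OF v] d inner_axis)
      then have "sym_grad (\<lambda>x. A *v x) x = \<tau> x" for x using const[of x] by (simp add: vec_eq_iff A_def)
      then have "sym_grad (\<lambda>x. A *v x) = \<tau>" by (rule ext)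
      then show "\<tau> \<in> sym_grad ` ?P" using v by blast
    qed
  qed
  ultimately have "dim ?P = dim {v \<in> polys {..r} UNIV. \<forall>x. sym_grad v x = (0 :: real^'n^'n)} + card edges"
    using dim_polys_sym[of 0] by simp
  then show ?thesis using dim_polys_vec[of 1] card_edges by simp
qed

subsection \<open>Integration by parts\<close>

lemma polys_continuous_vec:
  fixes v :: "real^'n \<Rightarrow> real^'m"
  assumes "v \<in> polys {..r} UNIV" shows "continuous_on UNIV v"
  using has_derivative_continuous[OF polys_vec_has_derivative[OF assms finite_atMost]]
  by (auto simp: continuous_on_eq_continuous_at)

lemma polys_continuous_sym:
  fixes \<tau> :: "real^'n \<Rightarrow> real^'n^'n"
  assumes "\<tau> \<in> polys {..r} sym_mats" shows "continuous_on UNIV \<tau>"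
proof -
  have "continuous_on UNIV (\<lambda>x. \<chi> i j. \<tau> x $ i $ j)"
    by (intro continuous_on_vec_lambda polys_continuous[OF polys_entry[OF assms]]) auto
  then show ?thesis by simp
qed

text \<open>
  Expanding \<open>\<tau> = \<Sum>e. f\<^sub>e t\<^sub>e t\<^sub>e\<^sup>T\<close> over the edges gives \<open>div \<tau> = \<Sum>e. (\<partial> f\<^sub>e / \<partial> t\<^sub>e) t\<^sub>e\<close>. Hence
  \<open>div \<tau> \<bullet> v + \<tau> \<bullet> \<epsilon>(v)\<close> is the sum of the derivatives of \<open>f\<^sub>e (t\<^sub>e \<bullet> v)\<close> along \<open>t\<^sub>e\<close>, whose integrals
  vanish because \<open>f\<^sub>e\<close> contains the barycentric coordinates of both end points of \<open>e\<close>.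
\<close>

proposition simplex_integration_by_parts:
  fixes v :: "real^'n \<Rightarrow> real^'n"
  assumes m: "m \<ge> 2" and \<tau>: "\<tau> \<in> bubbles m" and v: "v \<in> polys {..r} UNIV"
  shows "simplex_integral (\<lambda>x. row_div \<tau> x \<bullet> v x) = - simplex_integral (\<lambda>x. \<tau> x \<bullet> sym_grad v x)"
proof -
  have \<tau>S: "\<tau> \<in> polys {..m} sym_mats" using \<tau> by (simp add: bubbles_def)
  have "\<forall>e\<in>edges. \<exists>q. q \<in> polys {..m - 2} UNIV \<and>
      (\<forall>x. - (bgrad (fst e) \<bullet> (\<tau> x *v bgrad (snd e))) = bary (fst e) x * bary (snd e) x * q x)"
  proof
    fix e assume "e \<in> edges"
    then have "(fst e, snd e) \<in> edges" by simp
    from bubbles_coefficient[OF m \<tau> this]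
    show "\<exists>q. q \<in> polys {..m - 2} UNIV \<and>
        (\<forall>x. - (bgrad (fst e) \<bullet> (\<tau> x *v bgrad (snd e))) = bary (fst e) x * bary (snd e) x * q x)"
      by blast
  qed
  from bchoice[OF this] obtain q where q: "\<And>e. e \<in> edges \<Longrightarrow> q e \<in> polys {..m - 2} UNIV"
    and q2: "\<And>e x. e \<in> edges \<Longrightarrow> - (bgrad (fst e) \<bullet> (\<tau> x *v bgrad (snd e))) = bary (fst e) x * bary (snd e) x * q e x"
    by blast
  let ?t = "\<lambda>e. snd e - fst e"
  let ?f = "\<lambda>e x. bary (fst e) x * bary (snd e) x * q e x"
  have V: "fst e \<in> V" "snd e \<in> V" "fst e \<noteq> snd e" if "e \<in> edges" for e
    using edges_distinct[of "fst e" "snd e"] that by auto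
  have f: "?f e \<in> polys {..1 + 1 + (m - 2)} UNIV" if "e \<in> edges" for e
    by (intro polys_mult bary_polys V[OF that] q[OF that])
  have expand: "\<tau> x = (\<Sum>e\<in>edges. ?f e x *\<^sub>R osq (?t e))" for x
  proof -
    have "\<tau> x = (\<Sum>e\<in>edges. (- (bgrad (fst e) \<bullet> (\<tau> x *v bgrad (snd e)))) *\<^sub>R osq (?t e))"
      using sym_mats_expansion[OF polys_range[OF \<tau>S subspace_sym_mats]] by (simp add: case_prod_beta)
    also have "\<dots> = (\<Sum>e\<in>edges. ?f e x *\<^sub>R osq (?t e))"
      by (rule sum.cong[OF refl]) (simp only: q2)
    finally show ?thesis .
  qed
  have entry: "(\<lambda>y. \<tau> y $ i $ j) = (\<lambda>y. \<Sum>e\<in>edges. (?t e $ i * ?t e $ j) * ?f e y)" for i j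
  proof
    fix y
    show "\<tau> y $ i $ j = (\<Sum>e\<in>edges. (?t e $ i * ?t e $ j) * ?f e y)"
      using arg_cong[OF expand[of y], of "\<lambda>A. A $ i $ j"] by (simp add: osq_def mult_ac)
  qed
  have div: "row_div \<tau> x = (\<Sum>e\<in>edges. dderiv (?t e) (?f e) x *\<^sub>R ?t e)" for x
  proof -
    have "row_div \<tau> x $ i = (\<Sum>e\<in>edges. dderiv (?t e) (?f e) x *\<^sub>R ?t e) $ i" for i
    proof -
      have "row_div \<tau> x $ i = (\<Sum>j\<in>UNIV. dderiv (axis j 1) (\<lambda>y. \<tau> y $ i $ j) x)"
        by (rule row_div_component[OF polys_entry[OF \<tau>S] finite_atMost])
      also have "\<dots> = (\<Sum>j\<in>UNIV. \<Sum>e\<in>edges. (?t e $ i * ?t e $ j) * dderiv (axis j 1) (?f e) x)"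
      proof (rule sum.cong[OF refl])
        fix j
        have "dderiv (axis j 1) (\<lambda>y. \<tau> y $ i $ j) x =
            (\<Sum>e\<in>edges. dderiv (axis j 1) (\<lambda>y. (?t e $ i * ?t e $ j) * ?f e y) x)"
          unfolding entry by (rule dderiv_sum[OF polys_cmult[OF f] finite_atMost])
        also have "\<dots> = (\<Sum>e\<in>edges. (?t e $ i * ?t e $ j) * dderiv (axis j 1) (?f e) x)"
          by (rule sum.cong[OF refl]) (rule dderiv_cmult[OF f finite_atMost])
        finally show "dderiv (axis j 1) (\<lambda>y. \<tau> y $ i $ j) x =
            (\<Sum>e\<in>edges. (?t e $ i * ?t e $ j) * dderiv (axis j 1) (?f e) x)" .
      qed
      also have "\<dots> = (\<Sum>e\<in>edges. ?t e $ i * (\<Sum>j\<in>UNIV. ?t e $ j * dderiv (axis j 1) (?f e) x))"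
        by (subst sum.swap) (simp add: sum_distrib_left mult.assoc)
      also have "\<dots> = (\<Sum>e\<in>edges. ?t e $ i * dderiv (?t e) (?f e) x)"
      proof (rule sum.cong[OF refl])
        fix e assume "e \<in> edges"
        from dderiv_components[OF f[OF this] finite_atMost, of "?t e" x]
        show "?t e $ i * (\<Sum>j\<in>UNIV. ?t e $ j * dderiv (axis j 1) (?f e) x) = ?t e $ i * dderiv (?t e) (?f e) x"
          by (rule arg_cong[OF sym])
      qed
      finally show ?thesis by (simp add: mult.commute)
    qed
    then show ?thesis by (simp add: vec_eq_iff)
  qed
  let ?w = "\<lambda>e x. ?t e \<bullet> v x"
  have w: "?w e \<in> polys {..r} UNIV" for e by (rule polys_inner_const[OF v])
  have leibniz: "row_div \<tau> x \<bullet> v x + \<tau> x \<bullet> sym_grad v x = (\<Sum>e\<in>edges. dderiv (?t e) (\<lambda>x. ?f e x * ?w e x) x)" for x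
  proof -
    have "row_div \<tau> x \<bullet> v x + \<tau> x \<bullet> sym_grad v x =
        (\<Sum>e\<in>edges. dderiv (?t e) (?f e) x * ?w e x + ?f e x * (sym_grad v x \<bullet> osq (?t e)))"
      unfolding div by (subst expand) (simp add: inner_sum_left inner_sum_right sum.distrib inner_commute)
    also have "\<dots> = (\<Sum>e\<in>edges. dderiv (?t e) (\<lambda>x. ?f e x * ?w e x) x)"
      by (rule sum.cong[OF refl])
        (simp only: dderiv_mult[OF f w finite_atMost finite_atMost] sym_grad_inner_osq[OF v finite_atMost])
    finally show ?thesis .
  qed
  have fw: "(\<lambda>x. ?f e x * ?w e x) = (\<lambda>x. bary (fst e) x * bary (snd e) x * (q e x * ?w e x))" for e
    by (simp add: mult.assoc)
  have qw: "(\<lambda>x. q e x * ?w e x) \<in> polys {..(m - 2) + r} UNIV" if "e \<in> edges" for e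
    by (rule polys_mult[OF q[OF that] w])
  have cont: "continuous_on UNIV (dderiv (?t e) (\<lambda>x. ?f e x * ?w e x))" if "e \<in> edges" for e
    by (rule polys_continuous[OF dderiv_polys[where J' = "{..1 + 1 + (m - 2) + r}",
            OF polys_mult[OF f[OF that] w] finite_atMost finite_atMost]]) auto
  have divP: "row_div \<tau> \<in> polys {..m} UNIV" by (rule row_div_polys[OF \<tau>S]) auto
  have "simplex_integral (\<lambda>x. row_div \<tau> x \<bullet> v x) + simplex_integral (\<lambda>x. \<tau> x \<bullet> sym_grad v x) =
      simplex_integral (\<lambda>x. row_div \<tau> x \<bullet> v x + \<tau> x \<bullet> sym_grad v x)"
    by (intro simplex_integral_add[symmetric] continuous_on_inner polys_continuous_vec[OF divP]
        polys_continuous_vec[OF v] polys_continuous_sym[OF \<tau>S] polys_continuous_sym[OF sym_grad_polys[OF v]])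
  also have "\<dots> = (\<Sum>e\<in>edges. simplex_integral (dderiv (?t e) (\<lambda>x. ?f e x * ?w e x)))"
    unfolding leibniz by (rule simplex_integral_sum[OF finite_edges cont])
  also have "\<dots> = 0"
    unfolding fw
  proof (rule sum.neutral, rule ballI)
    fix e assume e: "e \<in> edges"
    show "simplex_integral (dderiv (?t e) (\<lambda>x. bary (fst e) x * bary (snd e) x * (q e x * ?w e x))) = 0"
      by (rule simplex_integral_edge_derivative[OF V[OF e] qw[OF e]])
  qed
  finally show ?thesis by simp
qed

lemma polys_vec_zeroI:
  fixes v :: "real^'n \<Rightarrow> real^'m"
  assumes v: "v \<in> polys {..r} UNIV" and z: "\<And>x. (\<And>a. a \<in> V \<Longrightarrow> 0 < bary a x) \<Longrightarrow> v x = 0"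
  shows "v x = 0"
proof -
  have "v x $ i = 0" for i
    by (rule polys_zero_on_simplex[OF polys_component[OF v]]) (simp add: z)
  then show ?thesis by (simp add: vec_eq_iff)
qed

text \<open>
  If \<open>v\<close> is orthogonal to all divergences of bubble fields, testing with the field
  \<open>bary a * bary b * q\<close> times \<open>osq t\<close>, \<open>t = b - a\<close>, where \<open>q = t \<bullet> \<epsilon>(v) t\<close>, yields
  \<open>\<integral> bary a * bary b * q\<^sup>2 = 0\<close>, so that \<open>q = 0\<close>. The matrices \<open>osq t\<close> span the symmetric matrices.
\<close>

proposition orthogonal_to_divergences_imp_rigid:
  fixes v :: "real^'n \<Rightarrow> real^'n"
  assumes m: "m \<ge> 2" and v: "v \<in> polys {..m - 1} UNIV"
    and z: "\<And>\<tau>. \<tau> \<in> bubbles m \<Longrightarrow> simplex_integral (\<lambda>x. row_div \<tau> x \<bullet> v x) = 0"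
  shows "sym_grad v x = 0"
proof (rule sym_mats_zero_if_edges_zero[OF sym_grad_sym])
  fix a b assume "(a, b) \<in> edges"
  then have ab: "a \<in> V" "b \<in> V" using edges_distinct by auto
  let ?t = "b - a"
  define q where "q = dderiv ?t (\<lambda>y. ?t \<bullet> v y)"
  have q: "q \<in> polys {..m - 2} UNIV"
    unfolding q_def by (rule dderiv_polys[OF polys_inner_const[OF v]]) auto
  have qe: "sym_grad v x \<bullet> osq ?t = q x" for x
    unfolding q_def by (rule sym_grad_inner_osq[OF v finite_atMost])
  let ?\<tau> = "\<lambda>x. (bary a x * bary b x * q x) *\<^sub>R osq ?t"
  have \<tau>: "?\<tau> \<in> bubbles m" by (rule edge_bubble_in_bubbles[OF m ab q])
  have "simplex_integral (\<lambda>x. ?\<tau> x \<bullet> sym_grad v x) = 0"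
    using simplex_integration_by_parts[OF m \<tau> v] z[OF \<tau>] by simp
  then have int: "simplex_integral (\<lambda>x. bary a x * bary b x * (q x * q x)) = 0"
    by (simp add: inner_commute[of "osq ?t"] qe mult.assoc)
  have c: "continuous_on UNIV (\<lambda>x. bary a x * bary b x * (q x * q x))"
    by (intro continuous_on_mult continuous_bary ab polys_continuous[OF q] finite_atMost)
  have "q x = 0"
  proof (rule polys_zero_on_simplex[OF q])
    fix x assume pos: "\<And>v. v \<in> V \<Longrightarrow> 0 < bary v x"
    have "bary a x * bary b x * (q x * q x) = 0"
      using face_iff[OF order_refl] ab by (intro simplex_integral_zero_imp[OF c _ int pos]) auto
    moreover have "0 < bary a x" "0 < bary b x" using pos ab by auto
    ultimately show "q x = 0" by simp
  qed
  then show "?t \<bullet> (sym_grad v x *v ?t) = 0" using qe[of x] by (simp add: inner_osq)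
qed

lemma polys_sym_zeroI:
  fixes \<tau> :: "real^'n \<Rightarrow> real^'n^'n"
  assumes "\<tau> \<in> polys {..m} sym_mats" "simplex_integral (\<lambda>x. \<tau> x \<bullet> \<tau> x) = 0"
  shows "\<tau> = 0"
proof -
  have c: "continuous_on UNIV (\<lambda>x. \<tau> x \<bullet> \<tau> x)"
    by (intro continuous_on_inner polys_continuous_sym[OF assms(1)])
  have "\<tau> x $ i $ j = 0" for x i j
  proof (rule polys_zero_on_simplex[OF polys_entry[OF assms(1)]])
    fix x assume "\<And>v. v \<in> V \<Longrightarrow> 0 < bary v x"
    then have "\<tau> x \<bullet> \<tau> x = 0" by (intro simplex_integral_zero_imp[OF c _ assms(2)]) auto
    then show "\<tau> x $ i $ j = 0" by simp
  qed
  then show ?thesis by (simp add: fun_eq_iff vec_eq_iff zero_fun_def)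
qed

text \<open>
  The pairing \<open>(\<tau>, v) \<mapsto> \<integral> div \<tau> \<bullet> v\<close> has the divergence-free bubble fields as left kernel (take
  \<open>v = div \<tau>\<close>) and the rigid motions as right kernel, and both quotients have dimension equal to its rank.
\<close>

proposition dim_divergence_free_bubbles:
  assumes m: "m \<ge> 2"
  shows "dim (polys {..m - 1} UNIV :: (real^'n \<Rightarrow> real^'n) set) + dim {\<tau> \<in> bubbles m. \<forall>x. row_div \<tau> x = 0} =
    dim {v \<in> polys {..m - 1} UNIV. \<forall>x. sym_grad v x = (0 :: real^'n^'n)} + dim (bubbles m)"
proof -
  let ?W = "polys {..m - 1} UNIV :: (real^'n \<Rightarrow> real^'n) set"
  let ?\<beta> = "\<lambda>\<tau> v. simplex_integral (\<lambda>x. row_div \<tau> x \<bullet> v x)"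
  have B: "bubbles m \<subseteq> polys {..m} sym_mats" by (auto simp: bubbles_def)
  have divP: "row_div \<tau> \<in> ?W" if "\<tau> \<in> bubbles m" for \<tau>
    by (rule row_div_polys) (use that B in auto)
  have cont: "continuous_on UNIV (\<lambda>x. row_div \<tau> x \<bullet> v x)" if "\<tau> \<in> bubbles m" "v \<in> ?W" for \<tau> v
    using that divP polys_continuous_vec by (intro continuous_on_inner) blast+
  have lin: "linear_map_on (bubbles m) row_div"
    by (rule linear_map_on_subset[OF linear_row_div B]) simp
  have "dim ?W + dim {\<tau> \<in> bubbles m. \<forall>v\<in>?W. ?\<beta> \<tau> v = 0} = dim {v \<in> ?W. \<forall>\<tau>\<in>bubbles m. ?\<beta> \<tau> v = 0} + dim (bubbles m)"
  proof (rule pairing_rank[where \<beta> = ?\<beta>, OF subspace_bubbles finite_dim_bubbles subspace_polys[OF subspace_UNIV] finite_dim_polys_vec])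
    show "linear_map_on (bubbles m) (\<lambda>\<tau>. ?\<beta> \<tau> v)" if v: "v \<in> ?W" for v
    proof (rule linear_map_on_set_integral)
      show "linear_map_on (bubbles m) (\<lambda>\<tau>. row_div \<tau> x \<bullet> v x)" for x
        using linear_map_onD[OF lin]
        by (auto simp: linear_map_on_def plus_fun_def scaleR_fun_def inner_add_left)
    qed (intro integrable_on_simplex cont v)
    show "linear_map_on ?W (?\<beta> \<tau>)" if \<tau>: "\<tau> \<in> bubbles m" for \<tau>
      by (rule linear_map_on_set_integral[OF integrable_on_simplex[OF cont[OF \<tau>]]])
        (auto simp: linear_map_on_def plus_fun_def scaleR_fun_def inner_add_right)
  qed
  moreover have "{\<tau> \<in> bubbles m. \<forall>v\<in>?W. ?\<beta> \<tau> v = 0} = {\<tau> \<in> bubbles m. \<forall>x. row_div \<tau> x = 0}"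
  proof safe
    fix \<tau> x assume \<tau>: "\<tau> \<in> bubbles m" and z: "\<forall>v\<in>?W. ?\<beta> \<tau> v = 0"
    show "row_div \<tau> x = 0"
    proof (rule polys_vec_zeroI[OF divP[OF \<tau>]])
      fix x assume pos: "\<And>a. a \<in> V \<Longrightarrow> 0 < bary a x"
      have "row_div \<tau> x \<bullet> row_div \<tau> x = 0"
        using z divP[OF \<tau>] by (intro simplex_integral_zero_imp[OF cont[OF \<tau> divP[OF \<tau>]] _ _ pos]) auto
      then show "row_div \<tau> x = 0" by simp
    qed
  next
    fix \<tau> :: "real^'n \<Rightarrow> real^'n^'n" and v :: "real^'n \<Rightarrow> real^'n" assume "\<forall>x. row_div \<tau> x = 0"
    then show "?\<beta> \<tau> v = 0" by (simp add: set_lebesgue_integral_def)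
  qed
  moreover have "{v \<in> ?W. \<forall>\<tau>\<in>bubbles m. ?\<beta> \<tau> v = 0} = {v \<in> ?W. \<forall>x. sym_grad v x = (0 :: real^'n^'n)}"
  proof safe
    fix v x assume "v \<in> ?W" "\<forall>\<tau>\<in>bubbles m. ?\<beta> \<tau> v = 0"
    then show "sym_grad v x = 0" by (intro orthogonal_to_divergences_imp_rigid[OF m]) auto
  next
    fix v \<tau> assume "v \<in> ?W" "\<forall>x. sym_grad v x = (0 :: real^'n^'n)" "\<tau> \<in> bubbles m"
    then show "?\<beta> \<tau> v = 0"
      using simplex_integration_by_parts[OF m] by (simp add: set_lebesgue_integral_def)
  qed
  ultimately show ?thesis by simp
qed

end

section \<open>Faces, tangents and normals\<close>

lemma orthonormal_expansion:
  fixes x :: "real^'n"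
  assumes B: "pairwise orthogonal B" "\<And>b. b \<in> B \<Longrightarrow> norm b = 1" "finite B" and x: "x \<in> span B"
  shows "(\<Sum>b\<in>B. (x \<bullet> b) *\<^sub>R b) = x"
proof -
  let ?u = "x - (\<Sum>b\<in>B. (x \<bullet> b) *\<^sub>R b)"
  have "orthogonal ?u c" if c: "c \<in> B" for c
  proof -
    have "(\<Sum>b\<in>B. (x \<bullet> b) * (b \<bullet> c)) = (\<Sum>b\<in>B. if b = c then x \<bullet> c else 0)"
    proof (rule sum.cong[OF refl])
      fix b assume b: "b \<in> B"
      show "(x \<bullet> b) * (b \<bullet> c) = (if b = c then x \<bullet> c else 0)"
      proof (cases "b = c")
        case True
        then show ?thesis using B(2)[OF c] by (simp add: norm_eq_1)
      next
        case False
        then have "b \<bullet> c = 0" using B(1) b c unfolding pairwise_def orthogonal_def by blast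
        then show ?thesis using False by simp
      qed
    qed
    also have "\<dots> = x \<bullet> c" using c B(3) by simp
    finally show ?thesis by (simp add: orthogonal_def inner_diff_left inner_sum_left)
  qed
  moreover have "?u \<in> span B" by (rule span_diff[OF x]) (intro span_sum span_scale span_base)
  ultimately have "orthogonal ?u ?u" by (rule orthogonal_to_span[rotated])
  then show ?thesis by (simp add: orthogonal_self)
qed

lemma normal_vectors_iff: "\<nu> \<in> normal_vectors F \<longleftrightarrow> (\<forall>x\<in>F. \<forall>y\<in>F. \<nu> \<bullet> (x - y) = 0)"
proof
  assume "\<nu> \<in> normal_vectors F"
  then show "\<forall>x\<in>F. \<forall>y\<in>F. \<nu> \<bullet> (x - y) = 0"
    unfolding normal_vectors_def tangent_space_def orthogonal_comp_def orthogonal_def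
    by (auto simp: inner_commute[of \<nu>] intro!: span_base)
next
  assume *: "\<forall>x\<in>F. \<forall>y\<in>F. \<nu> \<bullet> (x - y) = 0"
  have "orthogonal \<nu> y" if "y \<in> tangent_space F" for y
    by (rule orthogonal_to_span[OF that[unfolded tangent_space_def]]) (use * in \<open>auto simp: orthogonal_def\<close>)
  then show "\<nu> \<in> normal_vectors F"
    by (simp add: normal_vectors_def orthogonal_comp_def orthogonal_commute)
qed

lemma normal_vectors_antimono: "G \<subseteq> F \<Longrightarrow> normal_vectors F \<subseteq> normal_vectors G"
  unfolding normal_vectors_iff subset_iff by blast

lemma normal_tangent: "\<nu> \<in> normal_vectors F \<Longrightarrow> t \<in> tangent_space F \<Longrightarrow> \<nu> \<bullet> t = 0"
  by (auto simp: normal_vectors_def orthogonal_comp_def orthogonal_def inner_commute)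

lemma subspace_tangent_space: "subspace (tangent_space F)"
  by (simp add: tangent_space_def)

lemma lin_indep_vectors_span:
  assumes "lin_indep_vectors v d W" "dim W \<le> d"
  shows "W \<subseteq> span (v ` {1..d})"
  using assms by (intro card_ge_dim_independent) (auto simp: lin_indep_vectors_def card_image)

context simplex_vertices
begin

lemma vertex_in_face_iff: "C \<subseteq> V \<Longrightarrow> v \<in> V \<Longrightarrow> v \<in> convex hull C \<longleftrightarrow> v \<in> C"
  using face_iff[of C v] by (auto simp: bary_vertex hull_inc split: if_splits)

lemma subsimplices_eq: "subsimplices d (convex hull V) = (\<lambda>C. convex hull C) ` {C. C \<subseteq> V \<and> card C = d + 1}"
proof (intro equalityI subsetI)
  fix F assume "F \<in> subsimplices d (convex hull V)"
  then have F: "F face_of convex hull V" "int d simplex F" by (auto simp: subsimplices_def)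
  then obtain C where C: "C \<subseteq> V" "F = convex hull C"
    using face_of_convex_hull_affine_independent[OF indep] by blast
  have "\<not> affine_dependent C" using affine_independent_subset[OF indep C(1)] .
  then have "int (card C) = aff_dim F + 1"
    using aff_dim_affine_independent[of C] by (simp add: C(2) aff_dim_convex_hull)
  then have "card C = d + 1" using aff_dim_simplex[OF F(2)] by simp
  then show "F \<in> (\<lambda>C. convex hull C) ` {C. C \<subseteq> V \<and> card C = d + 1}" using C by blast
next
  fix F assume "F \<in> (\<lambda>C. convex hull C) ` {C. C \<subseteq> V \<and> card C = d + 1}"
  then obtain C where C: "C \<subseteq> V" "card C = d + 1" "F = convex hull C" by blast
  have "int d simplex F"
    unfolding simplex C(3)
    using affine_independent_subset[OF indep C(1)] C(2) finite_subset[OF C(1) finite_V]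
    by (intro exI[of _ C]) auto
  then show "F \<in> subsimplices d (convex hull V)"
    using face_of_convex_hull_affine_independent[OF indep] C by (auto simp: subsimplices_def)
qed

lemma inj_on_face: "inj_on (\<lambda>C. convex hull C) {C. C \<subseteq> V \<and> card C = d + 1}"
proof (rule inj_onI)
  fix C D assume "C \<in> {C. C \<subseteq> V \<and> card C = d + 1}" "D \<in> {C. C \<subseteq> V \<and> card C = d + 1}"
    and eq: "convex hull C = convex hull D"
  then show "C = D"
    using vertex_in_face_iff[of C] vertex_in_face_iff[of D] by blast
qed

lemma card_subsimplices: "card (subsimplices d (convex hull V)) = (CARD('n) + 1) choose (d + 1)"
  and finite_subsimplices: "finite (subsimplices d (convex hull V))"
  unfolding subsimplices_eq using inj_on_face[of d] finite_V
  by (simp_all add: card_image n_subsets card_V)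

lemma facet_iff: "F facet_of convex hull V \<longleftrightarrow> (\<exists>a\<in>V. F = convex hull (V - {a}))"
  using facet_of_convex_hull_affine_independent_alt[OF indep, of F] card_V by auto

lemma tangent_space_face:
  assumes C: "C \<subseteq> V" "card C = d + 1" shows "dim (tangent_space (convex hull C)) \<le> d"
proof -
  have fC: "finite C" using C(1) finite_V finite_subset by blast
  obtain c where c: "c \<in> C" using C(2) by fastforce
  let ?S = "(\<lambda>v. v - c) ` (C - {c})"
  have "x - y \<in> span ?S" if x: "x \<in> convex hull C" and y: "y \<in> convex hull C" for x y
  proof -
    have expand: "z = (\<Sum>v\<in>C. bary v z *\<^sub>R v)" "(\<Sum>v\<in>C. bary v z) = 1" if "z \<in> convex hull C" for z
    proof -
      have 0: "\<forall>v\<in>V - C. bary v z = 0" using that face_iff[OF C(1)] by blast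
      show "z = (\<Sum>v\<in>C. bary v z *\<^sub>R v)"
        using bary_expansion[of z] 0 C(1) finite_V by (subst (asm) sum.mono_neutral_right[of V C]) auto
      show "(\<Sum>v\<in>C. bary v z) = 1"
        using sum_bary[of z] 0 C(1) finite_V by (subst (asm) sum.mono_neutral_right[of V C]) auto
    qed
    have "x - y = (\<Sum>v\<in>C. bary v x *\<^sub>R v) - (\<Sum>v\<in>C. bary v y *\<^sub>R v)
        - ((\<Sum>v\<in>C. bary v x) - (\<Sum>v\<in>C. bary v y)) *\<^sub>R c"
      using expand[OF x] expand[OF y] by simp
    also have "\<dots> = (\<Sum>v\<in>C. (bary v x - bary v y) *\<^sub>R (v - c))"
      by (simp add: scaleR_diff_left scaleR_diff_right sum_subtractf scaleR_sum_left)
    also have "\<dots> \<in> span ?S"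
    proof (rule span_sum)
      fix v assume "v \<in> C"
      then show "(bary v x - bary v y) *\<^sub>R (v - c) \<in> span ?S"
        by (cases "v = c") (simp add: span_zero, rule span_scale, rule span_base, blast)
    qed
    finally show ?thesis .
  qed
  then have "tangent_space (convex hull C) \<subseteq> span ?S"
    unfolding tangent_space_def by (intro span_minimal) auto
  then have "dim (tangent_space (convex hull C)) \<le> card ?S"
    using fC by (intro dim_le_card) auto
  also have "\<dots> \<le> card (C - {c})" using fC by (intro card_image_le) auto
  finally show ?thesis using C c fC by simp
qed

lemma bgrad_normal: "C \<subseteq> V \<Longrightarrow> a \<in> V - C \<Longrightarrow> bgrad a \<in> normal_vectors (convex hull C)"
  unfolding normal_vectors_iff using face_iff[of C] by (simp add: inner_diff_right bgrad_inner)

text \<open>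
  A normal \<open>\<nu>\<close> has a constant inner product \<open>\<kappa>\<close> with the vertices of the face, and
  \<open>\<nu> = \<Sum>v. (v \<bullet> \<nu> - \<kappa>) bgrad v\<close> because the gradients sum to zero.
\<close>

lemma normal_vectors_face:
  assumes C: "C \<subseteq> V" "C \<noteq> {}"
  shows "normal_vectors (convex hull C) \<subseteq> span (bgrad ` (V - C))"
proof
  fix \<nu> assume \<nu>: "\<nu> \<in> normal_vectors (convex hull C)"
  obtain c where c: "c \<in> C" using C(2) by blast
  have const: "v \<bullet> \<nu> - c \<bullet> \<nu> = 0" if "v \<in> C" for v
    using \<nu> that c hull_inc[of _ C] unfolding normal_vectors_iff by (metis inner_commute inner_diff_left)
  have "\<nu> = (\<Sum>v\<in>V. (v \<bullet> \<nu>) *\<^sub>R bgrad v) - (c \<bullet> \<nu>) *\<^sub>R (\<Sum>v\<in>V. bgrad v)"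
    by (simp add: bgrad_dual_expansion sum_bgrad)
  also have "\<dots> = (\<Sum>v\<in>V. (v \<bullet> \<nu> - c \<bullet> \<nu>) *\<^sub>R bgrad v)"
    by (simp add: scaleR_diff_left sum_subtractf scaleR_sum_right)
  also have "\<dots> = (\<Sum>v\<in>V - C. (v \<bullet> \<nu> - c \<bullet> \<nu>) *\<^sub>R bgrad v)"
    using const finite_V by (intro sum.mono_neutral_right) auto
  also have "\<dots> \<in> span (bgrad ` (V - C))"
    by (intro span_sum span_scale span_base) auto
  finally show "\<nu> \<in> span (bgrad ` (V - C))" .
qed

lemma dim_normal_vectors_face:
  assumes C: "C \<subseteq> V" "card C = d + 1"
  shows "dim (normal_vectors (convex hull C)) \<le> CARD('n) - d"
proof -
  have fC: "finite C" using C(1) finite_V finite_subset by blast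
  have "dim (normal_vectors (convex hull C)) \<le> card (bgrad ` (V - C))"
    using C finite_V by (intro dim_le_card normal_vectors_face) auto
  also have "\<dots> \<le> card (V - C)" using finite_V by (intro card_image_le) auto
  also have "\<dots> = CARD('n) - d" using C fC card_V by (simp add: card_Diff_subset)
  finally show ?thesis .
qed

lemma bubbles_iff_facets:
  "\<tau> \<in> bubbles m \<longleftrightarrow> \<tau> \<in> polys {..m} sym_mats \<and>
    (\<forall>F. F facet_of convex hull V \<longrightarrow> (\<forall>x\<in>F. \<forall>\<nu>\<in>normal_vectors F. \<tau> x *v \<nu> = 0))"
proof -
  define Q where "Q = (\<lambda>F. \<forall>x\<in>F. \<forall>\<nu>\<in>normal_vectors F. \<tau> x *v \<nu> = 0)"
  have eq: "(\<forall>x\<in>convex hull (V - {a}). \<tau> x *v bgrad a = 0) \<longleftrightarrow> Q (convex hull (V - {a}))"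
    if a: "a \<in> V" for a
  proof -
    have "card (V - {a}) = CARD('n)" using a card_V finite_V by simp
    then have ne: "V - {a} \<noteq> {}" by (metis card.empty zero_less_card_finite less_irrefl)
    have sub: "normal_vectors (convex hull (V - {a})) \<subseteq> span {bgrad a}"
      using normal_vectors_face[OF _ ne] a by (simp add: double_diff)
    have mem: "bgrad a \<in> normal_vectors (convex hull (V - {a}))"
      by (rule bgrad_normal) (use a in auto)
    have "\<tau> x *v \<nu> = 0"
      if z: "\<tau> x *v bgrad a = 0" and \<nu>: "\<nu> \<in> normal_vectors (convex hull (V - {a}))" for x \<nu>
    proof -
      obtain r where "\<nu> = r *\<^sub>R bgrad a" using \<nu> sub unfolding span_singleton by blast
      then show ?thesis using z by (simp add: matrix_vector_mult_scaleR)
    qed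
    then show ?thesis unfolding Q_def using mem by blast
  qed
  have "(\<forall>F. F facet_of convex hull V \<longrightarrow> Q F) \<longleftrightarrow> (\<forall>a\<in>V. Q (convex hull (V - {a})))"
    unfolding facet_iff by blast
  then show ?thesis using eq by (simp add: bubbles_def Q_def)
qed

section \<open>Moments over a face\<close>

abbreviation face_integral :: "(real^'n) set \<Rightarrow> (real^'n \<Rightarrow> real) \<Rightarrow> real"
  where "face_integral C g \<equiv> (LINT x:convex hull C|flat_measure (convex hull C). g x)"

lemma flat_measure_coordinates:
  assumes C: "C \<subseteq> V" "C \<noteq> {}"
  obtains a B where "a \<in> convex hull C" "pairwise orthogonal B" "\<And>b. b \<in> B \<Longrightarrow> norm b = 1"
    "span B = tangent_space (convex hull C)" "finite B"
    "flat_measure (convex hull C) = distr (\<Pi>\<^sub>M b\<in>B. lborel) borel (\<lambda>c. a + (\<Sum>b\<in>B. c b *\<^sub>R b))"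
proof -
  define F where "F = convex hull C"
  define a where "a = (SOME a. a \<in> F)"
  define B where "B = (SOME B. pairwise orthogonal B \<and> (\<forall>b\<in>B. norm b = 1) \<and> span B = tangent_space F)"
  have a: "a \<in> F" unfolding a_def using C(2) by (intro someI_ex[of "\<lambda>a. a \<in> F"]) (auto simp: F_def)
  obtain B0 where "pairwise orthogonal B0" "\<And>b. b \<in> B0 \<Longrightarrow> norm b = 1" "span B0 = tangent_space F"
    using orthonormal_basis_subspace[OF subspace_tangent_space[of F]] by metis
  then have "\<exists>B. pairwise orthogonal B \<and> (\<forall>b\<in>B. norm b = 1) \<and> span B = tangent_space F" by blast
  from someI_ex[OF this, folded B_def]
  have B: "pairwise orthogonal B" "\<forall>b\<in>B. norm b = 1" "span B = tangent_space F" by auto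
  have "independent B" using B(1,2) by (intro pairwise_orthogonal_independent) auto
  then have "finite B" by (rule independent_imp_finite)
  moreover have "flat_measure F = distr (\<Pi>\<^sub>M b\<in>B. lborel) borel (\<lambda>c. a + (\<Sum>b\<in>B. c b *\<^sub>R b))"
    unfolding flat_measure_def a_def[symmetric] B_def[symmetric] by (simp add: Let_def)
  ultimately show ?thesis using a B that unfolding F_def by blast
qed

lemma sets_flat_measure: "sets (flat_measure F) = sets borel"
  by (simp add: flat_measure_def Let_def)

lemma measurable_chart:
  fixes B :: "(real^'n) set"
  shows "(\<lambda>c. a + (\<Sum>b\<in>B. c b *\<^sub>R b)) \<in> measurable (\<Pi>\<^sub>M b\<in>B. lborel) borel"
proof -
  have "(\<lambda>c. c b) \<in> borel_measurable (\<Pi>\<^sub>M b\<in>B. lborel :: real measure)" if "b \<in> B" for b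
    using measurable_component_singleton[OF that, of "\<lambda>_. lborel :: real measure"] by simp
  then show ?thesis
    by (intro borel_measurable_add borel_measurable_const borel_measurable_sum borel_measurable_scaleR) auto
qed

lemma emeasure_lborel_box:
  fixes B :: "(real^'n) set" and l u :: "real^'n \<Rightarrow> real"
  assumes "finite B"
  shows "emeasure (\<Pi>\<^sub>M b\<in>B. lborel) (\<Pi>\<^sub>E b\<in>B. {l b..u b}) = (\<Prod>b\<in>B. emeasure lborel {l b..u b})"
proof -
  interpret product_sigma_finite "\<lambda>b::real^'n. lborel :: real measure" ..
  show ?thesis using assms by (intro emeasure_PiM) auto
qed

lemma compact_face: "C \<subseteq> V \<Longrightarrow> compact (convex hull C)"
  using finite_V finite_subset by (intro finite_imp_compact_convex_hull) blast

text \<open>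
  The coordinates of the points of the face lie in a bounded box, so the face has finite measure.
\<close>

lemma integrable_on_face:
  assumes C: "C \<subseteq> V" "C \<noteq> {}" and g: "continuous_on UNIV g"
  shows "set_integrable (flat_measure (convex hull C)) (convex hull C) (g :: real^'n \<Rightarrow> real)"
proof -
  define F where "F = convex hull C"
  obtain a B where a: "a \<in> F" and B: "pairwise orthogonal B" "\<And>b. b \<in> B \<Longrightarrow> norm b = 1"
    "span B = tangent_space F" "finite B"
    and M: "flat_measure F = distr (\<Pi>\<^sub>M b\<in>B. lborel) borel (\<lambda>c. a + (\<Sum>b\<in>B. c b *\<^sub>R b))"
    using flat_measure_coordinates[OF C] unfolding F_def by blast
  let ?\<phi> = "\<lambda>c. a + (\<Sum>b\<in>B. c b *\<^sub>R b)" and ?P = "\<Pi>\<^sub>M b\<in>B. (lborel :: real measure)"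
  have cF: "compact F" unfolding F_def by (rule compact_face[OF C(1)])
  have Fb: "F \<in> sets borel" using compact_imp_closed[OF cF] by (rule borel_closed)
  obtain R where R: "\<And>x. x \<in> F \<Longrightarrow> norm x \<le> R" using compact_imp_bounded[OF cF] unfolding bounded_iff by blast
  have coord: "(?\<phi> c - a) \<bullet> b = c b" if "b \<in> B" for c b
  proof -
    have "(\<Sum>b'\<in>B. c b' * (b' \<bullet> b)) = (\<Sum>b'\<in>B. if b' = b then c b else 0)"
      using B(1,2) that by (intro sum.cong refl) (auto simp: pairwise_def orthogonal_def norm_eq_1)
    then show ?thesis using that B(4) by (simp add: inner_sum_left)
  qed
  have "?\<phi> -` F \<inter> space ?P \<subseteq> (\<Pi>\<^sub>E b\<in>B. {- (R + R)..R + R})"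
  proof
    fix c assume c: "c \<in> ?\<phi> -` F \<inter> space ?P"
    then have ext: "c \<in> extensional B" by (auto simp: space_PiM PiE_def)
    have "\<bar>c b\<bar> \<le> R + R" if b: "b \<in> B" for b
    proof -
      have "\<bar>(?\<phi> c - a) \<bullet> b\<bar> \<le> norm (?\<phi> c - a) * norm b" by (rule Cauchy_Schwarz_ineq2)
      also have "\<dots> \<le> norm (?\<phi> c) + norm a" using B(2)[OF b] norm_triangle_ineq4[of "?\<phi> c" a] by simp
      also have "\<dots> \<le> R + R" using c a R by (intro add_mono) auto
      finally show ?thesis by (simp only: coord[OF b])
    qed
    then show "c \<in> (\<Pi>\<^sub>E b\<in>B. {- (R + R)..R + R})" using ext by (auto simp: PiE_def Pi_def abs_le_iff minus_le_iff)
  qed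
  then have "emeasure ?P (?\<phi> -` F \<inter> space ?P) \<le> emeasure ?P (\<Pi>\<^sub>E b\<in>B. {- (R + R)..R + R})"
    using B(4) by (intro emeasure_mono sets_PiM_I_finite) auto
  also have "\<dots> < \<infinity>"
    unfolding emeasure_lborel_box[OF B(4)] by (auto simp: power_less_top_ennreal emeasure_lborel_Icc_eq)
  finally have fin: "emeasure (flat_measure F) F < \<infinity>"
    unfolding M using emeasure_distr[OF measurable_chart Fb, of B a] by simp
  obtain N where N: "\<And>x. x \<in> F \<Longrightarrow> norm (g x) \<le> N"
    using compact_imp_bounded[OF compact_continuous_image[OF continuous_on_subset[OF g subset_UNIV] cF]]
    unfolding bounded_iff by blast
  show ?thesis
    unfolding set_integrable_def F_def[symmetric]
  proof (rule integrableI_bounded_set[of F _ _ N])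
    show "F \<in> sets (flat_measure F)" using Fb by (simp add: sets_flat_measure)
    have "(\<lambda>x. indicator F x *\<^sub>R g x) \<in> borel_measurable borel"
      using Fb borel_measurable_continuous_onI[OF g] by measurable
    then show "(\<lambda>x. indicator F x *\<^sub>R g x) \<in> borel_measurable (flat_measure F)"
      by (simp add: measurable_cong_sets[OF sets_flat_measure refl])
  qed (use fin N in \<open>auto simp: indicator_def\<close>)
qed

text \<open>
  In the Cartesian coordinates that define the measure on the face, a small box around \<open>x\<close> is mapped
  into the part of the face where \<open>g\<close> is positive, and boxes have positive measure.
\<close>

lemma face_integral_zero_imp:
  assumes C: "C \<subseteq> V" and g: "continuous_on UNIV g" "\<And>x. x \<in> convex hull C \<Longrightarrow> 0 \<le> g x"
    and z: "face_integral C (\<lambda>x. g x) = 0"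
    and x: "x \<in> convex hull C" "\<And>v. v \<in> C \<Longrightarrow> 0 < bary v x"
  shows "g x = (0 :: real)"
proof (rule ccontr)
  assume gx: "g x \<noteq> 0"
  define F where "F = convex hull C"
  have ne: "C \<noteq> {}" using x(1) by auto
  obtain a B where a: "a \<in> F" and B: "pairwise orthogonal B" "\<And>b. b \<in> B \<Longrightarrow> norm b = 1"
    "span B = tangent_space F" "finite B"
    and M: "flat_measure F = distr (\<Pi>\<^sub>M b\<in>B. lborel) borel (\<lambda>c. a + (\<Sum>b\<in>B. c b *\<^sub>R b))"
    using flat_measure_coordinates[OF C ne] unfolding F_def by blast
  let ?\<phi> = "\<lambda>c. a + (\<Sum>b\<in>B. c b *\<^sub>R b)" and ?P = "\<Pi>\<^sub>M b\<in>B. (lborel :: real measure)"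
  have Fb: "F \<in> sets borel" using compact_imp_closed[OF compact_face[OF C]] unfolding F_def by (rule borel_closed)
  let ?W = "{y. g y \<noteq> 0} \<inter> {y. \<forall>v\<in>C. 0 < bary v y}"
  have "open {y. \<forall>v\<in>C. 0 < bary v y}"
    using C finite_subset[OF C finite_V] continuous_bary[of _ UNIV]
    by (auto simp: Collect_ball_eq intro!: open_INT open_Collect_less)
  then have "open ?W" using g(1) by (intro open_Int open_Collect_neq continuous_on_const)
  moreover have "x \<in> ?W" using gx x(2) by auto
  ultimately obtain \<delta> where \<delta>: "\<delta> > 0" "ball x \<delta> \<subseteq> ?W" using openE by blast
  define c0 where "c0 = (\<lambda>b. (x - a) \<bullet> b)"
  define \<epsilon> where "\<epsilon> = \<delta> / (real (card B) + 1)"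
  have \<epsilon>: "\<epsilon> > 0" using \<delta>(1) by (simp add: \<epsilon>_def)
  let ?box = "\<Pi>\<^sub>E b\<in>B. {c0 b - \<epsilon>..c0 b + \<epsilon>}"
  have "x - a \<in> tangent_space F"
    unfolding tangent_space_def using x(1) a by (auto intro!: span_base simp: F_def)
  then have x_eq: "?\<phi> c0 = x"
    using orthonormal_expansion[OF B(1,2,4), of "x - a"] B(3) by (simp add: c0_def)
  have box: "?\<phi> c \<in> F \<and> g (?\<phi> c) \<noteq> 0" if c: "c \<in> ?box" for c
  proof -
    have "norm (?\<phi> c - x) = norm (\<Sum>b\<in>B. (c b - c0 b) *\<^sub>R b)"
      by (subst x_eq[symmetric]) (simp add: scaleR_diff_left sum_subtractf)
    also have "\<dots> \<le> (\<Sum>b\<in>B. norm ((c b - c0 b) *\<^sub>R b))" by (rule norm_sum)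
    also have "\<dots> \<le> (\<Sum>b\<in>B. \<epsilon>)"
    proof (rule sum_mono)
      fix b assume b: "b \<in> B"
      then have "c b \<in> {c0 b - \<epsilon>..c0 b + \<epsilon>}" using c by (auto simp: PiE_iff)
      then show "norm ((c b - c0 b) *\<^sub>R b) \<le> \<epsilon>" using B(2)[OF b] by (simp add: abs_le_iff)
    qed
    also have "\<dots> < \<delta>" using \<delta>(1) by (simp add: \<epsilon>_def field_simps)
    finally have W: "?\<phi> c \<in> ?W" using \<delta>(2) by (auto simp: dist_norm norm_minus_commute subset_iff)
    have "bary v (?\<phi> c) = 0" if v: "v \<in> V - C" for v
    proof -
      have "bgrad v \<bullet> (\<Sum>b\<in>B. c b *\<^sub>R b) = 0"
      proof (rule normal_tangent)
        show "bgrad v \<in> normal_vectors F" unfolding F_def by (rule bgrad_normal[OF C v])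
        show "(\<Sum>b\<in>B. c b *\<^sub>R b) \<in> tangent_space F"
          unfolding B(3)[symmetric] by (intro span_sum span_scale span_base)
      qed
      moreover have "bary v a = 0" using a v face_iff[OF C] unfolding F_def by blast
      ultimately show ?thesis using v by (simp add: bary_add)
    qed
    then have "?\<phi> c \<in> F" unfolding F_def face_iff[OF C] using W by (auto intro: less_imp_le)
    then show ?thesis using W by blast
  qed
  have int: "integrable (flat_measure F) (\<lambda>x. indicator F x *\<^sub>R g x)"
    using integrable_on_face[OF C ne g(1)] unfolding set_integrable_def F_def .
  have "AE y in flat_measure F. indicator F y *\<^sub>R g y = 0"
    using integral_nonneg_eq_0_iff_AE[OF int] g(2) z
    unfolding set_lebesgue_integral_def F_def by (auto simp: indicator_def)
  moreover have "{y \<in> space borel. indicator F y *\<^sub>R g y = 0} \<in> sets borel"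
    using borel_measurable_continuous_onI[OF g(1)] Fb by measurable
  ultimately have "AE c in ?P. indicator F (?\<phi> c) *\<^sub>R g (?\<phi> c) = 0"
    unfolding M using AE_distr_iff[OF measurable_chart, where P = "\<lambda>y. indicator F y *\<^sub>R g y = 0"] by blast
  then have "AE c in ?P. c \<notin> ?box"
    by (rule AE_mp) (use box in \<open>auto intro!: AE_I2\<close>)
  moreover have "?box \<in> sets ?P" using B(4) by (intro sets_PiM_I_finite) auto
  ultimately have "emeasure ?P ?box = 0" using AE_iff_null_sets by blast
  then show False
    using \<epsilon> B(4) unfolding emeasure_lborel_box[OF B(4)] by (auto simp: emeasure_lborel_Icc_eq)
qed

text \<open>
  A polynomial that vanishes on the boundary of a face with vertices \<open>C\<close> has the form \<open>(\<Prod>v\<in>C. bary v) * r\<close>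
  there, where \<open>r\<close> has degree lower by \<open>card C\<close>; testing with \<open>r\<close> makes the integral of
  \<open>(\<Prod>v\<in>C. bary v) * r\<^sup>2\<close> vanish.
\<close>

proposition face_moments_determine:
  fixes p :: "real^'n \<Rightarrow> real"
  assumes C: "C \<subseteq> V" "C \<noteq> {}" and p: "p \<in> polys {..m} UNIV" and m: "m > 0"
    and bdry: "\<And>a x. a \<in> C \<Longrightarrow> x \<in> convex hull (C - {a}) \<Longrightarrow> p x = 0"
    and mom: "\<And>r. r \<in> polys {..m - card C} UNIV \<Longrightarrow>
      face_integral C (\<lambda>x. p x * r x) = 0"
    and x: "x \<in> convex hull C"
  shows "p x = 0"
proof -
  obtain r where r: "r \<in> polys {..m - card C} UNIV"
    and eq: "\<And>x. x \<in> convex hull C \<Longrightarrow> p x = (\<Prod>a\<in>C. bary a x) * r x"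
    by (rule polys_factor_on_face[OF C(1) order_refl p m bdry]) blast+
  let ?g = "\<lambda>x. (\<Prod>a\<in>C. bary a x) * r x * r x"
  have fC: "finite C" using C finite_V finite_subset by blast
  have cg: "continuous_on UNIV ?g"
    using C by (intro continuous_on_mult continuous_on_prod continuous_bary polys_continuous[OF r]) auto
  have nonneg: "0 \<le> ?g x" if "x \<in> convex hull C" for x
  proof -
    have "0 \<le> (\<Prod>a\<in>C. bary a x)" using that face_iff[OF C(1)] by (intro prod_nonneg) auto
    then show ?thesis by (simp add: mult.assoc)
  qed
  have "convex hull C \<in> sets (flat_measure (convex hull C))"
    using compact_imp_closed[OF compact_face[OF C(1)]] by (simp add: sets_flat_measure borel_closed)
  then have "face_integral C (\<lambda>x. ?g x) =
      face_integral C (\<lambda>x. p x * r x)"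
    by (rule set_lebesgue_integral_cong) (simp add: eq)
  then have z: "face_integral C (\<lambda>x. ?g x) = 0" using mom[OF r] by simp
  show ?thesis
  proof (cases "\<forall>v\<in>C. 0 < bary v x")
    case True
    then have "?g x = 0" by (intro face_integral_zero_imp[OF C(1) cg nonneg z x]) auto
    then show ?thesis using eq[OF x] by auto
  next
    case False
    then obtain v where "v \<in> C" "bary v x = 0" using x face_iff[OF C(1)] by force
    then show ?thesis using eq[OF x] fC by auto
  qed
qed

end

section \<open>The space of shape functions\<close>

context simplex_vertices
begin

text \<open>
  The components of \<open>div \<tau>\<close> of degree at least \<open>k\<close> form the divergence of the part of \<open>\<tau>\<close> of degree
  greater than \<open>k\<close>. So this part is divergence-free if and only if \<open>div \<tau>\<close> has degree at most \<open>k - 1\<close>.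
\<close>

lemma P_star_eq:
  assumes "k \<ge> 1"
  shows "P_star k = {\<tau> \<in> polys {..k + CARD('n) - 1} sym_mats. row_div \<tau> \<in> polys {..k - 1} (UNIV :: (real^'n) set)}"
    (is "_ = {\<tau> \<in> ?P. row_div \<tau> \<in> ?D}")
proof -
  define m where "m = k + CARD('n) - 1"
  have km: "k \<le> m" using zero_less_card_finite[where 'a='n] unfolding m_def by linarith
  have J: "{..k} \<union> {k + 1..m} = {..m}" "{..k} \<inter> {k + 1..m} = {}" using km by auto
  have sub: "polys {..k} sym_mats \<subseteq> (polys {..m} sym_mats :: (real^'n \<Rightarrow> real^'n^'n) set)"
    "polys {k + 1..m} sym_mats \<subseteq> (polys {..m} sym_mats :: (real^'n \<Rightarrow> real^'n^'n) set)"
    using km subspace_0[OF subspace_sym_mats] by (intro polys_mono; auto)+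
  have S: "subspace (polys {..m} sym_mats :: (real^'n \<Rightarrow> real^'n^'n) set)"
    by (rule subspace_polys[OF subspace_sym_mats])
  have lin: "linear_map_on (polys {..m} sym_mats) (row_div :: (real^'n \<Rightarrow> real^'n^'n) \<Rightarrow> _)"
    by (rule linear_row_div) simp
  have low: "row_div \<sigma> \<in> ?D" if "\<sigma> \<in> polys {..k} sym_mats" for \<sigma>
    by (rule row_div_polys[OF that]) auto
  have "\<sigma> + \<rho> \<in> polys {..m} sym_mats \<and> row_div (\<sigma> + \<rho>) \<in> ?D"
    if \<sigma>: "\<sigma> \<in> polys {..k} sym_mats" and \<rho>: "\<rho> \<in> Sigma_DF {k + 1..m}" for \<sigma> \<rho>
  proof -
    have \<rho>': "\<rho> \<in> polys {k + 1..m} sym_mats" "row_div \<rho> = 0"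
      using \<rho> by (auto simp: Sigma_DF_def zero_fun_def)
    have in_m: "\<sigma> \<in> polys {..m} sym_mats" "\<rho> \<in> polys {..m} sym_mats" using \<sigma> \<rho>' sub by auto
    have "row_div (\<sigma> + \<rho>) = row_div \<sigma>"
      using linear_map_onD(1)[OF lin in_m] \<rho>'(2) by simp
    then show ?thesis using subspace_add[OF S in_m] low[OF \<sigma>] by simp
  qed
  moreover have "\<exists>\<sigma> \<rho>. \<tau> = \<sigma> + \<rho> \<and> \<sigma> \<in> polys {..k} sym_mats \<and> \<rho> \<in> Sigma_DF {k + 1..m}"
    if \<tau>: "\<tau> \<in> polys {..m} sym_mats" "row_div \<tau> \<in> ?D" for \<tau>
  proof -
    obtain \<sigma> \<rho> where \<sigma>: "\<sigma> \<in> polys {..k} sym_mats" and \<rho>: "\<rho> \<in> polys {k + 1..m} sym_mats" and eq: "\<tau> = \<sigma> + \<rho>"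
      using polys_split[of \<tau> "{..k}" "{k + 1..m}" sym_mats] \<tau>(1) J by auto
    have in_m: "\<sigma> \<in> polys {..m} sym_mats" "\<rho> \<in> polys {..m} sym_mats" using \<sigma> \<rho> sub by auto
    have high: "row_div \<rho> \<in> polys {k..m} UNIV"
      by (rule row_div_polys[OF \<rho>]) auto
    have "row_div \<rho> = row_div \<tau> - row_div \<sigma>"
      using linear_map_onD(1)[OF lin in_m] eq by simp
    then have "row_div \<rho> \<in> ?D"
      using subspace_diff[OF subspace_polys[OF subspace_UNIV] \<tau>(2) low[OF \<sigma>]] by simp
    then have "row_div \<rho> x $ i = 0" for x i
      using polys_disjoint_zero[OF polys_component[OF high, of i] polys_component[of "row_div \<rho>" "{..k - 1}" i]] assms
      by (auto simp: fun_eq_iff)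
    then have "\<rho> \<in> Sigma_DF {k + 1..m}" using \<rho> by (simp add: Sigma_DF_def vec_eq_iff)
    then show ?thesis using eq \<sigma> by blast
  qed
  ultimately show ?thesis unfolding P_star_def m_def[symmetric] by blast
qed

lemma P_star_subset: "k \<ge> 1 \<Longrightarrow> P_star k \<subseteq> (polys {..k + CARD('n) - 1} sym_mats :: (real^'n \<Rightarrow> real^'n^'n) set)"
  by (auto simp: P_star_eq)

lemma subspace_P_star:
  assumes "k \<ge> 1" shows "subspace (P_star k :: (real^'n \<Rightarrow> real^'n^'n) set)"
  unfolding P_star_eq[OF assms]
  by (intro subspace_preimage_on linear_row_div subspace_polys subspace_sym_mats) auto

lemma finite_dim_P_star: "k \<ge> 1 \<Longrightarrow> finite_dim (P_star k :: (real^'n \<Rightarrow> real^'n^'n) set)"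
  by (rule finite_dim_subset[OF finite_dim_polys_sym P_star_subset])

text \<open>
  The opposite inequality comes from unisolvence itself: the degrees of freedom separate the fields,
  and their number is exactly this lower bound.
\<close>

lemma dim_P_star_ge:
  assumes "k \<ge> 1"
  shows "card edges * ((k + 2 * CARD('n) - 1) choose CARD('n)) + CARD('n) * ((k - 1 + CARD('n)) choose CARD('n))
    \<le> dim (P_star k :: (real^'n \<Rightarrow> real^'n^'n) set) + CARD('n) * ((k + 2 * CARD('n) - 2) choose CARD('n))"
proof -
  let ?n = "CARD('n)" and ?m = "k + CARD('n) - 1"
  have n: "?n \<ge> 1" using zero_less_card_finite[where 'a='n] by linarith
  let ?P = "polys {..?m} sym_mats :: (real^'n \<Rightarrow> real^'n^'n) set"
  let ?Y = "polys {..?m - 1} UNIV :: (real^'n \<Rightarrow> real^'n) set"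
  have "dim ?P + dim (polys {..k - 1} UNIV :: (real^'n \<Rightarrow> real^'n) set)
      \<le> dim {\<tau> \<in> ?P. row_div \<tau> \<in> polys {..k - 1} UNIV} + dim ?Y"
  proof (rule dim_preimage_ge[OF linear_row_div _ subspace_polys[OF subspace_sym_mats] finite_dim_polys_sym
        finite_dim_polys_vec subspace_polys[OF subspace_UNIV] subspace_polys[OF subspace_UNIV]])
    show "row_div ` ?P \<subseteq> ?Y" by (auto intro!: row_div_polys)
    have "k - 1 \<le> ?m - 1" using n by linarith
    then show "polys {..k - 1} UNIV \<subseteq> ?Y" by (intro polys_mono) auto
  qed simp
  moreover have "?m + ?n = k + 2 * ?n - 1" "?m - 1 + ?n = k + 2 * ?n - 2" using n assms by linarith+
  ultimately show ?thesis
    unfolding P_star_eq[OF assms] dim_polys_sym dim_polys_vec by simp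
qed

lemma M_space_eq:
  assumes "k \<ge> 1"
  shows "M_space k (convex hull V) = {\<tau> \<in> bubbles (k + CARD('n) - 1). \<forall>x. row_div \<tau> x = 0}"
proof -
  have "row_div \<tau> \<in> polys {..k - 1} UNIV" if "\<forall>x. row_div \<tau> x = 0" for \<tau> :: "real^'n \<Rightarrow> real^'n^'n"
    using that subspace_0[OF subspace_polys[OF subspace_UNIV, of "{..k - 1}"]] by (simp add: zero_fun_def fun_eq_iff[symmetric])
  then show ?thesis
    unfolding M_space_def P_star_eq[OF assms] bubbles_iff_facets by blast
qed

text \<open>
  The binomial coefficients are the dimensions of the bubble fields of degree \<open>k + n - 1\<close> and of the
  vector fields of degree \<open>k + n - 2\<close>; the remaining \<open>card edges = n (n + 1) / 2\<close> are the rigid motions.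
\<close>

lemma dim_M_space:
  assumes "k \<ge> 2"
  shows "CARD('n) * ((k + 2 * CARD('n) - 2) choose CARD('n)) + dim (M_space k (convex hull V)) =
    card edges + card edges * ((k + 2 * CARD('n) - 3) choose CARD('n))"
proof -
  let ?n = "CARD('n)" and ?m = "k + CARD('n) - 1"
  have n: "?n \<ge> 1" using zero_less_card_finite[where 'a='n] by linarith
  have m: "?m \<ge> 2" using n assms by linarith
  have "1 \<le> ?m - 1" using m by linarith
  then have "dim {v \<in> polys {..?m - 1} UNIV. \<forall>x. sym_grad v x = (0 :: real^'n^'n)} = card edges"
    using dim_rigid_motions[of "?m - 1"] card_edges by linarith
  moreover have "?m - 1 + ?n = k + 2 * ?n - 2" "?m - 2 + ?n = k + 2 * ?n - 3" using n assms by linarith+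
  ultimately show ?thesis
    using dim_divergence_free_bubbles[OF m] dim_bubbles[OF m] assms
    by (simp add: M_space_eq dim_polys_vec)
qed

lemma
  assumes "k \<ge> 2"
  shows dim_strains: "dim (sym_grad ` (polys {..k - 1} UNIV :: (real^'n \<Rightarrow> real^'n) set)) + card edges =
      CARD('n) * ((k - 1 + CARD('n)) choose CARD('n))"
    and finite_dim_strains: "finite_dim (sym_grad ` (polys {..k - 1} UNIV :: (real^'n \<Rightarrow> real^'n) set))"
    and subspace_strains: "subspace (sym_grad ` (polys {..k - 1} UNIV :: (real^'n \<Rightarrow> real^'n) set))"
proof -
  let ?P = "polys {..k - 1} UNIV :: (real^'n \<Rightarrow> real^'n) set"
  note rn = rank_nullity_on[OF linear_sym_grad subspace_polys[OF subspace_UNIV] finite_dim_polys_vec, of "k - 1"]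
  have "{v \<in> ?P. sym_grad v = 0} = {v \<in> ?P. \<forall>x. sym_grad v x = 0}"
    by (auto simp: fun_eq_iff zero_fun_def)
  moreover have "1 \<le> k - 1" using assms by linarith
  then have "dim {v \<in> ?P. \<forall>x. sym_grad v x = 0} = card edges"
    using dim_rigid_motions[of "k - 1"] card_edges by linarith
  ultimately have rigid: "dim {v \<in> ?P. sym_grad v = 0} = card edges" by (simp only:)
  show "dim (sym_grad ` ?P) + card edges = CARD('n) * ((k - 1 + CARD('n)) choose CARD('n))"
    using rn(1) rigid by (simp add: dim_polys_vec)
  show "finite_dim (sym_grad ` ?P)" using rn(2) by simp
  show "subspace (sym_grad ` ?P)"
    by (rule subspace_image_on[OF linear_sym_grad subspace_polys[OF subspace_UNIV]]) simp
qed

section \<open>Degrees of freedom\<close>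

lemma linear_simplex_moment:
  fixes \<theta> :: "real^'n \<Rightarrow> real^'n^'n"
  assumes "\<theta> \<in> polys {..r} sym_mats"
  shows "linear_map_on (polys {..m} sym_mats) (\<lambda>\<tau>. simplex_integral (\<lambda>x. \<tau> x \<bullet> \<theta> x))"
  by (intro linear_map_on_set_integral integrable_on_simplex continuous_on_inner polys_continuous_sym[OF assms])
    (auto intro: polys_continuous_sym simp: linear_map_on_def plus_fun_def scaleR_fun_def inner_add_left)

lemma face_moment_integrable:
  assumes C: "C \<subseteq> V" "C \<noteq> {}" and g: "g \<in> polys {..a} UNIV" and q: "q \<in> polys_on (convex hull C) b"
  shows "set_integrable (flat_measure (convex hull C)) (convex hull C) (\<lambda>x. g x * q x)"
proof -
  obtain p where p: "p \<in> polys {..b} UNIV" "q = (\<lambda>x. if x \<in> convex hull C then p x else 0)"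
    using q unfolding polys_on_def by blast
  have "set_integrable (flat_measure (convex hull C)) (convex hull C) (\<lambda>x. g x * p x)"
    by (intro integrable_on_face C continuous_on_mult polys_continuous[OF g] polys_continuous[OF p(1)] finite_atMost)
  moreover have "(\<lambda>x. indicator (convex hull C) x *\<^sub>R (g x * q x)) = (\<lambda>x. indicator (convex hull C) x *\<^sub>R (g x * p x))"
    by (auto simp: p(2) indicator_def)
  ultimately show ?thesis unfolding set_integrable_def by (simp only:)
qed

lemma linear_face_moment_weight:
  assumes C: "C \<subseteq> V" "C \<noteq> {}" and g: "g \<in> polys {..a} UNIV"
  shows "linear_map_on (polys_on (convex hull C) b)
    (\<lambda>q. face_integral C (\<lambda>x. g x * q x))"
  by (rule linear_map_on_set_integral[OF face_moment_integrable[OF C g]])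
    (auto simp: linear_map_on_def plus_fun_def scaleR_fun_def distrib_left mult.left_commute)

lemma linear_component: "linear (\<lambda>A :: real^'n^'n. w \<bullet> (A *v \<nu>))"
  by (simp add: linear_iff matrix_vector_mult_add_rdistrib inner_add_right scaleR_matrix_vector_assoc[symmetric])

lemma polys_component_pair:
  "\<tau> \<in> polys J sym_mats \<Longrightarrow> (\<lambda>x. w \<bullet> (\<tau> x *v \<nu>)) \<in> polys J UNIV" for \<tau> :: "real^'n \<Rightarrow> real^'n^'n"
  by (rule polys_linear_image[OF _ linear_component]) auto

lemma linear_face_moment:
  fixes w \<nu> :: "real^'n"
  assumes C: "C \<subseteq> V" "C \<noteq> {}" and q: "q \<in> polys_on (convex hull C) b"
  shows "linear_map_on (polys {..m} sym_mats)
    (\<lambda>\<tau>. face_integral C (\<lambda>x. (w \<bullet> (\<tau> x *v \<nu>)) * q x))"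
  by (rule linear_map_on_set_integral[OF face_moment_integrable[OF C polys_component_pair q]])
    (auto simp: linear_map_on_def plus_fun_def scaleR_fun_def linear_add[OF linear_component]
      linear_scale[OF linear_component] distrib_right mult.assoc)

end

subsection \<open>Counting\<close>

lemma card_ordered_pairs: "card (SIGMA j:{1..p::nat}. {1..j}) = (p + 1) choose 2"
proof -
  have "(\<Sum>j=1..p. j) = (p + 1) choose 2" by (induction p) (auto simp: numeral_2_eq_2)
  then show ?thesis by simp
qed

lemma
  fixes F :: "(real^'n) set"
  assumes "finite (Q F)" "d \<le> CARD('n)"
  shows card_face_dofs: "card (face_dofs Q d F) =
      ((CARD('n) + 1 - d choose 2) + d * (CARD('n) - d)) * card (Q F)"
    and finite_face_dofs: "finite (face_dofs Q d F)"
proof -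
  let ?p = "CARD('n) - d"
  let ?T = "(\<lambda>(l, i, q). TN F l i q :: 'n dof) ` ({1..d} \<times> {1..?p} \<times> Q F)"
  let ?N = "(\<lambda>((j, i), q). NN F i j q :: 'n dof) ` ((SIGMA j:{1..?p}. {1..j}) \<times> Q F)"
  have eq: "face_dofs Q d F = ?T \<union> ?N"
    unfolding face_dofs_def by (auto simp: image_iff split: prod.splits)
  have "inj_on (\<lambda>(l, i, q). TN F l i q :: 'n dof) ({1..d} \<times> {1..?p} \<times> Q F)"
    "inj_on (\<lambda>((j, i), q). NN F i j q :: 'n dof) ((SIGMA j:{1..?p}. {1..j}) \<times> Q F)"
    by (auto simp: inj_on_def)
  then have "card ?T = card ({1..d} \<times> {1..?p} \<times> Q F)"
    "card ?N = card ((SIGMA j:{1..?p}. {1..j}) \<times> Q F)"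
    by (auto intro: card_image)
  then have c: "card ?T = d * (?p * card (Q F))" "card ?N = (?p + 1 choose 2) * card (Q F)"
    unfolding card_cartesian_product card_ordered_pairs by simp_all
  have fin: "finite ?T" "finite ?N" using assms(1) by auto
  then show "finite (face_dofs Q d F)" unfolding eq by blast
  have "?T \<inter> ?N = {}" by auto
  then have "card (face_dofs Q d F) = card ?T + card ?N"
    unfolding eq using fin by (intro card_Un_disjoint)
  moreover have "CARD('n) + 1 - d = ?p + 1" using assms(2) by simp
  ultimately show "card (face_dofs Q d F) = ((CARD('n) + 1 - d choose 2) + d * (CARD('n) - d)) * card (Q F)"
    by (simp only: c) (simp add: algebra_simps)
qed

context simplex_vertices
begin

lemma card_all_face_dofs:
  assumes "\<And>d F. d < m \<Longrightarrow> F \<in> subsimplices d (convex hull V) \<Longrightarrow> finite (face_dofs Q d F) \<and> card (face_dofs Q d F) = c d"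
  shows "card (\<Union>d<m. \<Union>F\<in>subsimplices d (convex hull V). face_dofs Q d F) = (\<Sum>d<m. (CARD('n) + 1 choose (d + 1)) * c d)"
proof -
  let ?F = "\<lambda>d. subsimplices d (convex hull V)"
  have disjoint: "face_dofs Q d F \<inter> face_dofs Q d' F' = {}" if "F \<noteq> F'" for d d' and F F' :: "(real^'n) set"
    using that unfolding face_dofs_def by auto
  have same_dim: "d = d'" if "F \<in> ?F d" "F \<in> ?F d'" for d d' F
    using that aff_dim_simplex[of "int d" F] aff_dim_simplex[of "int d'" F] by (simp add: subsimplices_def)
  have inner: "card (\<Union>F\<in>?F d. face_dofs Q d F) = (CARD('n) + 1 choose (d + 1)) * c d" if d: "d < m" for d
  proof -
    have "card (\<Union>F\<in>?F d. face_dofs Q d F) = (\<Sum>F\<in>?F d. card (face_dofs Q d F))"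
    proof (rule card_UN_disjoint[OF finite_subsimplices])
      show "\<forall>F\<in>?F d. finite (face_dofs Q d F)" using assms[OF d] by blast
      show "\<forall>F\<in>?F d. \<forall>F'\<in>?F d. F \<noteq> F' \<longrightarrow> face_dofs Q d F \<inter> face_dofs Q d F' = {}"
        by (intro ballI impI disjoint)
    qed
    also have "\<dots> = (\<Sum>F\<in>?F d. c d)" using assms[OF d] by (intro sum.cong) auto
    finally show ?thesis by (simp add: card_subsimplices)
  qed
  have "card (\<Union>d<m. \<Union>F\<in>?F d. face_dofs Q d F) = (\<Sum>d<m. card (\<Union>F\<in>?F d. face_dofs Q d F))"
  proof (rule card_UN_disjoint)
    show "\<forall>d\<in>{..<m}. finite (\<Union>F\<in>?F d. face_dofs Q d F)"
      using assms finite_subsimplices by auto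
    show "\<forall>d\<in>{..<m}. \<forall>d'\<in>{..<m}. d \<noteq> d' \<longrightarrow>
        (\<Union>F\<in>?F d. face_dofs Q d F) \<inter> (\<Union>F\<in>?F d'. face_dofs Q d' F) = {}"
    proof (intro ballI impI equals0I)
      fix d d' \<delta> assume dd': "d \<noteq> d'"
        and \<delta>: "\<delta> \<in> (\<Union>F\<in>?F d. face_dofs Q d F) \<inter> (\<Union>F\<in>?F d'. face_dofs Q d' F)"
      then obtain F F' where F: "F \<in> ?F d" "\<delta> \<in> face_dofs Q d F" "F' \<in> ?F d'" "\<delta> \<in> face_dofs Q d' F'" by blast
      then have "F \<noteq> F'" using same_dim dd' by blast
      then show False using disjoint[of F F' d d'] F by blast
    qed
  qed simp
  also have "\<dots> = (\<Sum>d<m. (CARD('n) + 1 choose (d + 1)) * c d)"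
    using inner by (intro sum.cong) auto
  finally show ?thesis .
qed

end

lemma twice_component_count:
  fixes n d :: nat
  assumes "d \<le> n"
  shows "2 * ((n + 1 - d choose 2) + d * (n - d)) = (n - d) * (n + d + 1)"
proof -
  obtain e where n: "n = d + e" using assms le_iff_add by blast
  have "2 * (e + 1 choose 2) = e * (e + 1)" by (induction e) (auto simp: numeral_2_eq_2)
  then have "2 * ((e + 1 choose 2) + d * e) = e * (e + 1) + 2 * (d * e)" by (simp only: distrib_left)
  also have "\<dots> = e * (n + d + 1)" by (simp add: n algebra_simps)
  finally have "2 * ((e + 1 choose 2) + d * e) = e * (n + d + 1)" .
  moreover have "n + 1 - d = e + 1" "n - d = e" using n by simp_all
  ultimately show ?thesis by (simp only:)
qed

text \<open>
  The absorptions \<open>(n - d) (n + 1 choose d + 1) = (n + 1) (n choose d + 1)\<close> and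
  \<open>(d + 1) (n choose d + 1) = n (n - 1 choose d)\<close> reduce the sum to two Vandermonde convolutions.
\<close>

lemma face_dof_count:
  fixes n N :: nat
  assumes "n \<ge> 1"
  shows "(\<Sum>d<n. (n + 1 choose (d + 1)) * ((n - d) * (n + d + 1)) * (N choose d)) =
    n * (n + 1) * ((N + n choose (n - 1)) + (N + n - 1 choose (n - 1)))"
proof -
  have "(n + 1 choose (d + 1)) * ((n - d) * (n + d + 1)) * (N choose d) =
      n * (n + 1) * ((N choose d) * (n choose (n - 1 - d)) + (N choose d) * (n - 1 choose (n - 1 - d)))"
    if d: "d < n" for d
  proof -
    have 1: "(n - d) * (n + 1 choose (d + 1)) = (n + 1) * (n choose (d + 1))"
      using binomial_absorb_comp[of "n + 1" "d + 1"] by simp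
    have 2: "(d + 1) * (n choose (d + 1)) = n * (n - 1 choose d)"
      using binomial_absorption[of d n] by simp
    have 3: "n choose (d + 1) = n choose (n - 1 - d)" "n - 1 choose d = n - 1 choose (n - 1 - d)"
      using binomial_symmetric[of "d + 1" n] binomial_symmetric[of d "n - 1"] d by auto
    have factor: "(n + 1) * (n * A + n * B) = n * (n + 1) * (A + B)" for A B :: nat
      by (simp add: algebra_simps)
    have "(n + 1 choose (d + 1)) * ((n - d) * (n + d + 1)) =
        ((n - d) * (n + 1 choose (d + 1))) * (n + d + 1)" by (simp only: mult_ac)
    also have "\<dots> = (n + 1) * (n * (n choose (d + 1)) + (d + 1) * (n choose (d + 1)))"
      unfolding 1 by (simp add: algebra_simps)
    also have "\<dots> = (n + 1) * (n * (n choose (d + 1)) + n * (n - 1 choose d))"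
      by (simp only: 2)
    also have "\<dots> = n * (n + 1) * ((n choose (d + 1)) + (n - 1 choose d))"
      by (rule factor)
    also have "\<dots> = n * (n + 1) * ((n choose (n - 1 - d)) + (n - 1 choose (n - 1 - d)))"
      by (simp only: 3)
    finally have "(n + 1 choose (d + 1)) * ((n - d) * (n + d + 1)) =
        n * (n + 1) * ((n choose (n - 1 - d)) + (n - 1 choose (n - 1 - d)))" .
    then show ?thesis by (simp only: distrib_left distrib_right mult_ac)
  qed
  then have "(\<Sum>d<n. (n + 1 choose (d + 1)) * ((n - d) * (n + d + 1)) * (N choose d)) =
      (\<Sum>d<n. n * (n + 1) * ((N choose d) * (n choose (n - 1 - d)) + (N choose d) * (n - 1 choose (n - 1 - d))))"
    by (intro sum.cong) auto
  also have "\<dots> = n * (n + 1) * ((\<Sum>d<n. (N choose d) * (n choose (n - 1 - d))) +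
      (\<Sum>d<n. (N choose d) * (n - 1 choose (n - 1 - d))))"
    by (simp only: sum_distrib_left[symmetric] sum.distrib)
  also have "\<dots> = n * (n + 1) * ((N + n choose (n - 1)) + (N + n - 1 choose (n - 1)))"
  proof -
    have idx: "{..<n} = {..n - 1}" and shift: "N + n - 1 = N + (n - 1)" using assms by auto
    have "(\<Sum>d<n. (N choose d) * (n choose (n - 1 - d))) = (N + n choose (n - 1))"
      unfolding idx by (rule vandermonde)
    moreover have "(\<Sum>d<n. (N choose d) * (n - 1 choose (n - 1 - d))) = (N + n - 1 choose (n - 1))"
      unfolding idx shift by (rule vandermonde)
    ultimately show ?thesis by (simp only:)
  qed
  finally show ?thesis .
qed

text \<open>
  With \<open>e\<close> the number of edges and \<open>m = N + 1\<close>, the right-hand side is the dimension of the symmetric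
  matrix fields of degree \<open>m\<close> and the second summand the dimension of the bubble fields among them: the
  face degrees of freedom count what lies between the two. Pascal's rule, applied twice, writes the
  difference of the two binomial coefficients as the sum found above.
\<close>

lemma face_dof_total:
  fixes n N e :: nat
  assumes n: "n \<ge> 1" and e: "2 * e = n * (n + 1)"
  shows "(\<Sum>d<n. (n + 1 choose (d + 1)) * (((n + 1 - d choose 2) + d * (n - d)) * (N choose d)))
    + e * (N + n - 1 choose n) = e * (N + n + 1 choose n)"
proof -
  let ?A = "\<lambda>d. (n + 1 choose (d + 1)) * (((n + 1 - d choose 2) + d * (n - d)) * (N choose d))"
  have "2 * (\<Sum>d<n. ?A d) = (\<Sum>d<n. (n + 1 choose (d + 1)) * ((n - d) * (n + d + 1)) * (N choose d))"
    unfolding sum_distrib_left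
  proof (rule sum.cong[OF refl])
    fix d assume "d \<in> {..<n}"
    then have c: "2 * ((n + 1 - d choose 2) + d * (n - d)) = (n - d) * (n + d + 1)"
      by (intro twice_component_count) simp
    have "2 * ?A d = (n + 1 choose (d + 1)) * (2 * ((n + 1 - d choose 2) + d * (n - d))) * (N choose d)"
      by (simp only: mult_ac)
    then show "2 * ?A d = (n + 1 choose (d + 1)) * ((n - d) * (n + d + 1)) * (N choose d)"
      by (simp only: c)
  qed
  also have "\<dots> = 2 * (e * ((N + n choose (n - 1)) + (N + n - 1 choose (n - 1))))"
    unfolding face_dof_count[OF n] e[symmetric] by simp
  finally have faces: "(\<Sum>d<n. ?A d) = e * ((N + n choose (n - 1)) + (N + n - 1 choose (n - 1)))"
    by simp
  obtain i where "n = Suc i" using n by (cases n) auto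
  then have "(N + n + 1 choose n) = (N + n choose (n - 1)) + (N + n - 1 choose (n - 1)) + (N + n - 1 choose n)"
    by simp
  then show ?thesis
    unfolding faces by (simp add: algebra_simps)
qed

section \<open>Unisolvence\<close>

context simplex_vertices
begin

text \<open>
  The traces \<open>\<tau> \<nu>\<close> vanish face by face, by induction on the dimension: normals of a face are also
  normals of its subfaces, so by induction the components of \<open>\<tau> \<nu>\<close> vanish on the boundary of the face.
\<close>

proposition face_moments_imp_normal_trace_zero:
  fixes t \<nu> :: "(real^'n) set \<Rightarrow> nat \<Rightarrow> real^'n" and \<tau> :: "real^'n \<Rightarrow> real^'n^'n"
  assumes k: "k \<ge> 1" and \<tau>: "\<tau> \<in> polys {..k + CARD('n) - 1} sym_mats"
    and tangents: "\<And>d F. \<lbrakk>d < CARD('n); F \<in> subsimplices d (convex hull V)\<rbrakk> \<Longrightarrow>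
          lin_indep_vectors (t F) d (tangent_space F)"
    and normals: "\<And>d F. \<lbrakk>d < CARD('n); F \<in> subsimplices d (convex hull V)\<rbrakk> \<Longrightarrow>
          lin_indep_vectors (\<nu> F) (CARD('n) - d) (normal_vectors F)"
    and Q: "\<And>d F. \<lbrakk>d < CARD('n); F \<in> subsimplices d (convex hull V)\<rbrakk> \<Longrightarrow>
          is_basis (Q F) (polys_on F (k + CARD('n) - d - 2))"
    and dofs: "\<And>d F \<delta>. \<lbrakk>d < CARD('n); F \<in> subsimplices d (convex hull V); \<delta> \<in> face_dofs Q d F\<rbrakk> \<Longrightarrow>
          dof_val K t \<nu> \<delta> \<tau> = 0"
  shows "d < CARD('n) \<Longrightarrow> C \<subseteq> V \<Longrightarrow> card C = d + 1 \<Longrightarrow> x \<in> convex hull C \<Longrightarrow>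
    \<nu>' \<in> normal_vectors (convex hull C) \<Longrightarrow> \<tau> x *v \<nu>' = 0"
proof (induction d arbitrary: C x \<nu>' rule: less_induct)
  case (less d)
  let ?F = "convex hull C" and ?m = "k + CARD('n) - 1"
  have F: "?F \<in> subsimplices d (convex hull V)" unfolding subsimplices_eq using less.prems by blast
  have ne: "C \<noteq> {}" using less.prems(3) by auto
  note basis = Q[OF less.prems(1) F]
  have deg: "?m - card C = k + CARD('n) - d - 2" using less.prems(3) by simp
  have m: "?m > 0" using k less.prems(1) by linarith
  have boundary: "\<tau> y *v w = 0"
    if "a \<in> C" "y \<in> convex hull (C - {a})" "w \<in> normal_vectors ?F" for a y w
  proof (cases d)
    \<comment> \<open>A vertex has no boundary: no point lies in the convex hull of the remaining vertices.\<close>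
    case 0
    then have empty: "C - {a} = {}" using less.prems(3) that(1) card_1_singletonE[of C] by auto
    show ?thesis using that(2) unfolding empty by simp
  next
    case (Suc d')
    have "finite C" using less.prems(3) card.infinite by fastforce
    then have "card (C - {a}) = d' + 1" using less.prems(3) that(1) Suc by simp
    moreover have "w \<in> normal_vectors (convex hull (C - {a}))"
      using that(3) normal_vectors_antimono[OF hull_mono[of "C - {a}" C convex]] by blast
    ultimately show ?thesis
      using less.IH[of d' "C - {a}" y w] Suc less.prems(1,2) that(2) by auto
  qed
  have component: "w \<bullet> (\<tau> x *v \<nu> ?F i) = 0"
    if i: "i \<in> {1..CARD('n) - d}" and x: "x \<in> ?F"
      and mom: "\<And>q. q \<in> Q ?F \<Longrightarrow> (LINT y:?F|flat_measure ?F. (w \<bullet> (\<tau> y *v \<nu> ?F i)) * q y) = 0"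
    for w i x
  proof -
    let ?p = "\<lambda>y. w \<bullet> (\<tau> y *v \<nu> ?F i)"
    have p: "?p \<in> polys {..?m} UNIV" by (rule polys_component_pair[OF \<tau>])
    have \<nu>i: "\<nu> ?F i \<in> normal_vectors ?F"
      using normals[OF less.prems(1) F] i unfolding lin_indep_vectors_def by blast
    show "?p x = 0"
    proof (rule face_moments_determine[OF less.prems(2) ne p m _ _ x])
      show "?p y = 0" if "a \<in> C" "y \<in> convex hull (C - {a})" for a y
        using boundary[OF that \<nu>i] by simp
      fix r :: "real^'n \<Rightarrow> real" assume r: "r \<in> polys {..?m - card C} UNIV"
      let ?q = "\<lambda>y. if y \<in> ?F then r y else 0"
      have q: "?q \<in> polys_on ?F (k + CARD('n) - d - 2)"
        using r unfolding deg polys_on_def by blast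
      have "(LINT y:?F|flat_measure ?F. ?p y * ?q y) = 0"
        using is_basis_annihilates[OF basis dim_polys_on_face(2,3)[OF less.prems(2) ne]
            linear_face_moment_weight[OF less.prems(2) ne p] mom q] .
      moreover have "?F \<in> sets (flat_measure ?F)"
        using compact_imp_closed[OF compact_face[OF less.prems(2)]] by (simp add: sets_flat_measure borel_closed)
      then have "(LINT y:?F|flat_measure ?F. ?p y * ?q y) = (LINT y:?F|flat_measure ?F. ?p y * r y)"
        by (rule set_lebesgue_integral_cong) simp
      ultimately show "(LINT y:?F|flat_measure ?F. ?p y * r y) = 0" by simp
    qed
  qed
  have tangential: "t ?F l \<bullet> (\<tau> x *v \<nu> ?F i) = 0" if "l \<in> {1..d}" "i \<in> {1..CARD('n) - d}" for l i
  proof (rule component[OF that(2) less.prems(4)])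
    fix q assume "q \<in> Q ?F"
    then have "TN ?F l i q \<in> face_dofs Q d ?F" unfolding face_dofs_def using that by blast
    from dofs[OF less.prems(1) F this]
    show "(LINT y:?F|flat_measure ?F. (t ?F l \<bullet> (\<tau> y *v \<nu> ?F i)) * q y) = 0" by simp
  qed
  have normal: "\<nu> ?F i \<bullet> (\<tau> x *v \<nu> ?F j) = 0"
    if "i \<in> {1..CARD('n) - d}" "j \<in> {1..CARD('n) - d}" "i \<le> j" for i j
  proof (rule component[OF that(2) less.prems(4)])
    fix q assume "q \<in> Q ?F"
    then have "NN ?F i j q \<in> face_dofs Q d ?F" unfolding face_dofs_def using that by blast
    from dofs[OF less.prems(1) F this]
    show "(LINT y:?F|flat_measure ?F. (\<nu> ?F i \<bullet> (\<tau> y *v \<nu> ?F j)) * q y) = 0" by simp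
  qed
  have normal': "\<nu> ?F j \<bullet> (\<tau> x *v \<nu> ?F i) = 0"
    if "i \<in> {1..CARD('n) - d}" "j \<in> {1..CARD('n) - d}" for i j
  proof (cases "i \<le> j")
    case True
    then show ?thesis
      using normal[OF that True] sym_mats_inner[OF polys_range[OF \<tau> subspace_sym_mats]] by metis
  next
    case False
    then show ?thesis using normal[OF that(2,1)] by simp
  qed
  have spans: "tangent_space ?F \<subseteq> span (t ?F ` {1..d})"
    "normal_vectors ?F \<subseteq> span (\<nu> ?F ` {1..CARD('n) - d})"
    by (rule lin_indep_vectors_span[OF tangents[OF less.prems(1) F] tangent_space_face[OF less.prems(2,3)]],
        rule lin_indep_vectors_span[OF normals[OF less.prems(1) F] dim_normal_vectors_face[OF less.prems(2,3)]])
  \<comment> \<open>The vector \<open>\<tau> x \<nu>\<^sub>i\<close> is orthogonal to the tangents, hence normal, and to the normals, hence zero.\<close>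
  have zero: "\<tau> x *v \<nu> ?F i = 0" if i: "i \<in> {1..CARD('n) - d}" for i
  proof -
    let ?u = "\<tau> x *v \<nu> ?F i"
    have "orthogonal ?u y" if "y \<in> tangent_space ?F" for y
      by (rule orthogonal_to_span[OF subsetD[OF spans(1) that]])
        (use tangential[OF _ i] in \<open>auto simp: orthogonal_def inner_commute\<close>)
    then have "?u \<in> normal_vectors ?F"
      by (simp add: normal_vectors_def orthogonal_comp_def orthogonal_commute)
    then have u: "?u \<in> span (\<nu> ?F ` {1..CARD('n) - d})" using spans(2) by blast
    have "orthogonal ?u ?u"
      by (rule orthogonal_to_span[OF u]) (use normal'[OF i] in \<open>auto simp: orthogonal_def inner_commute\<close>)
    then show ?thesis by (simp add: orthogonal_self)
  qed
  show ?case
    by (rule linear_eq_0_on_span[OF matrix_vector_mul_linear _ subsetD[OF spans(2) less.prems(5)]])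
      (use zero in auto)
qed

text \<open>
  A field with vanishing normal traces is a bubble field; the strain moments then make its divergence,
  a polynomial of degree at most \<open>k - 1\<close>, orthogonal to itself.
\<close>

lemma strain_moments_imp_divergence_free:
  assumes k: "k \<ge> 1" and m: "m \<ge> 2" and \<tau>: "\<tau> \<in> bubbles m" and div: "row_div \<tau> \<in> polys {..k - 1} UNIV"
    and mom: "\<And>v. v \<in> polys {..k - 1} UNIV \<Longrightarrow> simplex_integral (\<lambda>x. \<tau> x \<bullet> sym_grad v x) = 0"
  shows "row_div \<tau> x = 0"
proof (rule polys_vec_zeroI[OF div])
  fix x assume pos: "\<And>a. a \<in> V \<Longrightarrow> 0 < bary a x"
  have c: "continuous_on UNIV (\<lambda>x. row_div \<tau> x \<bullet> row_div \<tau> x)"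
    by (intro continuous_on_inner polys_continuous_vec[OF div])
  have z: "simplex_integral (\<lambda>x. row_div \<tau> x \<bullet> row_div \<tau> x) = 0"
    using simplex_integration_by_parts[OF m \<tau> div] mom[OF div] by simp
  have "row_div \<tau> x \<bullet> row_div \<tau> x = 0"
    by (rule simplex_integral_zero_imp[OF c _ z pos]) simp
  then show "row_div \<tau> x = 0" by simp
qed

end

theorem theorem3p2:
  fixes K :: "(real^'n) set" and n k :: nat
    and t \<nu> :: "(real^'n) set \<Rightarrow> nat \<Rightarrow> real^'n"
    and Q :: "(real^'n) set \<Rightarrow> (real^'n \<Rightarrow> real) set"
    and E M :: "(real^'n \<Rightarrow> real^'n^'n) set"
  assumes n: "n = CARD('n)"
    and k: "k > 2"
    and K: "int n simplex K"
    and tangents: "\<And>d F. \<lbrakk>d < n; F \<in> subsimplices d K\<rbrakk> \<Longrightarrow>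
          lin_indep_vectors (t F) d (tangent_space F)"
    and normals: "\<And>d F. \<lbrakk>d < n; F \<in> subsimplices d K\<rbrakk> \<Longrightarrow>
          lin_indep_vectors (\<nu> F) (n - d) (normal_vectors F)"
    and Q: "\<And>d F. \<lbrakk>d < n; F \<in> subsimplices d K\<rbrakk> \<Longrightarrow>
          is_basis (Q F) (polys_on F (k + n - d - 2))"
    and E: "is_basis E (sym_grad ` polys {..k - 1} UNIV)"
    and M: "is_basis M (M_space k K)"
  shows "unisolvent (P_star k)
           ((\<Union>d<n. \<Union>F\<in>subsimplices d K. face_dofs Q d F) \<union> Strain ` E \<union> Bubble ` M)
           (dof_val K t \<nu>)
       \<and> (\<forall>d<n. \<forall>F\<in>subsimplices d K.
            card (face_dofs Q d F) =
              ((n + 1 - d choose 2) + d * (n - d)) * (k + n - 2 choose d)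
          \<and> real (card (face_dofs Q d F)) =
              real ((n - d) * (n + d + 1)) / 2 * real (k + n - 2 choose d))
       \<and> real (card (Strain ` E)) = real (n * (n + k - 1 choose n)) - real (n * (n + 1)) / 2
       \<and> real (card (Bubble ` M)) =
            fact (k + 2 * n - 3) / (fact n * fact (k + n - 3)) * (real (n * (n + 1)) / 2)
            + real (n * (n + 1)) / 2
            - real n * (fact (k + 2 * n - 2) / (fact n * fact (k + n - 2)))"
proof -
  obtain V where V: "\<not> affine_dependent V" "int (card V) = int n + 1" and KV: "K = convex hull V"
    using K unfolding simplex by blast
  interpret simplex_vertices V by unfold_locales (use V n in auto)
  have n1: "n \<ge> 1" using n zero_less_card_finite[where 'a='n] by linarith
  have k1: "k \<ge> 1" and k2: "k \<ge> 2" using k by auto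
  \<comment> \<open>All fields in question have degree at most \<open>m\<close>.\<close>
  define m where "m = k + n - 1"
  have m2: "m \<ge> 2" using k n1 by (simp add: m_def)
  have cE: "2 * card edges = n * (n + 1)" using card_edges n by simp
  let ?W = "P_star k :: (real^'n \<Rightarrow> real^'n^'n) set"
  let ?S = "sym_grad ` (polys {..k - 1} UNIV :: (real^'n \<Rightarrow> real^'n) set)"
  let ?I = "(\<Union>d<n. \<Union>F\<in>subsimplices d K. face_dofs Q d F) \<union> Strain ` E \<union> Bubble ` M"
  have faceE: "\<exists>C. C \<subseteq> V \<and> C \<noteq> {} \<and> card C = d + 1 \<and> F = convex hull C" if "F \<in> subsimplices d K" for d F
  proof -
    from that[unfolded KV subsimplices_eq]
    obtain C where C: "F = convex hull C" "C \<in> {C. C \<subseteq> V \<and> card C = d + 1}" by (rule imageE)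
    then have "C \<noteq> {}" by auto
    with C show ?thesis by (intro exI[of _ C]) simp
  qed
  have Wm: "?W \<subseteq> polys {..m} sym_mats" using P_star_subset[OF k1] by (simp add: m_def n)
  have M_eq: "M_space k K = {\<tau> \<in> bubbles m. \<forall>x. row_div \<tau> x = 0}"
    unfolding KV M_space_eq[OF k1] by (simp add: m_def n)
  have Mm: "M_space k K \<subseteq> polys {..m} sym_mats" unfolding M_eq by (auto simp: bubbles_def)
  have Sm: "?S \<subseteq> polys {..k - 1} sym_mats"
  proof -
    have "?S \<subseteq> polys {..k - 1 - 1} sym_mats" using sym_grad_polys by blast
    also have "\<dots> \<subseteq> polys {..k - 1} sym_mats"
      by (rule polys_mono) (use subspace_0[OF subspace_sym_mats] in auto)
    finally show ?thesis .
  qed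
  have subM: "subspace (M_space k K)"
    unfolding M_eq
  proof -
    have "subspace {\<tau> \<in> bubbles m. row_div \<tau> = 0}"
      by (intro subspace_kernel_on subspace_bubbles linear_map_on_subset[OF linear_row_div[of "{..m}"]])
        (auto simp: bubbles_def)
    then show "subspace {\<tau> \<in> bubbles m. \<forall>x. row_div \<tau> x = 0}" by (simp add: fun_eq_iff zero_fun_def)
  qed
  have fdM: "finite_dim (M_space k K)" by (rule finite_dim_subset[OF finite_dim_polys_sym Mm])

  have Qdim: "dim (polys_on F (k + n - d - 2)) = (k + n - 2) choose d" and Qfin: "finite_dim (polys_on F (k + n - d - 2))"
    if d: "d < n" and F: "F \<in> subsimplices d K" for d F
  proof -
    obtain C where C: "C \<subseteq> V" "C \<noteq> {}" "card C = d + 1" "F = convex hull C" using faceE[OF F] by blast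
    have "k + n - d - 2 + d = k + n - 2" using d k by linarith
    then show "dim (polys_on F (k + n - d - 2)) = (k + n - 2) choose d"
      using dim_polys_on_face(1)[OF C(1,2), of "k + n - d - 2"] by (simp add: C(3,4))
    show "finite_dim (polys_on F (k + n - d - 2))"
      using dim_polys_on_face(2)[OF C(1,2)] by (simp add: C(4))
  qed
  have face_card: "card (face_dofs Q d F) = ((n + 1 - d choose 2) + d * (n - d)) * (k + n - 2 choose d)"
    and face_fin: "finite (face_dofs Q d F)"
    if d: "d < n" and F: "F \<in> subsimplices d K" for d F
    using card_face_dofs[of Q F d] finite_face_dofs[of Q F d] is_basis_card[OF Q[OF d F] Qfin[OF d F]]
      Qdim[OF d F] d n by auto
  have fE: "finite E" "card E = dim ?S" using is_basis_card[OF E finite_dim_strains[OF k2]] by auto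
  have fM: "finite M" "card M = dim (M_space k K)" using is_basis_card[OF M fdM] by auto
  have cS: "card (Strain ` E) = card E" and cB: "card (Bubble ` M) = card M"
    by (auto intro!: card_image simp: inj_on_def)
  have Ecount: "card E + card edges = n * (n + k - 1 choose n)"
    using dim_strains[OF k2] k n1 by (simp add: fE n add.commute)
  have Mcount: "n * (k + 2 * n - 2 choose n) + card M = card edges + card edges * (k + 2 * n - 3 choose n)"
    using dim_M_space[OF k2] by (simp add: fM KV n)

  have Ifin: "finite ?I"
    using face_fin finite_subsimplices fE(1) fM(1) unfolding KV by auto

  have vanish: "\<tau> = 0" if \<tau>: "\<tau> \<in> ?W" and z: "\<forall>i\<in>?I. dof_val K t \<nu> i \<tau> = 0" for \<tau>
  proof -
    have \<tau>m: "\<tau> \<in> polys {..m} sym_mats" and div: "row_div \<tau> \<in> polys {..k - 1} UNIV"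
      using \<tau> P_star_eq[OF k1] Wm by auto
    \<comment> \<open>Each group of degrees of freedom removes one part: the normal traces, the divergence, the bubble.\<close>
    have trace: "\<tau> x *v \<nu>' = 0"
      if "C \<subseteq> V" "card C = n" "x \<in> convex hull C" "\<nu>' \<in> normal_vectors (convex hull C)" for C x \<nu>'
    proof (rule face_moments_imp_normal_trace_zero[where Q = Q and K = K and t = t and \<nu> = \<nu> and k = k
          and d = "n - 1" and C = C, OF k1])
      show "\<tau> \<in> polys {..k + CARD('n) - 1} sym_mats" using \<tau>m by (simp add: m_def n)
      fix d F assume "d < CARD('n)" "F \<in> subsimplices d (convex hull V)"
      then have dF: "d < n" "F \<in> subsimplices d K" by (auto simp: KV n)
      show "lin_indep_vectors (t F) d (tangent_space F)" by (rule tangents[OF dF])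
      show "lin_indep_vectors (\<nu> F) (CARD('n) - d) (normal_vectors F)"
        using normals[OF dF] by (simp only: n)
      show "is_basis (Q F) (polys_on F (k + CARD('n) - d - 2))" using Q[OF dF] by (simp only: n)
      show "dof_val K t \<nu> \<delta> \<tau> = 0" if "\<delta> \<in> face_dofs Q d F" for \<delta>
        using z that dF by blast
    next
      show "n - 1 < CARD('n)" "card C = n - 1 + 1" using n n1 that(2) by linarith+
    qed (use that in auto)
    have \<tau>B: "\<tau> \<in> bubbles m"
      unfolding bubbles_iff_facets
    proof (intro conjI \<tau>m allI impI ballI)
      fix F x \<nu>' assume "F facet_of convex hull V" and x: "x \<in> F" "\<nu>' \<in> normal_vectors F"
      then obtain a where a: "a \<in> V" "F = convex hull (V - {a})" using facet_iff by blast
      have "card (V - {a}) = n" using a card_V finite_V n by simp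
      then show "\<tau> x *v \<nu>' = 0" using trace[of "V - {a}"] x a by auto
    qed
    have strain: "simplex_integral (\<lambda>x. \<tau> x \<bullet> \<theta> x) = 0" if \<theta>: "\<theta> \<in> ?S" for \<theta>
    proof -
      have "simplex_integral (\<lambda>x. \<theta> x \<bullet> \<tau> x) = 0"
      proof (rule is_basis_annihilates[OF E finite_dim_strains[OF k2] subspace_strains[OF k2] _ _ \<theta>])
        show "linear_map_on ?S (\<lambda>\<theta>. simplex_integral (\<lambda>x. \<theta> x \<bullet> \<tau> x))"
          by (rule linear_map_on_subset[OF linear_simplex_moment[OF \<tau>m] Sm])
        fix \<eta> assume "\<eta> \<in> E"
        then have "dof_val K t \<nu> (Strain \<eta>) \<tau> = 0" using z by blast
        then show "simplex_integral (\<lambda>x. \<eta> x \<bullet> \<tau> x) = 0" by (simp add: KV inner_commute)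
      qed
      then show ?thesis by (simp add: inner_commute)
    qed
    have "row_div \<tau> x = 0" for x
      by (rule strain_moments_imp_divergence_free[OF k1 m2 \<tau>B div]) (auto intro!: strain)
    then have \<tau>M: "\<tau> \<in> M_space k K" unfolding M_eq using \<tau>B by simp
    have "simplex_integral (\<lambda>x. \<tau> x \<bullet> \<tau> x) = 0"
    proof (rule is_basis_annihilates[where \<phi> = "\<lambda>\<theta>. simplex_integral (\<lambda>x. \<theta> x \<bullet> \<tau> x)", OF M fdM subM _ _ \<tau>M])
      show "linear_map_on (M_space k K) (\<lambda>\<theta>. simplex_integral (\<lambda>x. \<theta> x \<bullet> \<tau> x))"
        by (rule linear_map_on_subset[OF linear_simplex_moment[OF \<tau>m] Mm])
      fix \<eta> assume "\<eta> \<in> M"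
      then have "dof_val K t \<nu> (Bubble \<eta>) \<tau> = 0" using z by blast
      then show "simplex_integral (\<lambda>x. \<eta> x \<bullet> \<tau> x) = 0" by (simp add: KV inner_commute)
    qed
    then show "\<tau> = 0" by (rule polys_sym_zeroI[OF \<tau>m])
  qed

  have dof_linear: "linear_map_on ?W (dof_val K t \<nu> i)" if i: "i \<in> ?I" for i
  proof -
    consider d F where "d < n" "F \<in> subsimplices d K" "i \<in> face_dofs Q d F"
      | \<eta> where "\<eta> \<in> E" "i = Strain \<eta>" | \<eta> where "\<eta> \<in> M" "i = Bubble \<eta>"
      using i by blast
    then show ?thesis
    proof cases
      case 1
      obtain C where C: "C \<subseteq> V" "C \<noteq> {}" "F = convex hull C" using faceE[OF 1(2)] by blast
      have Qsub: "Q F \<subseteq> polys_on F (k + n - d - 2)" using Q[OF 1(1,2)] by (simp add: is_basis_def)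
      have lin: "linear_map_on ?W (\<lambda>\<tau>. LINT x:F|flat_measure F. (w \<bullet> (\<tau> x *v \<mu>)) * q x)"
        if "q \<in> Q F" for w \<mu> q
        unfolding C(3)
        by (rule linear_map_on_subset[OF linear_face_moment[OF C(1,2)] Wm]) (use that Qsub C(3) in blast)
      consider l j q where "i = TN F l j q" "q \<in> Q F" | a b q where "i = NN F a b q" "q \<in> Q F"
        using 1(3) unfolding face_dofs_def by blast
      then show ?thesis
      proof cases
        case (1 l j q)
        then show ?thesis using lin[of q "t F l" "\<nu> F j"] by (simp add: linear_map_on_def)
      next
        case (2 a b q)
        then show ?thesis using lin[of q "\<nu> F a" "\<nu> F b"] by (simp add: linear_map_on_def)
      qed
    next
      case 2
      then have "\<eta> \<in> polys {..k - 1} sym_mats" using E Sm unfolding is_basis_def by blast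
      from linear_map_on_subset[OF linear_simplex_moment[OF this] Wm]
      show ?thesis using 2 by (simp add: KV linear_map_on_def)
    next
      case 3
      then have "\<eta> \<in> polys {..m} sym_mats" using M Mm unfolding is_basis_def by blast
      from linear_map_on_subset[OF linear_simplex_moment[OF this] Wm]
      show ?thesis using 3 by (simp add: KV linear_map_on_def)
    qed
  qed

  have dim_le: "dim ?W \<le> card ?I"
  proof -
    have "{v \<in> ?W. \<forall>i\<in>?I. dof_val K t \<nu> i v = 0} \<subseteq> {0}" using vanish by blast
    then have "dim {v \<in> ?W. \<forall>i\<in>?I. dof_val K t \<nu> i v = 0} \<le> 0"
      using dim_le_card[of "{v \<in> ?W. \<forall>i\<in>?I. dof_val K t \<nu> i v = 0}" "{}"] by simp
    moreover have "dim ?W \<le> dim {v \<in> ?W. \<forall>i\<in>?I. dof_val K t \<nu> i v = 0} + card ?I"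
      by (rule dim_le_dim_annihilator[OF Ifin subspace_P_star[OF k1] finite_dim_P_star[OF k1] dof_linear])
    ultimately show ?thesis by linarith
  qed

  have card_I: "card ?I = (\<Sum>d<n. (n + 1 choose (d + 1)) * (((n + 1 - d choose 2) + d * (n - d)) * (k + n - 2 choose d)))
      + card E + card M"
  proof -
    have faces: "card (\<Union>d<n. \<Union>F\<in>subsimplices d K. face_dofs Q d F) =
        (\<Sum>d<n. (n + 1 choose (d + 1)) * (((n + 1 - d choose 2) + d * (n - d)) * (k + n - 2 choose d)))"
      unfolding KV n[symmetric] using face_card face_fin
      by (subst card_all_face_dofs[where c = "\<lambda>d. ((n + 1 - d choose 2) + d * (n - d)) * (k + n - 2 choose d)"])
        (auto simp: KV n[symmetric])
    have fin: "finite (\<Union>d<n. \<Union>F\<in>subsimplices d K. face_dofs Q d F)"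
      using Ifin by (rule finite_subset[rotated]) blast
    have "(\<Union>d<n. \<Union>F\<in>subsimplices d K. face_dofs Q d F) \<inter> Strain ` E = {}"
      "((\<Union>d<n. \<Union>F\<in>subsimplices d K. face_dofs Q d F) \<union> Strain ` E) \<inter> Bubble ` M = {}"
      unfolding face_dofs_def by auto
    then show ?thesis
      using fin fE(1) fM(1) by (simp add: card_Un_disjoint faces cS cB)
  qed

  \<comment> \<open>The rigid motions cancel: they are missing from the strains and counted by the bubble fields.\<close>
  have dim_ge: "card ?I \<le> dim ?W"
  proof -
    define N where "N = k + n - 2"
    let ?A = "\<lambda>d. (n + 1 choose (d + 1)) * (((n + 1 - d choose 2) + d * (n - d)) * (N choose d))"
    have "(\<Sum>d<n. ?A d) + card edges * (N + n - 1 choose n) = card edges * (N + n + 1 choose n)"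
      by (rule face_dof_total[OF n1 cE])
    moreover have "N + n + 1 = k + 2 * n - 1" "N + n - 1 = k + 2 * n - 3" "n + k - 1 = k - 1 + n"
      using n1 k by (auto simp: N_def)
    ultimately have "(\<Sum>d<n. ?A d) + card edges * (k + 2 * n - 3 choose n) = card edges * (k + 2 * n - 1 choose n)"
      and "card E + card edges = n * (k - 1 + n choose n)"
      using Ecount by (simp_all only:)
    moreover have "card edges * (k + 2 * n - 1 choose n) + n * (k - 1 + n choose n) \<le> dim ?W + n * (k + 2 * n - 2 choose n)"
      using dim_P_star_ge[OF k1] by (simp only: n)
    moreover have "card ?I = (\<Sum>d<n. ?A d) + card E + card M" using card_I by (simp only: N_def)
    ultimately show ?thesis using Mcount by linarith
  qed

  have unisolvent: "unisolvent ?W ?I (dof_val K t \<nu>)"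
    unfolding unisolvent_def using Ifin vanish dim_le dim_ge by auto
  have face_card_real: "real (card (face_dofs Q d F)) = real ((n - d) * (n + d + 1)) / 2 * real (k + n - 2 choose d)"
    if d: "d < n" and F: "F \<in> subsimplices d K" for d F
  proof -
    have "2 * card (face_dofs Q d F) = (n - d) * (n + d + 1) * (k + n - 2 choose d)"
      using twice_component_count[of d n] d unfolding face_card[OF d F] by (simp only: mult.assoc[symmetric])
    then have "2 * real (card (face_dofs Q d F)) = real ((n - d) * (n + d + 1)) * real (k + n - 2 choose d)"
      by (metis of_nat_mult of_nat_numeral)
    then show ?thesis by simp
  qed
  have cE_real: "real (card edges) = real (n * (n + 1)) / 2"
    using cE by (metis nonzero_mult_div_cancel_left of_nat_mult of_nat_numeral zero_neq_numeral)
  have E_real: "real (card (Strain ` E)) = real (n * (n + k - 1 choose n)) - real (n * (n + 1)) / 2"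
    unfolding cS cE_real[symmetric] Ecount[symmetric] by simp
  have b1: "real (k + 2 * n - 3 choose n) = fact (k + 2 * n - 3) / (fact n * fact (k + n - 3))"
  proof -
    have "n \<le> k + 2 * n - 3" and sub: "k + 2 * n - 3 - n = k + n - 3" using k n1 by linarith+
    from binomial_fact[OF this(1), where 'a = real] show ?thesis unfolding sub .
  qed
  have b2: "real (k + 2 * n - 2 choose n) = fact (k + 2 * n - 2) / (fact n * fact (k + n - 2))"
  proof -
    have "n \<le> k + 2 * n - 2" and sub: "k + 2 * n - 2 - n = k + n - 2" using k n1 by linarith+
    from binomial_fact[OF this(1), where 'a = real] show ?thesis unfolding sub .
  qed
  have "real (n * (k + 2 * n - 2 choose n) + card M) = real (card edges + card edges * (k + 2 * n - 3 choose n))"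
    by (simp only: Mcount)
  then have M_real: "real (card (Bubble ` M)) =
      fact (k + 2 * n - 3) / (fact n * fact (k + n - 3)) * (real (n * (n + 1)) / 2)
      + real (n * (n + 1)) / 2 - real n * (fact (k + 2 * n - 2) / (fact n * fact (k + n - 2)))"
    unfolding cB b1[symmetric] b2[symmetric] cE_real[symmetric] by (simp add: algebra_simps)
  show ?thesis
    using unisolvent face_card face_card_real E_real M_real by blast
qed

end
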